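(* Let $\gamma=2^{-1/m}$ for some integer $m\ge7$, and let $\xi\in[0,1]$. Then the function $$\phi(u)=E\big[\exp\big(iu(I_1(f)+I_2(\widetilde g))\big)\big],\qquad u\in\mathbb{R},$$ belongs to $L^2(\mathbb{R})$. Consequently, the Takagi function $\mathcal{T}:[0,1]\to\mathbb{R}$, $\mathcal{T}(y)=\sum_{n=0}^\infty\gamma^n d(2^ny,\mathbb{Z})$, has a square integrable occupation density.
   Context: $d(y,\mathbb{Z})$ is the distance from $y$ to the nearest integer, $\kappa=\frac1{2\gamma}$. $(X_n)_{n\ge1}$ is an i.i.d. sequence with $P(X_n=\pm1)=\frac12$; $I_1(f)=\sum_{n\ge1}f(n)X_n$, $I_2(\widetilde g)=\sum_{n,k\ge1}\widetilde g(n,k)X_nX_k$, where $$f(n)=\gamma^n\Big[\kappa^2+\frac{(1+\kappa)\kappa^n}{2}S(\xi,0)\Big],\qquad \widetilde g=-\frac{\kappa^2}{2}g,\qquad g(i,j)=\frac12\gamma^{\frac{i+j}{2}}\Big(\frac{\kappa}{2}\Big)^{\frac{|i-j|}{2}}1_{\{i\neq j\}}.$$ Here $S(\xi,0)=\sum_{n=0}^\infty\big(1_{\{\bar\xi_{-n}=0\}}-1_{\{\bar\xi_{-n}=1\}}\big)\kappa^{n+1}$, where $\xi=\sum_{n\ge0}\bar\xi_{-n}2^{-(n+1)}$ is the binary expansion of $\xi$ (not ending in zeros if there are two). The occupation measure of a measurable $F:[0,1]\to\mathbb{R}$ is $\mu_F(A)=\lambda(\{x\in[0,1]:F(x)\in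 A\})$, $\lambda$ Lebesgue measure; $F$ has a square integrable occupation density if $\mu_F$ is absolutely continuous with respect to Lebesgue measure with density in $L^2(\mathbb{R})$. *)

theory Defs
  imports "HOL-Probability.Probability"
begin

section \<open>Binary expansions\<close>

text \<open>The digit \<open>b n\<close> has weight \<open>2^-(n+1)\<close>; it is the digit indexed by \<open>-n\<close> in the usual
  two-sided notation.\<close>

definition binary_expansion :: "real \<Rightarrow> (nat \<Rightarrow> nat) \<Rightarrow> bool" where
  "binary_expansion \<xi> b \<longleftrightarrow> (\<forall>n. b n \<in> {0, 1}) \<and> (\<lambda>n. real (b n) / 2 ^ (n + 1)) sums \<xi>"

definition ends_in_zeros :: "(nat \<Rightarrow> nat) \<Rightarrow> bool" where
  "ends_in_zeros b \<longleftrightarrow> (\<exists>N. \<forall>n\<ge>N. b n = 0)"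

text \<open>If there are two expansions, the one not ending in zeros is chosen.  The point \<open>0\<close> has the
  zero expansion only.\<close>

definition canonical_expansion :: "real \<Rightarrow> (nat \<Rightarrow> nat) \<Rightarrow> bool" where
  "canonical_expansion \<xi> b \<longleftrightarrow> binary_expansion \<xi> b \<and>
     ((\<exists>b'. b' \<noteq> b \<and> binary_expansion \<xi> b') \<longrightarrow> \<not> ends_in_zeros b)"

definition binary_digit :: "real \<Rightarrow> nat \<Rightarrow> nat" where
  "binary_digit \<xi> = (THE b. canonical_expansion \<xi> b)"

lemma canonical_expansion_unique:
  assumes "canonical_expansion \<xi> b" "canonical_expansion \<xi> c"
  shows "b = c"
proof (rule ccontr)
  assume ne: "b \<noteq> c"
  have aux: False
    if b: "canonical_expansion \<xi> b" and c: "canonical_expansion \<xi> c"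
      and eq: "\<And>n. n < k \<Longrightarrow> b n = c n" and k: "b k = 0" "c k = 1" for b c k
  proof -
    have bs: "(\<lambda>n. real (b n) / 2 ^ (n + 1)) sums \<xi>" and b01: "\<And>n. b n \<in> {0, 1}"
      and cs: "(\<lambda>n. real (c n) / 2 ^ (n + 1)) sums \<xi>" and c01: "\<And>n. c n \<in> {0, 1}"
      using b c by (auto simp: canonical_expansion_def binary_expansion_def)
    define p where "p = (\<Sum>n<k. real (b n) / 2 ^ (n + 1))"
    have p': "p = (\<Sum>n<k. real (c n) / 2 ^ (n + 1))"
      unfolding p_def using eq by simp
    have bt: "(\<lambda>n. real (b (n + Suc k)) / 2 ^ (n + Suc k + 1)) sums (\<xi> - p)"
      using sums_split_initial_segment[OF bs, of "Suc k"] k by (simp add: p_def)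
    have ct: "(\<lambda>n. real (c (n + Suc k)) / 2 ^ (n + Suc k + 1)) sums (\<xi> - p - 1 / 2 ^ (k + 1))"
      using sums_split_initial_segment[OF cs, of "Suc k"] k by (simp add: p' algebra_simps)
    have geo: "(\<lambda>n. 1 / 2 ^ (n + Suc k + 1) :: real) sums (1 / 2 ^ (k + 1))"
      using sums_mult[OF power_half_series, of "1 / 2 ^ (k + 1)"]
      by (simp add: power_add field_simps)
    have "\<xi> - p \<le> 1 / 2 ^ (k + 1)"
    proof (rule sums_le[OF _ bt geo])
      fix n
      show "real (b (n + Suc k)) / 2 ^ (n + Suc k + 1) \<le> 1 / 2 ^ (n + Suc k + 1)"
        using b01[of "n + Suc k"] by auto
    qed
    moreover have "0 \<le> \<xi> - p - 1 / 2 ^ (k + 1)"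
      by (rule sums_le[OF _ sums_zero ct]) simp
    ultimately have "(\<lambda>n. real (c (n + Suc k)) / 2 ^ (n + Suc k + 1)) sums 0"
      using ct by simp
    then have "real (c (n + Suc k)) / 2 ^ (n + Suc k + 1) = 0" for n
      using suminf_eq_zero_iff[OF sums_summable, of "\<lambda>n. real (c (n + Suc k)) / 2 ^ (n + Suc k + 1)" 0]
        sums_unique[of "\<lambda>n. real (c (n + Suc k)) / 2 ^ (n + Suc k + 1)" 0]
      by simp
    then have "c (n + Suc k) = 0" for n
      by simp
    then have "c n = 0" if "n \<ge> Suc k" for n
      using that by (metis le_add_diff_inverse2)
    then have "ends_in_zeros c"
      by (auto simp: ends_in_zeros_def)
    moreover have "b \<noteq> c"
      using k by auto
    ultimately show False
      using b c by (auto simp: canonical_expansion_def)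
  qed
  define k where "k = (LEAST n. b n \<noteq> c n)"
  have "\<exists>n. b n \<noteq> c n"
    using ne by (simp add: fun_eq_iff)
  then have "b k \<noteq> c k"
    unfolding k_def by (rule LeastI_ex[where P = "\<lambda>n. b n \<noteq> c n"])
  moreover have eq: "b n = c n" if "n < k" for n
    using not_less_Least[of n "\<lambda>n. b n \<noteq> c n"] that by (simp add: k_def)
  moreover have "b k \<in> {0, 1}" "c k \<in> {0, 1}"
    using assms by (auto simp: canonical_expansion_def binary_expansion_def)
  ultimately have "b k = 0 \<and> c k = 1 \<or> c k = 0 \<and> b k = 1"
    by auto
  then show False
  proof
    assume "b k = 0 \<and> c k = 1"
    then show False using aux[OF assms eq, of k] by simp
  next
    assume "c k = 0 \<and> b k = 1"
    then show False using aux[OF assms(2,1) eq[symmetric], of k] by simp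
  qed
qed

lemma canonical_expansion_exists:
  assumes "\<xi> \<in> {0..1}"
  shows "\<exists>b. canonical_expansion \<xi> b"
proof (cases "\<xi> = 0")
  case True
  have "binary_expansion \<xi> (\<lambda>_. 0)"
    by (simp add: binary_expansion_def True)
  moreover have "b = (\<lambda>_. 0)" if "binary_expansion \<xi> b" for b
  proof
    fix n
    have "(\<lambda>n. real (b n) / 2 ^ (n + 1)) sums 0"
      using that by (simp add: binary_expansion_def True)
    then have "real (b n) / 2 ^ (n + 1) = 0"
      using suminf_eq_zero_iff[OF sums_summable, of "\<lambda>n. real (b n) / 2 ^ (n + 1)" 0]
        sums_unique[of "\<lambda>n. real (b n) / 2 ^ (n + 1)" 0] by simp
    then show "b n = 0" by simp
  qed
  ultimately have "canonical_expansion \<xi> (\<lambda>_. 0)"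
    unfolding canonical_expansion_def by blast
  then show ?thesis by (rule exI[where x = "\<lambda>_. 0"])
next
  case False
  then have \<xi>: "0 < \<xi>" "\<xi> \<le> 1" using assms by auto
  define c where "c n = \<lceil>2 ^ n * \<xi>\<rceil> - 1" for n :: nat
  define b where "b n = nat (c (Suc n) - 2 * c n)" for n
  have c_up: "real_of_int (c n) < 2 ^ n * \<xi>" and c_lo: "2 ^ n * \<xi> - 1 \<le> real_of_int (c n)" for n
    unfolding c_def by linarith+
  have dig: "c (Suc n) - 2 * c n \<in> {0, 1}" for n
  proof -
    have "real_of_int (c (Suc n)) < 2 * (2 ^ n * \<xi>)" "2 * (2 ^ n * \<xi>) - 1 \<le> real_of_int (c (Suc n))"
      using c_up[of "Suc n"] c_lo[of "Suc n"] by (simp_all add: mult.assoc)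
    with c_up[of n] c_lo[of n]
    have "real_of_int (c (Suc n) - 2 * c n) < 2" "real_of_int (c (Suc n) - 2 * c n) > - 1"
      by simp_all
    then have "c (Suc n) - 2 * c n < 2" "c (Suc n) - 2 * c n > - 1"
      by linarith+
    then show ?thesis by auto
  qed
  have b_int: "int (b n) = c (Suc n) - 2 * c n" for n
    using dig[of n] by (auto simp: b_def)
  have b_real: "real (b n) = real_of_int (c (Suc n)) - 2 * real_of_int (c n)" for n
    using arg_cong[OF b_int, of real_of_int] by simp
  have c0: "c 0 = 0"
    using \<xi> by (simp add: c_def ceiling_eq_iff)
  have part: "(\<Sum>k<n. real (b k) / 2 ^ (k + 1)) = real_of_int (c n) / 2 ^ n" for n
    by (induction n) (simp_all add: c0 b_real field_simps)
  have "(\<lambda>n. real_of_int (c n) / 2 ^ n) \<longlonglongrightarrow> \<xi>"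
  proof (rule tendsto_sandwich[where f = "\<lambda>n. \<xi> - (1 / 2) ^ n" and h = "\<lambda>_. \<xi>"])
    show "\<forall>\<^sub>F n in sequentially. \<xi> - (1 / 2) ^ n \<le> real_of_int (c n) / 2 ^ n"
    proof (rule always_eventually, rule allI)
      fix n
      show "\<xi> - (1 / 2) ^ n \<le> real_of_int (c n) / 2 ^ n"
        using divide_right_mono[OF c_lo[of n], of "2 ^ n"]
        by (simp add: diff_divide_distrib power_one_over)
    qed
    show "\<forall>\<^sub>F n in sequentially. real_of_int (c n) / 2 ^ n \<le> \<xi>"
    proof (rule always_eventually, rule allI)
      fix n
      show "real_of_int (c n) / 2 ^ n \<le> \<xi>"
        using c_up[of n] by (simp add: field_simps)
    qed
    show "(\<lambda>n. \<xi> - (1 / 2) ^ n) \<longlonglongrightarrow> \<xi>"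
      using tendsto_diff[OF tendsto_const LIMSEQ_power_zero[of "1 / 2 :: real"], of \<xi>] by simp
  qed simp
  then have "(\<lambda>n. real (b n) / 2 ^ (n + 1)) sums \<xi>"
    unfolding sums_def part .
  moreover have "b n \<in> {0, 1}" for n
    using dig[of n] by (auto simp: b_def)
  ultimately have "binary_expansion \<xi> b"
    by (simp add: binary_expansion_def)
  moreover have "\<not> ends_in_zeros b"
  proof
    assume "ends_in_zeros b"
    then obtain N where N: "\<And>n. n \<ge> N \<Longrightarrow> b n = 0"
      by (auto simp: ends_in_zeros_def)
    have "(\<lambda>n. real (b n) / 2 ^ (n + 1)) sums (\<Sum>n<N. real (b n) / 2 ^ (n + 1))"
      by (rule sums_finite) (auto simp: N not_less)
    then have "\<xi> = real_of_int (c N) / 2 ^ N"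
      using sums_unique2[OF \<open>(\<lambda>n. real (b n) / 2 ^ (n + 1)) sums \<xi>\<close>] part[of N] by simp
    then show False
      using c_up[of N] by simp
  qed
  ultimately show ?thesis
    unfolding canonical_expansion_def by blast
qed

lemma binary_digit_canonical:
  assumes "\<xi> \<in> {0..1}"
  shows "canonical_expansion \<xi> (binary_digit \<xi>)"
proof -
  obtain b where "canonical_expansion \<xi> b"
    using canonical_expansion_exists[OF assms] ..
  then show ?thesis
    unfolding binary_digit_def by (rule theI[of "canonical_expansion \<xi>"])
      (rule canonical_expansion_unique[OF _ \<open>canonical_expansion \<xi> b\<close>])
qed


section \<open>The Rademacher chaos\<close>

definition kappa :: "real \<Rightarrow> real" where
  "kappa \<gamma> = 1 / (2 * \<gamma>)"

text \<open>The quantity \<open>S(\<xi>, 0)\<close>.\<close>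

definition S0 :: "real \<Rightarrow> real \<Rightarrow> real" where
  "S0 \<gamma> \<xi> = (\<Sum>n. (of_bool (binary_digit \<xi> n = 0) - of_bool (binary_digit \<xi> n = 1))
                     * kappa \<gamma> ^ (n + 1))"

definition f_coeff :: "real \<Rightarrow> real \<Rightarrow> nat \<Rightarrow> real" where
  "f_coeff \<gamma> \<xi> n =
     \<gamma> ^ n * ((kappa \<gamma>)\<^sup>2 + (1 + kappa \<gamma>) * kappa \<gamma> ^ n / 2 * S0 \<gamma> \<xi>)"

definition g_coeff :: "real \<Rightarrow> nat \<Rightarrow> nat \<Rightarrow> real" where
  "g_coeff \<gamma> i j =
     1 / 2 * \<gamma> powr ((real i + real j) / 2) * (kappa \<gamma> / 2) powr (\<bar>real i - real j\<bar> / 2)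
       * of_bool (i \<noteq> j)"

definition g_tilde :: "real \<Rightarrow> nat \<Rightarrow> nat \<Rightarrow> real" where
  "g_tilde \<gamma> i j = - ((kappa \<gamma>)\<^sup>2 / 2) * g_coeff \<gamma> i j"

text \<open>Only the variables \<open>X n\<close> with \<open>n \<ge> 1\<close> are constrained.\<close>

definition rademacher_sequence :: "'a measure \<Rightarrow> (nat \<Rightarrow> 'a \<Rightarrow> real) \<Rightarrow> bool" where
  "rademacher_sequence M X \<longleftrightarrow>
     prob_space M \<and> prob_space.indep_vars M (\<lambda>_. borel) X {1..} \<and>
     (\<forall>n\<ge>1. measure M {\<omega> \<in> space M. X n \<omega> = 1} = 1 / 2 \<and>
            measure M {\<omega> \<in> space M. X n \<omega> = - 1} = 1 / 2)"

definition I1 :: "(nat \<Rightarrow> 'a \<Rightarrow> real) \<Rightarrow> (nat \<Rightarrow> real) \<Rightarrow> 'a \<Rightarrow> real" where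
  "I1 X f \<omega> = (\<Sum>\<^sub>\<infinity>n\<in>{1..}. f n * X n \<omega>)"

definition I2 :: "(nat \<Rightarrow> 'a \<Rightarrow> real) \<Rightarrow> (nat \<Rightarrow> nat \<Rightarrow> real) \<Rightarrow> 'a \<Rightarrow> real" where
  "I2 X h \<omega> = (\<Sum>\<^sub>\<infinity>(n, k)\<in>{1..} \<times> {1..}. h n k * X n \<omega> * X k \<omega>)"

definition chaos_char ::
    "'a measure \<Rightarrow> (nat \<Rightarrow> 'a \<Rightarrow> real) \<Rightarrow> real \<Rightarrow> real \<Rightarrow> real \<Rightarrow> complex" where
  "chaos_char M X \<gamma> \<xi> u =
     (LINT \<omega>|M. exp (\<i> * complex_of_real u *
        complex_of_real (I1 X (f_coeff \<gamma> \<xi>) \<omega> + I2 X (g_tilde \<gamma>) \<omega>)))"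


section \<open>Square integrability and occupation densities\<close>

definition square_integrable :: "(real \<Rightarrow> 'b::{real_normed_vector, second_countable_topology}) \<Rightarrow> bool" where
  "square_integrable f \<longleftrightarrow> f \<in> borel_measurable lborel \<and> integrable lborel (\<lambda>x. (norm (f x))\<^sup>2)"

text \<open>Values of \<open>F\<close> outside \<open>[0,1]\<close> play no role.  Measurability is that of Lebesgue, not only Borel,
  measurable functions.\<close>

definition occupation_measure :: "(real \<Rightarrow> real) \<Rightarrow> real measure" where
  "occupation_measure F = distr (lebesgue_on {0..1}) borel F"

definition has_square_integrable_occupation_density :: "(real \<Rightarrow> real) \<Rightarrow> bool" where
  "has_square_integrable_occupation_density F \<longleftrightarrow>
     F \<in> borel_measurable (lebesgue_on {0..1}) \<and>
     absolutely_continuous lborel (occupation_measure F) \<and>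
     (\<exists>\<rho>. (\<forall>x. 0 \<le> \<rho> x) \<and> square_integrable \<rho> \<and>
          occupation_measure F = density lborel (\<lambda>x. ennreal (\<rho> x)))"

lemma emeasure_occupation_measure:
  assumes "F \<in> borel_measurable (lebesgue_on {0..1})" "A \<in> sets borel"
  shows "emeasure (occupation_measure F) A = emeasure lebesgue {x \<in> {0..1}. F x \<in> A}"
proof -
  have "emeasure (occupation_measure F) A = emeasure (lebesgue_on {0..1}) (F -` A \<inter> {0..1})"
    unfolding occupation_measure_def using assms by (subst emeasure_distr) auto
  also have "\<dots> = emeasure lebesgue (F -` A \<inter> {0..1})"
    by (rule emeasure_restrict_space) auto
  also have "F -` A \<inter> {0..1} = {x \<in> {0..1}. F x \<in> A}"
    by auto
  finally show ?thesis .
qed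

text \<open>Here \<open>infdist y \<int>\<close> is the distance of \<open>y\<close> to the nearest integer.\<close>

definition takagi :: "real \<Rightarrow> real \<Rightarrow> real" where
  "takagi \<gamma> y = (\<Sum>n. \<gamma> ^ n * infdist (2 ^ n * y) \<int>)"

end

theory Submission
  imports Defs
begin

text \<open>For \<open>i < j\<close> one has \<open>g i j = \<gamma>^i / 2^(j - i + 1)\<close>.  Hence both characteristic functions are limits of
  means over the cube \<open>{-1, 1}^N\<close> of a product weight times \<open>exp (i u Q)\<close>, where \<open>Q x\<close> is the sum of
  \<open>\<gamma>^i 2^-(j - i) x\<^sub>i x\<^sub>j\<close> over \<open>i < j\<close>: the linear part of the chaos is absorbed into the weight, and at dyadic
  midpoints the Takagi function is affine in \<open>Q\<close>.

  The square of such a mean is \<open>O (\<bar>u\<bar>^(-5/4))\<close> uniformly in the weight.  Split \<open>x\<close> into \<open>w\<close>, \<open>p\<close>, \<open>q\<close>, where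
  \<open>w\<close> has about \<open>n = log\<^sub>2 \<bar>u\<bar>\<close> digits and \<open>p\<close> has \<open>n + 3\<close>.  The interaction of \<open>w\<close> and \<open>p\<close> is \<open>u \<gamma>^n S(w) U(p)\<close>,
  with \<open>U(p)\<close> equidistributed over dyadic midpoints and \<open>S(w)\<close> a truncated Bernoulli convolution with ratio
  \<open>\<kappa>\<close>; as \<open>\<kappa>\<^sup>2\<close> is close to \<open>1/4\<close>, \<open>S(w)\<close> lies in a given interval of length \<open>\<delta>\<close> with probability at
  most of order \<open>\<delta>^(1/2)\<close>.  A large sieve inequality bounds the squared mean by \<open>O ((\<bar>u\<bar> \<gamma>^n)^(-1/2))\<close> times the
  squared mean over \<open>q\<close> at frequency \<open>u \<gamma>^(2n + 3)\<close>, and iteration gives the decay because \<open>m \<ge> 7\<close>.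

  Finally, a law with square integrable characteristic function has a square integrable density: by Gaussian
  regularisation, two independent copies are within \<open>r\<close> of each other with probability \<open>O (r)\<close>, and this bounds
  integrals against the law by the \<open>L\<^sup>2\<close> norm.\<close>

section \<open>Means over the cube and the quadratic form\<close>

text \<open>Recursion on the first digit turns the estimates below into inductions that peel off one
  digit; the target is any real vector space, so that one mean serves both real bounds and complex
  exponentials.\<close>

primrec ave :: "nat \<Rightarrow> (real list \<Rightarrow> 'b::real_vector) \<Rightarrow> 'b" where
  "ave 0 h = h []"
| "ave (Suc n) h = (1 / 2) *\<^sub>R (ave n (\<lambda>xs. h (1 # xs)) + ave n (\<lambda>xs. h (- 1 # xs)))"

definition cube :: "nat \<Rightarrow> real list set" where
  "cube n = {xs. length xs = n \<and> set xs \<subseteq> {- 1, 1}}"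

lemma cube_Nil [simp]: "[] \<in> cube 0"
  by (simp add: cube_def)

lemma cube_Cons_iff [simp]: "x # xs \<in> cube (Suc n) \<longleftrightarrow> x \<in> {- 1, 1} \<and> xs \<in> cube n"
  by (auto simp: cube_def)

lemma length_cube: "xs \<in> cube n \<Longrightarrow> length xs = n"
  by (simp add: cube_def)

lemma ave_cong: "(\<And>xs. xs \<in> cube n \<Longrightarrow> h xs = k xs) \<Longrightarrow> ave n h = ave n k"
proof (induction n arbitrary: h k)
  case (Suc n)
  have "ave n (\<lambda>xs. h (1 # xs)) = ave n (\<lambda>xs. k (1 # xs))"
    "ave n (\<lambda>xs. h (- 1 # xs)) = ave n (\<lambda>xs. k (- 1 # xs))"
    by (intro Suc.IH Suc.prems, simp)+
  then show ?case by simp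
qed simp

lemma ave_mono:
  fixes h k :: "real list \<Rightarrow> real"
  shows "(\<And>xs. xs \<in> cube n \<Longrightarrow> h xs \<le> k xs) \<Longrightarrow> ave n h \<le> ave n k"
proof (induction n arbitrary: h k)
  case (Suc n)
  have "ave n (\<lambda>xs. h (1 # xs)) \<le> ave n (\<lambda>xs. k (1 # xs))"
    "ave n (\<lambda>xs. h (- 1 # xs)) \<le> ave n (\<lambda>xs. k (- 1 # xs))"
    by (intro Suc.IH Suc.prems, simp)+
  then show ?case by simp
qed simp

lemma ave_const [simp]: "ave n (\<lambda>xs. c) = c"
  by (induction n) (auto simp flip: scaleR_2)

lemma ave_add: "ave n (\<lambda>xs. h xs + k xs) = ave n h + ave n k"
  by (induction n arbitrary: h k) (auto simp: algebra_simps)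

lemma ave_linear: "linear F \<Longrightarrow> F (ave n h) = ave n (\<lambda>xs. F (h xs))"
  by (induction n arbitrary: h) (auto simp: linear_scale linear_add)

lemma ave_mult_left: "ave n (\<lambda>xs. c * h xs) = c * ave n h" for c :: "'a::real_algebra"
  by (rule ave_linear[symmetric]) (auto intro!: linearI simp: algebra_simps)

lemma ave_mult_right: "ave n (\<lambda>xs. h xs * c) = ave n h * c" for c :: "'a::real_algebra"
  by (rule ave_linear[of "\<lambda>x. x * c", symmetric]) (auto intro!: linearI simp: algebra_simps)

lemma ave_scaleR: "ave n (\<lambda>xs. c *\<^sub>R h xs) = c *\<^sub>R ave n h"
  by (rule ave_linear[symmetric]) (auto intro!: linearI simp: algebra_simps)

lemma ave_swap: "ave m (\<lambda>xs. ave n (h xs)) = ave n (\<lambda>ys. ave m (\<lambda>xs. h xs ys))"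
  by (induction m arbitrary: h) (simp_all only: ave.simps ave_add ave_scaleR)

lemma ave_append: "ave (m + n) h = ave m (\<lambda>xs. ave n (\<lambda>ys. h (xs @ ys)))"
  by (induction m arbitrary: h) auto

lemma norm_ave_le: "norm (ave n h) \<le> ave n (\<lambda>xs. norm (h xs))"
proof (induction n arbitrary: h)
  case (Suc n)
  show ?case
    using Suc[of "\<lambda>xs. h (1 # xs)"] Suc[of "\<lambda>xs. h (- 1 # xs)"]
      norm_triangle_ineq[of "ave n (\<lambda>xs. h (1 # xs))" "ave n (\<lambda>xs. h (- 1 # xs))"]
    by (simp del: norm_triangle_ineq)
qed simp

lemma norm_ave_bound:
  assumes "\<And>xs. xs \<in> cube n \<Longrightarrow> norm (h xs) \<le> B"
  shows "norm (ave n h) \<le> B"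
  using norm_ave_le[of n h] ave_mono[of n "\<lambda>xs. norm (h xs)" "\<lambda>_. B"] assms by simp

lemma ave_power2_le: "(ave n h)\<^sup>2 \<le> ave n (\<lambda>xs. (h xs)\<^sup>2)" for h :: "real list \<Rightarrow> real"
proof (induction n arbitrary: h)
  case (Suc n)
  define a b where "a = ave n (\<lambda>xs. h (1 # xs))" and "b = ave n (\<lambda>xs. h (- 1 # xs))"
  have "((a + b) / 2)\<^sup>2 \<le> (a\<^sup>2 + b\<^sup>2) / 2"
    using zero_le_power2[of "a - b"] by (simp add: power2_eq_square field_simps)
  also have "\<dots> \<le> ave (Suc n) (\<lambda>xs. (h xs)\<^sup>2)"
    using Suc[of "\<lambda>xs. h (1 # xs)"] Suc[of "\<lambda>xs. h (- 1 # xs)"] by (simp add: a_def b_def)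
  finally show ?case by (simp add: a_def b_def)
qed simp

text \<open>For \<open>ys\<close> of length \<open>n\<close>, \<open>dya ys\<close> is \<open>\<Sum>2^-i y\<^sub>i\<close>, \<open>slope \<gamma> ys\<close> is \<open>\<Sum>\<kappa>^(n-i) y\<^sub>i\<close>
  with \<open>\<kappa> = 1 / (2\<gamma>)\<close>, and \<open>quad \<gamma> ys\<close> is \<open>\<Sum>\<^sub>i\<^sub><\<^sub>j \<gamma>^i 2^-(j-i) y\<^sub>i y\<^sub>j\<close>, indices running from 1.\<close>

primrec dya :: "real list \<Rightarrow> real" where
  "dya [] = 0"
| "dya (x # xs) = (x + dya xs) / 2"

primrec slope :: "real \<Rightarrow> real list \<Rightarrow> real" where
  "slope \<gamma> [] = 0"
| "slope \<gamma> (x # xs) = x * kappa \<gamma> ^ length xs + slope \<gamma> xs"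

primrec quad :: "real \<Rightarrow> real list \<Rightarrow> real" where
  "quad \<gamma> [] = 0"
| "quad \<gamma> (x # xs) = \<gamma> * (x * dya xs + quad \<gamma> xs)"

text \<open>One factor per digit. The class of such weights is closed under passing to a block of
  digits and under multiplication by a phase linear in \<open>dya\<close>, which is what allows
  \<open>char_step\<close> to be iterated.\<close>

primrec wt :: "(nat \<Rightarrow> real \<Rightarrow> complex) \<Rightarrow> real list \<Rightarrow> complex" where
  "wt b [] = 1"
| "wt b (x # xs) = b 0 x * wt (\<lambda>k. b (Suc k)) xs"

section \<open>Concatenation of blocks of digits\<close>

lemma dya_append: "dya (xs @ ys) = dya xs + dya ys / 2 ^ length xs"
  by (induction xs) (auto simp: field_simps)

lemma slope_append: "slope \<gamma> (xs @ ys) = kappa \<gamma> ^ length ys * slope \<gamma> xs + slope \<gamma> ys"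
  by (induction xs) (auto simp: algebra_simps power_add)

text \<open>The cross terms factor: for \<open>i\<close> in a first block of length \<open>n\<close>
  and \<open>j = n + l\<close>, the identity \<open>2 * \<gamma> * \<kappa> = 1\<close> gives
  \<open>\<gamma>^i * 2^-(j - i) = \<gamma>^n * \<kappa>^(n - i) * 2^-l\<close>.\<close>

lemma quad_append:
  assumes "\<gamma> \<noteq> 0"
  shows "quad \<gamma> (xs @ ys) = quad \<gamma> xs + \<gamma> ^ length xs * (slope \<gamma> xs * dya ys + quad \<gamma> ys)"
proof (induction xs)
  case (Cons x xs)
  have "\<gamma> ^ length xs * kappa \<gamma> ^ length xs = 1 / 2 ^ length xs"
    using assms by (simp add: kappa_def flip: power_mult_distrib power_one_over)
  then have "x * (dya ys * (\<gamma> ^ length xs * kappa \<gamma> ^ length xs)) = x * dya ys / 2 ^ length xs"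
    by simp
  with Cons show ?case
    by (simp add: dya_append algebra_simps)
qed simp

lemma wt_append: "wt b (xs @ ys) = wt b xs * wt (\<lambda>k. b (length xs + k)) ys"
  by (induction xs arbitrary: b) auto

lemma wt_mult: "wt (\<lambda>k x. b k x * c k x) xs = wt b xs * wt c xs"
  by (induction xs arbitrary: b c) auto

lemma wt_exp_dya: "wt (\<lambda>k x. cis (s * (x / 2 ^ Suc k))) xs = cis (s * dya xs)"
proof (induction xs arbitrary: s)
  case (Cons x xs)
  have "(\<lambda>k x. cis (s * (x / 2 ^ Suc (Suc k)))) = (\<lambda>k x. cis ((s / 2) * (x / 2 ^ Suc k)))"
    by (simp add: field_simps)
  then show ?case
    using Cons[of "s / 2"] by (simp add: cis_mult algebra_simps add_divide_distrib del: power_Suc)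
qed simp

definition bounded_weight :: "(nat \<Rightarrow> real \<Rightarrow> complex) \<Rightarrow> bool" where
  "bounded_weight b \<longleftrightarrow> (\<forall>k. \<forall>x\<in>{- 1, 1}. norm (b k x) \<le> 1)"

lemma norm_wt_le: "bounded_weight b \<Longrightarrow> xs \<in> cube n \<Longrightarrow> norm (wt b xs) \<le> 1"
proof (induction xs arbitrary: n b)
  case (Cons x xs)
  then obtain n' where n: "n = Suc n'" by (cases n) (auto simp: cube_def)
  have "norm (wt (\<lambda>k. b (Suc k)) xs) \<le> 1"
    using Cons by (intro Cons.IH[of _ n']) (auto simp: n bounded_weight_def)
  then show ?case
    using Cons.prems by (auto simp: n norm_mult bounded_weight_def intro!: mult_le_one)
qed simp

lemma abs_dya_le: "xs \<in> cube n \<Longrightarrow> \<bar>dya xs\<bar> \<le> 1"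
proof (induction xs arbitrary: n)
  case (Cons x xs)
  then obtain n' where n: "n = Suc n'" by (cases n) (auto simp: cube_def)
  with Cons.prems Cons.IH[of n'] show ?case by auto
qed simp

lemma abs_slope_le:
  assumes "0 < kappa \<gamma>" "kappa \<gamma> < 1"
  shows "xs \<in> cube n \<Longrightarrow> \<bar>slope \<gamma> xs\<bar> \<le> 1 / (1 - kappa \<gamma>)"
proof -
  \<comment> \<open>The bound by the partial geometric sum is the one that the induction
    preserves.\<close>
  have "xs \<in> cube n \<Longrightarrow> \<bar>slope \<gamma> xs\<bar> \<le> (1 - kappa \<gamma> ^ length xs) / (1 - kappa \<gamma>)"
  proof (induction xs arbitrary: n)
    case (Cons x xs)
    then obtain n' where n: "n = Suc n'" by (cases n) (auto simp: cube_def)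
    have "\<bar>slope \<gamma> (x # xs)\<bar> \<le> kappa \<gamma> ^ length xs + (1 - kappa \<gamma> ^ length xs) / (1 - kappa \<gamma>)"
      using Cons.prems Cons.IH[of n'] zero_less_power[OF assms(1), of "length xs"]
      by (auto simp: n intro: order_trans[OF abs_triangle_ineq] order_trans[OF abs_triangle_ineq4])
    also have "\<dots> = (1 - kappa \<gamma> ^ length (x # xs)) / (1 - kappa \<gamma>)"
      using assms by (simp add: field_simps)
    finally show ?case .
  qed simp
  also have "(1 - kappa \<gamma> ^ length xs) / (1 - kappa \<gamma>) \<le> 1 / (1 - kappa \<gamma>)"
    using assms by (intro divide_right_mono) auto
  finally show "xs \<in> cube n \<Longrightarrow> ?thesis" .
qed

section \<open>Concentration of slopes and the large sieve\<close>

text \<open>With \<open>\<kappa> \<le> 0.56\<close> the tail \<open>\<kappa>^2 * slope\<close> has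
  modulus at most 3/4, so its translates by 1 and -1 cannot both come within 1/4 of the centre
  \<open>z\<close>: the sign of \<open>z\<close> tells which one is far and contributes at most
  \<open>4 / a\<close>. The other one is the hypothesis at scale
  \<open>\<kappa>^2 * a\<close>.\<close>

lemma slope_concentration_step:
  fixes a z \<kappa> :: real
  assumes a: "a \<ge> 1" and \<kappa>: "1 / 2 < \<kappa>" "\<kappa> \<le> 56 / 100" "\<kappa> = kappa \<gamma>"
    and C: "\<And>x. ave n (\<lambda>xs. 1 / (1 + \<kappa>\<^sup>2 * a * \<bar>slope \<gamma> xs - x\<bar>)) \<le> c"
  shows "ave n (\<lambda>xs. (1 / (1 + a * \<bar>\<kappa>\<^sup>2 * slope \<gamma> xs + (1 - z)\<bar>)
    + 1 / (1 + a * \<bar>\<kappa>\<^sup>2 * slope \<gamma> xs + (- 1 - z)\<bar>)) / 2) \<le> 2 / a + c / 2"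
proof -
  have s: "\<bar>\<kappa>\<^sup>2 * slope \<gamma> xs\<bar> \<le> 3 / 4" if "xs \<in> cube n" for xs
  proof -
    have "\<bar>slope \<gamma> xs\<bar> \<le> 1 / (1 - \<kappa>)"
      using abs_slope_le[of \<gamma> xs n] that \<kappa> by auto
    also have "\<dots> \<le> 1 / (44 / 100)"
      using \<kappa> by (intro divide_left_mono) auto
    finally have "\<bar>slope \<gamma> xs\<bar> \<le> 100 / 44" by simp
    moreover have "\<kappa>\<^sup>2 \<le> (56 / 100)\<^sup>2"
      using \<kappa> by (intro power_mono) auto
    ultimately have "\<kappa>\<^sup>2 * \<bar>slope \<gamma> xs\<bar> \<le> (56 / 100)\<^sup>2 * (100 / 44)"
      by (intro mult_mono) auto
    then show ?thesis by (simp add: abs_mult power2_eq_square)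
  qed
  have far: "1 / (1 + a * \<bar>t\<bar>) \<le> 4 / a" if "\<bar>t\<bar> \<ge> 1 / 4" for t
  proof -
    have "a / 4 \<le> 1 + a * \<bar>t\<bar>"
      using mult_left_mono[OF that, of a] a by linarith
    then have "1 / (1 + a * \<bar>t\<bar>) \<le> 1 / (a / 4)"
      using a by (intro divide_left_mono) (auto simp: add_nonneg_pos)
    then show ?thesis by simp
  qed
  have near: "ave n (\<lambda>xs. 1 / (1 + a * \<bar>\<kappa>\<^sup>2 * slope \<gamma> xs + y\<bar>)) \<le> c" for y
  proof -
    have "\<kappa>\<^sup>2 * slope \<gamma> xs + y = \<kappa>\<^sup>2 * (slope \<gamma> xs - (- y / \<kappa>\<^sup>2))" for xs
      using \<kappa> by (simp add: distrib_left)
    then have "a * \<bar>\<kappa>\<^sup>2 * slope \<gamma> xs + y\<bar> = \<kappa>\<^sup>2 * a * \<bar>slope \<gamma> xs - (- y / \<kappa>\<^sup>2)\<bar>" for xs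
      by (simp add: abs_mult)
    then show ?thesis using C[of "- y / \<kappa>\<^sup>2"] by (simp only:)
  qed
  have half: "(A + B) / 2 \<le> 2 / a + (1 / 2) * B" if "A \<le> 4 / a" for A B
  proof -
    have "(A + B) / 2 \<le> (4 / a + B) / 2"
      using that by simp
    also have "\<dots> = 2 / a + (1 / 2) * B"
      by (simp add: add_divide_distrib)
    finally show ?thesis .
  qed
  have split: "ave n (\<lambda>xs. 2 / a + (1 / 2) * h xs) = 2 / a + (1 / 2) * ave n h" for h :: "real list \<Rightarrow> real"
    by (simp only: ave_add ave_mult_left ave_const)
  show ?thesis
  proof (cases "z \<le> 0")
    case True
    have "ave n (\<lambda>xs. (1 / (1 + a * \<bar>\<kappa>\<^sup>2 * slope \<gamma> xs + (1 - z)\<bar>)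
        + 1 / (1 + a * \<bar>\<kappa>\<^sup>2 * slope \<gamma> xs + (- 1 - z)\<bar>)) / 2)
      \<le> ave n (\<lambda>xs. 2 / a + (1 / 2) * (1 / (1 + a * \<bar>\<kappa>\<^sup>2 * slope \<gamma> xs + (- 1 - z)\<bar>)))"
    proof (rule ave_mono)
      fix xs assume "xs \<in> cube n"
      then have "1 / (1 + a * \<bar>\<kappa>\<^sup>2 * slope \<gamma> xs + (1 - z)\<bar>) \<le> 4 / a"
        using s[of xs] True by (intro far) auto
      then show "(1 / (1 + a * \<bar>\<kappa>\<^sup>2 * slope \<gamma> xs + (1 - z)\<bar>)
          + 1 / (1 + a * \<bar>\<kappa>\<^sup>2 * slope \<gamma> xs + (- 1 - z)\<bar>)) / 2
        \<le> 2 / a + (1 / 2) * (1 / (1 + a * \<bar>\<kappa>\<^sup>2 * slope \<gamma> xs + (- 1 - z)\<bar>))"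
        by (rule half)
    qed
    also have "\<dots> \<le> 2 / a + c / 2"
      unfolding split using near[of "- 1 - z"] by simp
    finally show ?thesis .
  next
    case False
    have "ave n (\<lambda>xs. (1 / (1 + a * \<bar>\<kappa>\<^sup>2 * slope \<gamma> xs + (1 - z)\<bar>)
        + 1 / (1 + a * \<bar>\<kappa>\<^sup>2 * slope \<gamma> xs + (- 1 - z)\<bar>)) / 2)
      \<le> ave n (\<lambda>xs. 2 / a + (1 / 2) * (1 / (1 + a * \<bar>\<kappa>\<^sup>2 * slope \<gamma> xs + (1 - z)\<bar>)))"
    proof (rule ave_mono)
      fix xs assume "xs \<in> cube n"
      then have "1 / (1 + a * \<bar>\<kappa>\<^sup>2 * slope \<gamma> xs + (- 1 - z)\<bar>) \<le> 4 / a"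
        using s[of xs] False by (intro far) auto
      then show "(1 / (1 + a * \<bar>\<kappa>\<^sup>2 * slope \<gamma> xs + (1 - z)\<bar>)
          + 1 / (1 + a * \<bar>\<kappa>\<^sup>2 * slope \<gamma> xs + (- 1 - z)\<bar>)) / 2
        \<le> 2 / a + (1 / 2) * (1 / (1 + a * \<bar>\<kappa>\<^sup>2 * slope \<gamma> xs + (1 - z)\<bar>))"
        by (subst add.commute) (rule half)
    qed
    also have "\<dots> \<le> 2 / a + c / 2"
      unfolding split using near[of "1 - z"] by simp
    finally show ?thesis .
  qed
qed

lemma slope_concentration_trivial:
  assumes "\<gamma> < 1" "0 < \<gamma>" "0 < a" "a \<le> 2"
  shows "ave n (\<lambda>xs. 1 / (1 + a * \<bar>slope \<gamma> xs - x\<bar>)) \<le> 2 / (1 - \<gamma>) / sqrt a"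
proof -
  have "ave n (\<lambda>xs. 1 / (1 + a * \<bar>slope \<gamma> xs - x\<bar>)) \<le> ave n (\<lambda>xs. 1)"
    using assms by (intro ave_mono) (auto simp: divide_simps add_nonneg_pos)
  also have "\<dots> \<le> 2 / sqrt a"
    using assms by (auto intro!: real_le_lsqrt)
  also have "\<dots> \<le> 2 / (1 - \<gamma>) / sqrt a"
    using assms by (intro divide_right_mono) (auto simp: field_simps)
  finally show ?thesis .
qed

text \<open>The function \<open>1 / (1 + a * \<bar>t\<bar>)\<close> is a soft substitute for the
  indicator of an interval of length about \<open>1 / a\<close>. Dropping two digits replaces
  \<open>a\<close> by \<open>\<kappa>^2 * a\<close> and halves the main term; in a bound of order
  \<open>a^(-1/2)\<close> this amounts to the factor
  \<open>1 / (2 * \<kappa>) = \<gamma> < 1\<close>, and the constant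
  \<open>2 / (1 - \<gamma>)\<close> absorbs the extra \<open>2 / a\<close>. The condition
  \<open>\<kappa>^n * a \<le> 1\<close>, enough digits for the scale, is inherited.\<close>

lemma slope_concentration:
  fixes a x :: real
  assumes \<gamma>: "0 < \<gamma>" "\<gamma> < 1" "kappa \<gamma> \<le> 56 / 100"
    and a: "a > 0" "kappa \<gamma> ^ n * a \<le> 1"
  shows "ave n (\<lambda>xs. 1 / (1 + a * \<bar>slope \<gamma> xs - x\<bar>)) \<le> 2 / (1 - \<gamma>) / sqrt a"
  using a
proof (induction n arbitrary: a x rule: induct_nat_012)
  have \<kappa>: "1 / 2 < kappa \<gamma>"
    using \<gamma> by (simp add: kappa_def field_simps)
  case 0
  then show ?case using \<gamma> by (intro slope_concentration_trivial \<gamma>) auto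
next
  have \<kappa>: "1 / 2 < kappa \<gamma>"
    using \<gamma> by (simp add: kappa_def field_simps)
  {
    case 1
    have "a \<le> 2"
      using 1[unfolded power_one_right One_nat_def[symmetric]] mult_strict_right_mono[OF \<kappa>, of a]
      by linarith
    with 1 show ?case by (intro slope_concentration_trivial \<gamma>) auto
  next
    case (ge2 n)
    show ?case
    proof (cases "a \<le> 2")
      case True
      with ge2 show ?thesis by (intro slope_concentration_trivial \<gamma>) auto
    next
      case False
      define \<kappa> where "\<kappa> = kappa \<gamma>"
      have \<kappa>': "1 / 2 < \<kappa>" "\<kappa> \<le> 56 / 100" "\<kappa> * \<gamma> = 1 / 2"
        using \<kappa> \<gamma> by (auto simp: \<kappa>_def kappa_def)
      define c where "c = 2 / (1 - \<gamma>) / sqrt (\<kappa>\<^sup>2 * a)"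
      have IH: "ave n (\<lambda>xs. 1 / (1 + \<kappa>\<^sup>2 * a * \<bar>slope \<gamma> xs - x\<bar>)) \<le> c" for x
        unfolding c_def using ge2 False \<kappa>'
        by (intro ge2.IH(1)) (auto simp: \<kappa>_def power2_eq_square mult_ac)
      \<comment> \<open>\<open>P\<close> averages over the last digit, of coefficient 1; the digit
        before it, of coefficient \<open>\<kappa>\<close>, moves the centre to
        \<open>x - \<kappa>\<close> or \<open>x + \<kappa>\<close>.\<close>
      define P where "P z = ave n (\<lambda>xs. (1 / (1 + a * \<bar>\<kappa>\<^sup>2 * slope \<gamma> xs + (1 - z)\<bar>)
        + 1 / (1 + a * \<bar>\<kappa>\<^sup>2 * slope \<gamma> xs + (- 1 - z)\<bar>)) / 2)" for z
      have P: "P z \<le> 2 / a + c / 2" for z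
        unfolding P_def using False \<kappa>' IH \<kappa>_def by (intro slope_concentration_step) auto
      have "ave (Suc (Suc n)) (\<lambda>xs. 1 / (1 + a * \<bar>slope \<gamma> xs - x\<bar>)) =
          ave (n + 2) (\<lambda>xs. 1 / (1 + a * \<bar>slope \<gamma> xs - x\<bar>))"
        by (metis add_2_eq_Suc')
      also have "\<dots> = ave n (\<lambda>xs. ave 2 (\<lambda>ys. 1 / (1 + a * \<bar>\<kappa> ^ length ys * slope \<gamma> xs + slope \<gamma> ys - x\<bar>)))"
        by (simp only: ave_append slope_append \<kappa>_def)
      also have "\<dots> = (P (x - \<kappa>) + P (x + \<kappa>)) / 2"
      proof -
        have "ave 2 (\<lambda>ys. 1 / (1 + a * \<bar>\<kappa> ^ length ys * slope \<gamma> xs + slope \<gamma> ys - x\<bar>)) =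
            (1 / 2) * ((1 / (1 + a * \<bar>\<kappa>\<^sup>2 * slope \<gamma> xs + (1 - (x - \<kappa>))\<bar>)
              + 1 / (1 + a * \<bar>\<kappa>\<^sup>2 * slope \<gamma> xs + (- 1 - (x - \<kappa>))\<bar>)) / 2
            + (1 / (1 + a * \<bar>\<kappa>\<^sup>2 * slope \<gamma> xs + (1 - (x + \<kappa>))\<bar>)
              + 1 / (1 + a * \<bar>\<kappa>\<^sup>2 * slope \<gamma> xs + (- 1 - (x + \<kappa>))\<bar>)) / 2)" for xs
        proof -
          have ave2: "ave 2 f = (f [1, 1] + f [1, - 1] + f [- 1, 1] + f [- 1, - 1]) / 4"
            for f :: "real list \<Rightarrow> real"
            by (simp add: numeral_2_eq_2 add_divide_distrib)
          have eqs: "\<kappa>\<^sup>2 * t + (1 - (x - \<kappa>)) = \<kappa>\<^sup>2 * t + (\<kappa> + 1) - x"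
            "\<kappa>\<^sup>2 * t + (- 1 - (x - \<kappa>)) = \<kappa>\<^sup>2 * t + (\<kappa> - 1) - x"
            "\<kappa>\<^sup>2 * t + (1 - (x + \<kappa>)) = \<kappa>\<^sup>2 * t + (- \<kappa> + 1) - x"
            "\<kappa>\<^sup>2 * t + (- 1 - (x + \<kappa>)) = \<kappa>\<^sup>2 * t + (- \<kappa> - 1) - x" for t
            by simp_all
          show ?thesis
            unfolding ave2 eqs by (simp add: \<kappa>_def[symmetric] power2_eq_square add_divide_distrib mult_ac)
        qed
        then show ?thesis
          unfolding P_def by (simp only: ave_mult_left ave_add)
      qed
      also have "\<dots> \<le> 2 / a + c / 2"
        using P[of "x - \<kappa>"] P[of "x + \<kappa>"] by simp
      also have "\<dots> = 2 / a + \<gamma> * (2 / (1 - \<gamma>) / sqrt a)"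
      proof -
        have "c / 2 = (1 / (2 * \<kappa>)) * (2 / (1 - \<gamma>) / sqrt a)"
          using \<kappa>' by (simp add: c_def real_sqrt_mult)
        also have "1 / (2 * \<kappa>) = \<gamma>"
          using \<kappa>' by (simp add: field_simps)
        finally show ?thesis by (simp only:)
      qed
      also have "2 / a \<le> 2 / sqrt a"
        using False by (intro divide_left_mono) (auto intro!: real_le_lsqrt simp: power2_eq_square)
      also have "2 / sqrt a + \<gamma> * (2 / (1 - \<gamma>) / sqrt a) = 2 / (1 - \<gamma>) / sqrt a"
        using \<gamma> False by (simp add: divide_simps)
      finally show ?thesis by simp
    qed
  }
qed

section \<open>Fourier means over dyadic midpoints\<close>

lemma abs_sin_ge: "\<bar>x\<bar> / 2 \<le> \<bar>sin x\<bar>" if "\<bar>x\<bar> \<le> 1" for x :: real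
proof -
  have "\<bar>sin x - (\<Sum>m<3. sin_coeff m * x ^ m)\<bar> \<le> inverse (fact 3) * \<bar>x\<bar> ^ 3"
    by (rule Maclaurin_sin_bound)
  then have "\<bar>sin x - x\<bar> \<le> \<bar>x\<bar> ^ 3 / 6"
    by (simp add: eval_nat_numeral sin_coeff_def)
  also have "\<bar>x\<bar> ^ 3 \<le> \<bar>x\<bar>"
    using power_decreasing[of 1 3 "\<bar>x\<bar>"] that by simp
  finally show ?thesis by linarith
qed

text \<open>The mean is \<open>\<Prod>cos (y / 2^j)\<close>, so Viete's product for the sine applies.\<close>

lemma norm_ave_cis_dya:
  "norm (ave l (\<lambda>p. cis (y * dya p))) * (2 ^ l * \<bar>sin (y / 2 ^ l)\<bar>) = \<bar>sin y\<bar>"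
proof (induction l arbitrary: y)
  case (Suc l)
  have "ave (Suc l) (\<lambda>p. cis (y * dya p)) =
      (1 / 2) *\<^sub>R ((cis (y / 2) + cis (- (y / 2))) * ave l (\<lambda>p. cis ((y / 2) * dya p)))"
    by (simp add: distrib_right cis_mult add_divide_distrib diff_divide_distrib algebra_simps
          flip: ave_mult_left)
  also have "cis (y / 2) + cis (- (y / 2)) = complex_of_real (2 * cos (y / 2))"
    by (simp add: complex_eq_iff)
  finally have "norm (ave (Suc l) (\<lambda>p. cis (y * dya p)))
      = \<bar>cos (y / 2)\<bar> * norm (ave l (\<lambda>p. cis ((y / 2) * dya p)))"
    by (simp add: norm_mult)
  then have "norm (ave (Suc l) (\<lambda>p. cis (y * dya p))) * (2 ^ Suc l * \<bar>sin (y / 2 ^ Suc l)\<bar>)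
    = 2 * \<bar>cos (y / 2)\<bar> * (norm (ave l (\<lambda>p. cis ((y / 2) * dya p))) * (2 ^ l * \<bar>sin (y / 2 / 2 ^ l)\<bar>))"
    by simp
  also have "\<dots> = \<bar>sin (2 * (y / 2))\<bar>"
    unfolding Suc sin_double by (simp add: abs_mult)
  finally show ?case by simp
qed simp

text \<open>For \<open>\<bar>y\<bar> \<le> 2^l\<close> the sine of \<open>y / 2^l\<close> in the
  product formula is at least half its argument in modulus, so the norm \<open>K\<close> of the mean
  satisfies \<open>K * \<bar>y\<bar> \<le> 2\<close>; adding the trivial \<open>K \<le> 1\<close>
  gives a form without singularity at 0.\<close>

lemma norm_ave_cis_dya_le:
  assumes "\<bar>y\<bar> \<le> 2 ^ l"
  shows "norm (ave l (\<lambda>p. cis (y * dya p))) \<le> 3 / (1 + \<bar>y\<bar>)"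
proof -
  define K where "K = norm (ave l (\<lambda>p. cis (y * dya p)))"
  have "\<bar>y\<bar> / 2 = 2 ^ l * (\<bar>y / 2 ^ l\<bar> / 2)" by simp
  also have "\<dots> \<le> 2 ^ l * \<bar>sin (y / 2 ^ l)\<bar>"
    using assms by (intro mult_left_mono abs_sin_ge) auto
  finally have "K * (\<bar>y\<bar> / 2) \<le> K * (2 ^ l * \<bar>sin (y / 2 ^ l)\<bar>)"
    by (intro mult_left_mono) (auto simp: K_def)
  also have "\<dots> \<le> 1"
    unfolding K_def norm_ave_cis_dya by simp
  finally have "K * \<bar>y\<bar> \<le> 2" by simp
  moreover have "K \<le> 1"
    unfolding K_def by (rule norm_ave_bound) simp
  ultimately have "K * (1 + \<bar>y\<bar>) \<le> 3" by (simp add: algebra_simps)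
  moreover have "1 + \<bar>y\<bar> > 0" by linarith
  ultimately show ?thesis by (simp add: K_def pos_le_divide_eq)
qed

text \<open>A phase that couples \<open>w\<close> to the digits of \<open>q\<close> costs only a constant factor: digit by digit,
  \<open>exp (i t x) = cos t + i x sin t\<close> for \<open>x = \<plusminus>1\<close>, and both terms are again bounded weights.\<close>

lemma decouple:
  assumes H: "\<And>\<alpha> b. \<lbrakk>\<And>w. w \<in> cube n \<Longrightarrow> norm (\<alpha> w) \<le> 1; bounded_weight b\<rbrakk>
      \<Longrightarrow> norm (ave n (\<lambda>w. \<alpha> w * ave r (\<lambda>q. wt b q * G w q))) \<le> B"
    and \<mu>: "\<And>w. w \<in> cube n \<Longrightarrow> \<bar>\<mu> w\<bar> \<le> Z"
    and \<alpha>: "\<And>w. w \<in> cube n \<Longrightarrow> norm (\<alpha> w) \<le> 1"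
    and b: "bounded_weight b"
    and Z: "Z \<ge> 0"
  shows "norm (ave n (\<lambda>w. \<alpha> w * ave r (\<lambda>q. wt b q * (cis (\<mu> w * dya q) * G w q)))) \<le> exp Z * B"
  using assms
proof (induction r arbitrary: G \<mu> Z B b)
  case 0
  have base: "norm (ave n (\<lambda>w. \<alpha> w * ave 0 (\<lambda>q. wt b q * G w q))) \<le> B"
    using "0.prems"(1)[of \<alpha> b] "0.prems"(3,4) by blast
  have "1 * B \<le> exp Z * B"
    using order_trans[OF norm_ge_zero base] "0.prems"(5) by (intro mult_right_mono) auto
  with base show ?case by simp
next
  case (Suc r)
  note H = Suc.prems(1)
  have B0: "B \<ge> 0"
    using order_trans[OF norm_ge_zero H[of \<alpha> b]] Suc.prems(3,4) by blast
  \<comment> \<open>A coefficient bounded by \<open>c\<close> instead of 1 costs the factor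
    \<open>c\<close>; this is how the smallness of the sine terms is used.\<close>
  have scaled: "norm (ave n (\<lambda>w. \<beta> w * ave (Suc r) (\<lambda>q. wt b q * G w q))) \<le> c * B"
    if \<beta>: "\<And>w. w \<in> cube n \<Longrightarrow> norm (\<beta> w) \<le> c" and b: "bounded_weight b" and c: "c \<ge> 0" for \<beta> b c
  proof (cases "c = 0")
    case True
    have "ave n (\<lambda>w. \<beta> w * ave (Suc r) (\<lambda>q. wt b q * G w q)) = ave n (\<lambda>w. 0)"
      using \<beta> True by (intro ave_cong) auto
    then show ?thesis using True by simp
  next
    case False
    have "norm (ave n (\<lambda>w. (\<beta> w / c) * ave (Suc r) (\<lambda>q. wt b q * G w q))) \<le> B"
      using \<beta> c False by (intro H b) (auto simp: norm_divide)
    moreover have "ave n (\<lambda>w. \<beta> w * ave (Suc r) (\<lambda>q. wt b q * G w q)) =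
        c * ave n (\<lambda>w. (\<beta> w / c) * ave (Suc r) (\<lambda>q. wt b q * G w q))"
      unfolding ave_mult_left[symmetric] using False by (intro ave_cong) (auto simp: field_simps)
    ultimately show ?thesis
      using c mult_left_mono[of _ B c] by (simp add: norm_mult)
  qed
  \<comment> \<open>\<open>G'\<close> absorbs the mean over the first digit of \<open>q\<close> with
    its share of the phase; the remaining digits carry half the phase.\<close>
  define G' where "G' w q = (1 / 2) *\<^sub>R (b 0 1 * cis (\<mu> w / 2) * G w (1 # q)
    + b 0 (- 1) * cis (- (\<mu> w / 2)) * G w (- 1 # q))" for w q
  have G': "norm (ave n (\<lambda>w. \<beta> w * ave r (\<lambda>q. wt c q * G' w q))) \<le> (1 + Z / 2) * B"
    if \<beta>: "\<And>w. w \<in> cube n \<Longrightarrow> norm (\<beta> w) \<le> 1" and c: "bounded_weight c" for \<beta> c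
  proof -
    \<comment> \<open>The cosine part keeps the factor of the first digit, the sine part multiplies
      it by the digit.\<close>
    define b1 b2 where "b1 k = (case k of 0 \<Rightarrow> b 0 | Suc j \<Rightarrow> c j)"
      and "b2 k = (case k of 0 \<Rightarrow> (\<lambda>x. x * b 0 x) | Suc j \<Rightarrow> c j)" for k
    have bw: "bounded_weight b1" "bounded_weight b2"
      using c Suc.prems(4) by (auto simp: bounded_weight_def b1_def b2_def norm_mult split: nat.splits)
    have cis: "cis x = of_real (cos x) + \<i> * of_real (sin x)" for x
      by (simp add: complex_eq_iff)
    have "ave r (\<lambda>q. wt c q * G' w q) =
        of_real (cos (\<mu> w / 2)) * ave (Suc r) (\<lambda>q. wt b1 q * G w q)
        + \<i> * of_real (sin (\<mu> w / 2)) * ave (Suc r) (\<lambda>q. wt b2 q * G w q)" for w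
      by (simp add: G'_def b1_def b2_def cis algebra_simps flip: ave_add ave_mult_left ave_scaleR)
    then have "ave n (\<lambda>w. \<beta> w * ave r (\<lambda>q. wt c q * G' w q)) =
        ave n (\<lambda>w. (\<beta> w * of_real (cos (\<mu> w / 2))) * ave (Suc r) (\<lambda>q. wt b1 q * G w q))
        + ave n (\<lambda>w. (\<beta> w * \<i> * of_real (sin (\<mu> w / 2))) * ave (Suc r) (\<lambda>q. wt b2 q * G w q))"
      by (simp add: algebra_simps flip: ave_add del: ave.simps)
    also have "norm \<dots> \<le> 1 * B + (Z / 2) * B"
    proof (intro order_trans[OF norm_triangle_ineq] add_mono scaled bw)
      fix w assume w: "w \<in> cube n"
      show "norm (\<beta> w * complex_of_real (cos (\<mu> w / 2))) \<le> 1"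
        using \<beta>[OF w] by (auto simp: norm_mult intro!: mult_le_one)
      have "\<bar>sin (\<mu> w / 2)\<bar> \<le> Z / 2"
        using abs_sin_x_le_abs_x[of "\<mu> w / 2"] Suc.prems(2)[OF w] by simp
      with \<beta>[OF w] have "norm (\<beta> w) * \<bar>sin (\<mu> w / 2)\<bar> \<le> 1 * (Z / 2)"
        by (intro mult_mono) auto
      then show "norm (\<beta> w * \<i> * complex_of_real (sin (\<mu> w / 2))) \<le> Z / 2"
        by (simp add: norm_mult)
    qed (use Suc.prems(5) in auto)
    finally show ?thesis by (simp add: algebra_simps)
  qed
  have "ave (Suc r) (\<lambda>q. wt b q * (cis (\<mu> w * dya q) * G w q)) =
      ave r (\<lambda>q. wt (\<lambda>k. b (Suc k)) q * (cis ((\<mu> w / 2) * dya q) * G' w q))" for w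
  proof -
    have "cis (\<mu> w * ((x + dya q) / 2)) = cis (\<mu> w / 2 * x) * cis (\<mu> w / 2 * dya q)" for x q
      by (simp add: cis_mult field_simps)
    from this[of 1] this[of "- 1"] show ?thesis
      unfolding ave.simps dya.simps wt.simps G'_def ave_add[symmetric] ave_scaleR[symmetric]
      by (intro ave_cong) (simp add: algebra_simps)
  qed
  then have "norm (ave n (\<lambda>w. \<alpha> w * ave (Suc r) (\<lambda>q. wt b q * (cis (\<mu> w * dya q) * G w q))))
      = norm (ave n (\<lambda>w. \<alpha> w *
          ave r (\<lambda>q. wt (\<lambda>k. b (Suc k)) q * (cis ((\<mu> w / 2) * dya q) * G' w q))))"
    by simp
  \<comment> \<open>The first digit costs \<open>1 + Z / 2 \<le> exp (Z / 2)\<close> and the others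
    \<open>exp (Z / 2)\<close> by induction, so the total does not depend on
    \<open>r\<close>.\<close>
  also have "\<dots> \<le> exp (Z / 2) * ((1 + Z / 2) * B)"
    using Suc.prems by (intro Suc.IH G') (auto simp: bounded_weight_def)
  also have "\<dots> \<le> exp (Z / 2) * (exp (Z / 2) * B)"
    using B0 by (intro mult_left_mono mult_right_mono) auto
  also have "\<dots> = exp Z * B"
    by (simp flip: exp_add mult.assoc)
  finally show ?case .
qed

section \<open>The large sieve inequality\<close>

text \<open>Duality: the two means are exchanged, Cauchy-Schwarz over \<open>p\<close> removes the
  unknown \<open>\<beta>\<close>, and expanding the square over pairs leaves explicit Fourier means
  at the differences \<open>\<theta> w - \<theta> w'\<close>.\<close>

lemma large_sieve:
  assumes \<alpha>: "\<And>w. w \<in> cube n \<Longrightarrow> norm (\<alpha> w) \<le> 1"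
    and \<beta>: "\<And>p. p \<in> cube l \<Longrightarrow> norm (\<beta> p) \<le> c"
  shows "(norm (ave n (\<lambda>w. \<alpha> w * ave l (\<lambda>p. \<beta> p * cis (\<theta> w * dya p)))))\<^sup>2
    \<le> c\<^sup>2 * ave n (\<lambda>w. ave n (\<lambda>w'. norm (ave l (\<lambda>p. cis ((\<theta> w - \<theta> w') * dya p)))))"
proof -
  define g where "g p = ave n (\<lambda>w. \<alpha> w * cis (\<theta> w * dya p))" for p
  have "ave n (\<lambda>w. \<alpha> w * ave l (\<lambda>p. \<beta> p * cis (\<theta> w * dya p))) = ave l (\<lambda>p. \<beta> p * g p)"
    unfolding ave_mult_left[symmetric] g_def
    by (subst ave_swap) (simp add: mult_ac)
  also have "norm \<dots> \<le> ave l (\<lambda>p. norm (\<beta> p * g p))"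
    by (rule norm_ave_le)
  also have "\<dots> \<le> ave l (\<lambda>p. c * norm (g p))"
    by (rule ave_mono) (auto simp: norm_mult intro!: mult_right_mono \<beta>)
  also have "\<dots> = c * ave l (\<lambda>p. norm (g p))"
    by (rule ave_mult_left)
  finally have "(norm (ave n (\<lambda>w. \<alpha> w * ave l (\<lambda>p. \<beta> p * cis (\<theta> w * dya p)))))\<^sup>2
      \<le> (c * ave l (\<lambda>p. norm (g p)))\<^sup>2"
    by (intro power_mono) auto
  also have "\<dots> \<le> c\<^sup>2 * ave l (\<lambda>p. (norm (g p))\<^sup>2)"
    unfolding power_mult_distrib by (intro mult_left_mono ave_power2_le) auto
  \<comment> \<open>The mean square is real and nonnegative, hence the norm of its complex version,
    to which the triangle inequality applies after expansion.\<close>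
  also have "ave l (\<lambda>p. (norm (g p))\<^sup>2) = norm (ave l (\<lambda>p. g p * cnj (g p)))"
  proof -
    have "ave l (\<lambda>p. g p * cnj (g p)) = ave l (\<lambda>p. complex_of_real ((norm (g p))\<^sup>2))"
      by (simp only: complex_norm_square)
    also have "\<dots> = complex_of_real (ave l (\<lambda>p. (norm (g p))\<^sup>2))"
      by (rule ave_linear[symmetric]) (auto intro!: linearI simp: scaleR_conv_of_real)
    finally show ?thesis
      using ave_mono[of l "\<lambda>_. 0" "\<lambda>p. (norm (g p))\<^sup>2"] by simp
  qed
  also have "ave l (\<lambda>p. g p * cnj (g p)) =
      ave n (\<lambda>w. ave n (\<lambda>w'. \<alpha> w * cnj (\<alpha> w') * ave l (\<lambda>p. cis ((\<theta> w - \<theta> w') * dya p))))"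
  proof -
    have "cnj (g p) = ave n (\<lambda>w. cnj (\<alpha> w) * cis (- (\<theta> w * dya p)))" for p
      unfolding g_def by (subst ave_linear[of cnj]) (auto intro!: linearI simp: cis_cnj)
    moreover have "g p * cnj (g p) =
        ave n (\<lambda>w. ave n (\<lambda>w'. \<alpha> w * cnj (\<alpha> w') * cis ((\<theta> w - \<theta> w') * dya p)))"
      if "cnj (g p) = ave n (\<lambda>w. cnj (\<alpha> w) * cis (- (\<theta> w * dya p)))" for p
    proof -
      have "\<alpha> w * cnj (\<alpha> w') * cis ((\<theta> w - \<theta> w') * dya p) =
          (\<alpha> w * cis (\<theta> w * dya p)) * (cnj (\<alpha> w') * cis (- (\<theta> w' * dya p)))" for w w'
      proof -
        have "cis ((\<theta> w - \<theta> w') * dya p) = cis (\<theta> w * dya p) * cis (- (\<theta> w' * dya p))"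
          unfolding cis_mult by (simp add: left_diff_distrib)
        then show ?thesis by (simp only: mult_ac)
      qed
      then show ?thesis
        using that by (simp only: ave_mult_left ave_mult_right g_def)
    qed
    ultimately have "ave l (\<lambda>p. g p * cnj (g p)) =
        ave l (\<lambda>p. ave n (\<lambda>w. ave n (\<lambda>w'. \<alpha> w * cnj (\<alpha> w') * cis ((\<theta> w - \<theta> w') * dya p))))"
      by simp
    also have "\<dots> = ave n (\<lambda>w. ave n (\<lambda>w'. ave l (\<lambda>p. \<alpha> w * cnj (\<alpha> w') * cis ((\<theta> w - \<theta> w') * dya p))))"
      by (simp add: ave_swap[of l n])
    finally show ?thesis by (simp add: ave_mult_left)
  qed
  also have "norm \<dots> \<le> ave n (\<lambda>w. ave n (\<lambda>w'. norm (ave l (\<lambda>p. cis ((\<theta> w - \<theta> w') * dya p)))))"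
  proof (intro order_trans[OF norm_ave_le] ave_mono)
    fix w w' assume "w \<in> cube n" "w' \<in> cube n"
    then have "norm (\<alpha> w) * norm (\<alpha> w') \<le> 1"
      by (intro mult_le_one \<alpha>) auto
    then show "norm (\<alpha> w * cnj (\<alpha> w') * ave l (\<lambda>p. cis ((\<theta> w - \<theta> w') * dya p)))
        \<le> norm (ave l (\<lambda>p. cis ((\<theta> w - \<theta> w') * dya p)))"
      by (simp add: norm_mult mult_left_le_one_le)
  qed
  finally show ?thesis by (simp add: mult_left_mono)
qed

section \<open>Decay of the characteristic function\<close>

text \<open>The digits split into \<open>w\<close>, \<open>p\<close>, \<open>q\<close> of lengths
  \<open>n\<close>, \<open>n + 3\<close>, \<open>r\<close>. By \<open>quad_append\<close> the phase
  couples \<open>w\<close> and \<open>p\<close> through \<open>v * slope \<gamma> w * dya p\<close>,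
  handled by the large sieve; \<open>p\<close> and \<open>q\<close> through a phase linear in
  \<open>dya q\<close>, absorbed into the weight; \<open>w\<close> and \<open>q\<close> through a
  phase of size at most 1, removed by \<open>decouple\<close>. The block \<open>q\<close> keeps the
  quadratic form at frequency \<open>\<gamma>^(2 * n + 3) * u\<close>.\<close>

lemma char_step:
  fixes u M' :: real
  assumes \<gamma>: "0 < \<gamma>" "\<gamma> < 1" "kappa \<gamma> \<le> 56 / 100"
    and u: "u \<noteq> 0" "\<bar>u\<bar> \<le> 2 ^ n"
    and M': "M' \<ge> 0" "\<And>b. bounded_weight b \<Longrightarrow>
      (norm (ave r (\<lambda>q. wt b q * cis (\<gamma> ^ (2 * n + 3) * u * quad \<gamma> q))))\<^sup>2 \<le> M'"
    and b: "bounded_weight b"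
  shows "(norm (ave (2 * n + 3 + r) (\<lambda>x. wt b x * cis (u * quad \<gamma> x))))\<^sup>2
    \<le> (exp 1)\<^sup>2 * (6 / (1 - \<gamma>) / sqrt (\<bar>u\<bar> * \<gamma> ^ n)) * M'"
proof -
  \<comment> \<open>Slopes of \<open>w\<close> lie in \<open>[-5/2, 5/2]\<close>, so the phases
    \<open>v * (slope \<gamma> w - slope \<gamma> w')\<close> are at most
    \<open>5 * 2^n \<le> 2^l\<close>: three extra digits keep them in the range of
    \<open>norm_ave_cis_dya_le\<close>.\<close>
  define l where "l = n + 3"
  define v where "v = \<gamma> ^ n * u"
  define J where "J = 6 / (1 - \<gamma>) / sqrt (\<bar>u\<bar> * \<gamma> ^ n)"
  define bp where "bp k = b (n + k)" for k
  define bq where "bq k = b (n + l + k)" for k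
  have bw: "bounded_weight bp" "bounded_weight bq"
    using b by (auto simp: bounded_weight_def bp_def bq_def)
  have \<kappa>: "0 < kappa \<gamma>" "kappa \<gamma> < 1" "1 / 2 \<le> kappa \<gamma>"
    using \<gamma> by (auto simp: kappa_def field_simps)
  have v0: "v \<noteq> 0" "\<bar>v\<bar> = \<bar>u\<bar> * \<gamma> ^ n"
    using u \<gamma> by (auto simp: v_def abs_mult)
  have v_le: "\<bar>v\<bar> \<le> 2 ^ n"
    using mult_mono[OF u(2) power_le_one[of \<gamma> n]] \<gamma> v0 by simp
  have slope_le: "\<bar>slope \<gamma> w\<bar> \<le> 5 / 2" if "w \<in> cube n" for w
  proof -
    have "\<bar>slope \<gamma> w\<bar> \<le> 1 / (1 - kappa \<gamma>)"
      using \<kappa> that by (intro abs_slope_le)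
    also have "\<dots> \<le> 1 / (44 / 100)"
      using \<gamma> by (intro divide_left_mono) auto
    finally show ?thesis by simp
  qed
  have J: "ave n (\<lambda>w. ave n (\<lambda>w'. norm (ave l (\<lambda>p. cis ((v * slope \<gamma> w - v * slope \<gamma> w') * dya p))))) \<le> J"
  proof -
    have "ave n (\<lambda>w'. norm (ave l (\<lambda>p. cis ((v * slope \<gamma> w - v * slope \<gamma> w') * dya p)))) \<le> J"
      if w: "w \<in> cube n" for w
    proof -
      have "ave n (\<lambda>w'. norm (ave l (\<lambda>p. cis ((v * slope \<gamma> w - v * slope \<gamma> w') * dya p))))
          \<le> ave n (\<lambda>w'. 3 * (1 / (1 + \<bar>v\<bar> * \<bar>slope \<gamma> w' - slope \<gamma> w\<bar>)))"
      proof (rule ave_mono)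
        fix w' assume w': "w' \<in> cube n"
        have eq: "\<bar>v * slope \<gamma> w - v * slope \<gamma> w'\<bar> = \<bar>v\<bar> * \<bar>slope \<gamma> w' - slope \<gamma> w\<bar>"
          by (simp add: abs_mult abs_minus_commute flip: right_diff_distrib)
        also have "\<dots> \<le> 2 ^ n * 5"
          using slope_le[OF w] slope_le[OF w'] v_le by (intro mult_mono) auto
        also have "\<dots> \<le> 2 ^ l"
          by (simp add: l_def power_add)
        finally show "norm (ave l (\<lambda>p. cis ((v * slope \<gamma> w - v * slope \<gamma> w') * dya p)))
            \<le> 3 * (1 / (1 + \<bar>v\<bar> * \<bar>slope \<gamma> w' - slope \<gamma> w\<bar>))"
          using norm_ave_cis_dya_le[of "v * slope \<gamma> w - v * slope \<gamma> w'" l] by (simp add: eq)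
      qed
      also have "\<dots> = 3 * ave n (\<lambda>w'. 1 / (1 + \<bar>v\<bar> * \<bar>slope \<gamma> w' - slope \<gamma> w\<bar>))"
        by (rule ave_mult_left)
      also have "\<dots> \<le> 3 * (2 / (1 - \<gamma>) / sqrt \<bar>v\<bar>)"
      proof (intro mult_left_mono slope_concentration \<gamma>)
        \<comment> \<open>As \<open>\<kappa> * \<gamma> = 1 / 2\<close>, the bound
          \<open>\<bar>u\<bar> \<le> 2^n\<close> becomes the digit condition for the slopes of
          \<open>w\<close>.\<close>
        have "kappa \<gamma> ^ n * \<bar>v\<bar> = (kappa \<gamma> * \<gamma>) ^ n * \<bar>u\<bar>"
          by (simp add: v0 power_mult_distrib)
        also have "\<dots> \<le> (kappa \<gamma> * \<gamma>) ^ n * 2 ^ n"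
          using u \<kappa> \<gamma> by (intro mult_left_mono) auto
        also have "\<dots> = 1"
          using \<gamma> by (simp add: kappa_def power_one_over)
        finally show "kappa \<gamma> ^ n * \<bar>v\<bar> \<le> 1" .
      qed (use v0 in auto)
      finally show ?thesis
        by (simp add: J_def v0)
    qed
    then show ?thesis
      using ave_mono[of n _ "\<lambda>_. J"] by simp
  qed
  have J0: "J \<ge> 0"
    using \<gamma> by (auto simp: J_def)
  \<comment> \<open>The coupling of \<open>w\<close> and \<open>q\<close> is left out of
    \<open>G\<close>; \<open>decouple\<close> restores it at the cost of the factor
    \<open>exp 1\<close>.\<close>
  define G where "G w q = ave l (\<lambda>p. wt bp p * cis (v * quad \<gamma> p) * cis (v * slope \<gamma> w * dya p)
      * cis (v * \<gamma> ^ l * slope \<gamma> p * dya q) * cis (v * \<gamma> ^ l * quad \<gamma> q))" for w q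
  have H: "norm (ave n (\<lambda>w. \<alpha> w * ave r (\<lambda>q. wt c q * G w q))) \<le> sqrt (M' * J)"
    if \<alpha>: "\<And>w. w \<in> cube n \<Longrightarrow> norm (\<alpha> w) \<le> 1" and c: "bounded_weight c" for \<alpha> c
  proof -
    define R where "R p = ave r (\<lambda>q. wt c q * cis (v * \<gamma> ^ l * slope \<gamma> p * dya q)
      * cis (v * \<gamma> ^ l * quad \<gamma> q))" for p
    have vl: "v * \<gamma> ^ l = \<gamma> ^ (2 * n + 3) * u"
    proof -
      have "\<gamma> ^ (2 * n + 3) = \<gamma> ^ n * \<gamma> ^ n * \<gamma> ^ 3"
        by (simp only: power_add mult_2)
      then show ?thesis
        by (simp only: v_def l_def power_add mult_ac)
    qed
    have R: "norm (R p) \<le> sqrt M'" for p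
    proof -
      define s where "s = v * \<gamma> ^ l * slope \<gamma> p"
      have "R p = ave r (\<lambda>q. wt (\<lambda>k x. c k x * cis (s * (x / 2 ^ Suc k))) q *
          cis (\<gamma> ^ (2 * n + 3) * u * quad \<gamma> q))"
        by (simp only: R_def wt_mult wt_exp_dya vl s_def)
      moreover have "bounded_weight (\<lambda>k x. c k x * cis (s * (x / 2 ^ Suc k)))"
        using c by (auto simp: bounded_weight_def norm_mult)
      ultimately have "(norm (R p))\<^sup>2 \<le> M'"
        by (simp only: M'(2))
      then show ?thesis by (rule real_le_rsqrt)
    qed
    have "ave r (\<lambda>q. wt c q * G w q) =
        ave l (\<lambda>p. (wt bp p * cis (v * quad \<gamma> p) * R p) * cis (v * slope \<gamma> w * dya p))" for w
    proof -
      have "ave r (\<lambda>q. wt c q * G w q) = ave r (\<lambda>q. ave l (\<lambda>p. (wt bp p * cis (v * quad \<gamma> p))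
        * (cis (v * slope \<gamma> w * dya p)) * (wt c q * cis (v * \<gamma> ^ l * slope \<gamma> p * dya q)
        * cis (v * \<gamma> ^ l * quad \<gamma> q))))"
        unfolding G_def ave_mult_left[symmetric] by (simp only: mult_ac)
      also have "\<dots> = ave l (\<lambda>p. (wt bp p * cis (v * quad \<gamma> p)) * (cis (v * slope \<gamma> w * dya p)) * R p)"
        unfolding R_def by (subst ave_swap) (simp only: ave_mult_left)
      finally show ?thesis by (simp only: mult_ac)
    qed
    then have "(norm (ave n (\<lambda>w. \<alpha> w * ave r (\<lambda>q. wt c q * G w q))))\<^sup>2 =
        (norm (ave n (\<lambda>w. \<alpha> w * ave l (\<lambda>p. (wt bp p * cis (v * quad \<gamma> p) * R p)
          * cis (v * slope \<gamma> w * dya p)))))\<^sup>2"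
      by simp
    also have "\<dots> \<le> (sqrt M')\<^sup>2 * ave n (\<lambda>w. ave n (\<lambda>w'. norm (ave l (\<lambda>p.
        cis ((v * slope \<gamma> w - v * slope \<gamma> w') * dya p)))))"
    proof (rule large_sieve[OF \<alpha>])
      fix p assume "p \<in> cube l"
      then have "norm (wt bp p) * norm (R p) \<le> 1 * sqrt M'"
        using R bw by (intro mult_mono norm_wt_le) auto
      then show "norm (wt bp p * cis (v * quad \<gamma> p) * R p) \<le> sqrt M'"
        by (simp add: norm_mult)
    qed
    also have "\<dots> \<le> M' * J"
      using J M' by (auto intro!: mult_left_mono)
    finally show ?thesis by (rule real_le_rsqrt)
  qed
  define \<alpha> where "\<alpha> w = wt b w * cis (u * quad \<gamma> w)" for w
  have split: "wt b (w @ p @ q) * cis (u * quad \<gamma> (w @ p @ q)) =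
      \<alpha> w * (wt bq q * (cis (v * slope \<gamma> w / 2 ^ l * dya q) *
        (wt bp p * cis (v * quad \<gamma> p) * cis (v * slope \<gamma> w * dya p)
        * cis (v * \<gamma> ^ l * slope \<gamma> p * dya q) * cis (v * \<gamma> ^ l * quad \<gamma> q))))"
    if "w \<in> cube n" "p \<in> cube l" for w p q
  proof -
    have lens: "length w = n" "length p = l"
      using that by (auto simp: length_cube)
    have "u * quad \<gamma> (w @ p @ q) = u * quad \<gamma> w + v * slope \<gamma> w / 2 ^ l * dya q + v * quad \<gamma> p
        + v * slope \<gamma> w * dya p + v * \<gamma> ^ l * slope \<gamma> p * dya q + v * \<gamma> ^ l * quad \<gamma> q"
      using \<gamma> by (simp add: quad_append dya_append lens v_def algebra_simps)
    then have "cis (u * quad \<gamma> (w @ p @ q)) = cis (u * quad \<gamma> w) * cis (v * slope \<gamma> w / 2 ^ l * dya q)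
        * cis (v * quad \<gamma> p) * cis (v * slope \<gamma> w * dya p) * cis (v * \<gamma> ^ l * slope \<gamma> p * dya q)
        * cis (v * \<gamma> ^ l * quad \<gamma> q)"
      by (simp only: cis_mult)
    moreover have "wt b (w @ p @ q) = wt b w * wt bp p * wt bq q"
      by (simp add: wt_append lens bp_def[abs_def] bq_def[abs_def] add.assoc)
    ultimately show ?thesis
      by (simp only: \<alpha>_def mult_ac)
  qed
  have "2 * n + 3 + r = n + (l + r)"
    by (simp add: l_def)
  then have "ave (2 * n + 3 + r) (\<lambda>x. wt b x * cis (u * quad \<gamma> x)) =
      ave n (\<lambda>w. ave l (\<lambda>p. ave r (\<lambda>q. wt b (w @ p @ q) * cis (u * quad \<gamma> (w @ p @ q)))))"
    by (simp only: ave_append)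
  also have "\<dots> = ave n (\<lambda>w. \<alpha> w * ave r (\<lambda>q. wt bq q * (cis (v * slope \<gamma> w / 2 ^ l * dya q) * G w q)))"
  proof (rule ave_cong)
    fix w assume w: "w \<in> cube n"
    have "ave l (\<lambda>p. ave r (\<lambda>q. wt b (w @ p @ q) * cis (u * quad \<gamma> (w @ p @ q)))) =
        ave l (\<lambda>p. ave r (\<lambda>q. \<alpha> w * (wt bq q * (cis (v * slope \<gamma> w / 2 ^ l * dya q) *
        (wt bp p * cis (v * quad \<gamma> p) * cis (v * slope \<gamma> w * dya p)
        * cis (v * \<gamma> ^ l * slope \<gamma> p * dya q) * cis (v * \<gamma> ^ l * quad \<gamma> q))))))"
      by (intro ave_cong split w)
    then show "ave l (\<lambda>p. ave r (\<lambda>q. wt b (w @ p @ q) * cis (u * quad \<gamma> (w @ p @ q)))) =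
        \<alpha> w * ave r (\<lambda>q. wt bq q * (cis (v * slope \<gamma> w / 2 ^ l * dya q) * G w q))"
      by (simp only: ave_swap[of l r] ave_mult_left G_def)
  qed
  also have "norm \<dots> \<le> exp 1 * sqrt (M' * J)"
  proof (rule decouple[OF H])
    fix w assume w: "w \<in> cube n"
    have "\<bar>v * slope \<gamma> w\<bar> \<le> 2 ^ n * (5 / 2)"
      unfolding abs_mult using slope_le[OF w] v_le by (intro mult_mono) auto
    also have "\<dots> \<le> 2 ^ l"
      by (simp add: l_def power_add)
    finally show "\<bar>v * slope \<gamma> w / 2 ^ l\<bar> \<le> 1"
      by simp
    show "norm (\<alpha> w) \<le> 1"
      using norm_wt_le[OF b w] by (simp add: \<alpha>_def norm_mult)
  qed (use bw in auto)
  finally have "(norm (ave (2 * n + 3 + r) (\<lambda>x. wt b x * cis (u * quad \<gamma> x))))\<^sup>2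
      \<le> (exp 1 * sqrt (M' * J))\<^sup>2"
    by (rule power_mono) simp
  also have "\<dots> = (exp 1)\<^sup>2 * J * M'"
    using M' J0 by (simp add: power_mult_distrib)
  finally show ?thesis by (simp add: J_def)
qed

section \<open>Iteration of the step and the decay exponent\<close>

text \<open>As \<open>\<kappa> = 2^(1/m - 1)\<close> decreases in \<open>m\<close>, the case
  \<open>m = 7\<close> is the worst; 0.56 is a rational bound for \<open>2^(-6/7)\<close>, since
  \<open>0.56^7 > 2^-6\<close>.\<close>

lemma gamma_bounds:
  assumes "m \<ge> 7" "\<gamma> = 2 powr (- 1 / real m)"
  shows "0 < \<gamma>" "\<gamma> < 1" "kappa \<gamma> \<le> 56 / 100"
proof -
  show "0 < \<gamma>" "\<gamma> < 1"
    using assms by (auto simp: powr_less_one divide_neg_pos)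
  have "kappa \<gamma> = 2 powr (1 / real m - 1)"
    by (simp add: kappa_def assms(2) powr_diff powr_minus_divide)
  also have "\<dots> \<le> 2 powr (- 6 / 7)"
    using assms by (intro powr_mono) (auto simp: divide_simps)
  also have "\<dots> \<le> 56 / 100"
  proof (rule power_le_imp_le_base)
    have "(2 powr (- 6 / 7)) ^ Suc 6 = (2::real) powr (- 6)"
      by (simp add: powr_realpow[symmetric] powr_powr)
    then show "(2 powr (- 6 / 7)) ^ Suc 6 \<le> (56 / 100 :: real) ^ Suc 6"
      by (simp add: powr_minus power_divide)
  qed simp
  finally show "kappa \<gamma> \<le> 56 / 100" .
qed

text \<open>With \<open>x = log 2 \<bar>u\<bar>\<close> and \<open>n\<close> the ceiling of
  \<open>x\<close>, one step gains \<open>x / 2\<close> in the exponent from the square root in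
  \<open>char_step\<close> and loses \<open>(3 * n + 15/4) / m\<close>, because the logarithmic
  frequency falls by \<open>(2 * n + 3) / m\<close> and the square root contains
  \<open>\<gamma>^n\<close>. As \<open>3 / m < 1 / 2\<close> for \<open>m \<ge> 7\<close>, the gain
  wins for large \<open>x\<close>. The condition \<open>\<gamma>^N * \<bar>u\<bar> \<le> 1\<close>
  passes unchanged to the remaining block. The exponent 5/4 exceeds 1, as integrability at infinity
  demands.\<close>

lemma char_decay:
  assumes m: "m \<ge> 7" and \<gamma>: "\<gamma> = 2 powr (- 1 / real m)"
  obtains A where "A > 0" "\<And>N u b. \<lbrakk>bounded_weight b; 1 \<le> \<bar>u\<bar>; \<gamma> ^ N * \<bar>u\<bar> \<le> 1\<rbrakk> \<Longrightarrow>
    (norm (ave N (\<lambda>x. wt b x * cis (u * quad \<gamma> x))))\<^sup>2 \<le> A * \<bar>u\<bar> powr (- 5 / 4)"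
proof -
  note \<gamma>b = gamma_bounds[OF m \<gamma>]
  have \<gamma>p: "\<gamma> ^ k = 2 powr (- real k / real m)" for k
    using m unfolding \<gamma> by (simp add: powr_realpow[symmetric] powr_powr)
  define K where "K = (exp 1)\<^sup>2 * (6 / (1 - \<gamma>))"
  have K: "K > 0" using \<gamma>b by (simp add: K_def)
  \<comment> \<open>Beyond \<open>x0\<close> the inequality
    \<open>log 2 K + (3 * (x + 1) + 15/4) / 7 \<le> x / 2\<close> holds, and the 2 guarantees
    \<open>n \<ge> 2\<close>. Up to \<open>x0\<close> the trivial bound 1 is covered by the choice
    of \<open>A\<close>.\<close>
  define x0 where "x0 = max 2 (14 * (log 2 K + 27 / 28))"
  define A :: real where "A = 2 powr (5 / 4 * x0)"
  have A: "A > 0" by (simp add: A_def)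
  have "(norm (ave N (\<lambda>x. wt b x * cis (u * quad \<gamma> x))))\<^sup>2 \<le> A * \<bar>u\<bar> powr (- 5 / 4)"
    if "bounded_weight b" "1 \<le> \<bar>u\<bar>" "\<gamma> ^ N * \<bar>u\<bar> \<le> 1" for N u b
    using that
  proof (induction N arbitrary: u b rule: less_induct)
    case (less N u b)
    define x where "x = log 2 \<bar>u\<bar>"
    have x: "\<bar>u\<bar> = 2 powr x" "x \<ge> 0"
      using less.prems by (auto simp: x_def)
    show ?case
    proof (cases "x \<le> x0")
      case True
      have "norm (ave N (\<lambda>x. wt b x * cis (u * quad \<gamma> x))) \<le> 1"
        using less.prems(1) by (intro norm_ave_bound) (simp add: norm_mult norm_wt_le)
      then have "(norm (ave N (\<lambda>x. wt b x * cis (u * quad \<gamma> x))))\<^sup>2 \<le> 1"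
        by (simp add: power_le_one)
      also have "1 = 2 powr 0" by simp
      also have "\<dots> \<le> (2::real) powr (5 / 4 * x0 + x * (- 5 / 4))"
        using True by (intro powr_mono) auto
      also have "\<dots> = A * \<bar>u\<bar> powr (- 5 / 4)"
        by (simp add: A_def x powr_powr flip: powr_add)
      finally show ?thesis .
    next
      case False
      define n where "n = nat \<lceil>x\<rceil>"
      have n: "x \<le> real n" "real n < x + 1"
        using x by (auto simp: n_def) linarith
      have x2: "x > 2" "x > 14 * (log 2 K + 27 / 28)"
        using False by (auto simp: x0_def)
      then have n2: "n \<ge> 2" using n by linarith
      \<comment> \<open>The hypothesis on \<open>N\<close> yields
        \<open>N \<ge> x * m \<ge> 7 * (n - 1) \<ge> 2 * n + 3\<close>, enough digits for a
        step.\<close>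
      have "2 powr (x - real N / real m) \<le> 2 powr 0"
      proof -
        have "\<gamma> ^ N * \<bar>u\<bar> = 2 powr (x - real N / real m)"
          by (simp add: \<gamma>p x flip: powr_add)
        with less.prems(3) show ?thesis by simp
      qed
      then have "x \<le> real N / real m"
        by (subst (asm) powr_le_cancel_iff) auto
      then have "x * real m \<le> real N"
        using m by (simp add: le_divide_eq)
      moreover have "(real n - 1) * 7 \<le> x * real m"
        using n m x2 by (intro mult_mono) auto
      ultimately have "real (2 * n + 3) \<le> real N"
        using n2 by simp
      then have N: "2 * n + 3 \<le> N" by (simp only: of_nat_le_iff)
      define r where "r = N - (2 * n + 3)"
      have N_eq: "N = 2 * n + 3 + r"
        using N by (simp add: r_def)
      define y where "y = x - real (2 * n + 3) / real m"
      have m7: "c / real m \<le> c / 7" if "c \<ge> 0" for c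
        using m that by (intro divide_left_mono) auto
      have y: "\<gamma> ^ (2 * n + 3) * \<bar>u\<bar> = 2 powr y"
        by (simp add: y_def \<gamma>p x flip: powr_add del: of_nat_add of_nat_Suc)
      have y0: "y \<ge> 0"
      proof -
        have "real (2 * n + 3) / real m \<le> real (2 * n + 3) / 7"
          by (rule m7) simp
        also have "\<dots> \<le> x"
          using n n2 by simp
        finally show ?thesis by (simp add: y_def)
      qed
      define M' where "M' = A * (2 powr y) powr (- 5 / 4)"
      have "(norm (ave N (\<lambda>x. wt b x * cis (u * quad \<gamma> x))))\<^sup>2
        \<le> (exp 1)\<^sup>2 * (6 / (1 - \<gamma>) / sqrt (\<bar>u\<bar> * \<gamma> ^ n)) * M'"
        unfolding N_eq
      proof (rule char_step[OF \<gamma>b])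
        show "u \<noteq> 0" using less.prems by auto
        have "2 powr x \<le> 2 powr real n"
          using n by (intro powr_mono) auto
        then show "\<bar>u\<bar> \<le> 2 ^ n"
          by (simp add: x powr_realpow)
        show "M' \<ge> 0" using A by (simp add: M'_def)
        fix c assume c: "bounded_weight c"
        have abs: "\<bar>\<gamma> ^ (2 * n + 3) * u\<bar> = 2 powr y"
          using y \<gamma>b by (simp add: abs_mult)
        have "(norm (ave r (\<lambda>q. wt c q * cis (\<gamma> ^ (2 * n + 3) * u * quad \<gamma> q))))\<^sup>2
            \<le> A * \<bar>\<gamma> ^ (2 * n + 3) * u\<bar> powr (- 5 / 4)"
        proof (rule less.IH[OF _ c])
          show "r < N" using N by (simp add: r_def)
          show "1 \<le> \<bar>\<gamma> ^ (2 * n + 3) * u\<bar>"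
            unfolding abs using y0 by (simp add: ge_one_powr_ge_zero)
          have "\<gamma> ^ r * \<bar>\<gamma> ^ (2 * n + 3) * u\<bar> = \<gamma> ^ N * \<bar>u\<bar>"
            using \<gamma>b by (simp add: N_eq abs_mult power_add mult_ac)
          then show "\<gamma> ^ r * \<bar>\<gamma> ^ (2 * n + 3) * u\<bar> \<le> 1"
            using less.prems by simp
        qed
        then show "(norm (ave r (\<lambda>q. wt c q * cis (\<gamma> ^ (2 * n + 3) * u * quad \<gamma> q))))\<^sup>2 \<le> M'"
          unfolding abs M'_def .
      qed (rule less.prems)
      also have "\<dots> = A * (K * 2 powr (- 5 / 4 * y - (x - real n / real m) / 2))"
      proof -
        have "sqrt (\<bar>u\<bar> * \<gamma> ^ n) = 2 powr ((x - real n / real m) / 2)"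
          by (simp add: x \<gamma>p powr_half_sqrt[symmetric] powr_powr flip: powr_add)
        then show ?thesis
          by (simp add: M'_def K_def powr_powr powr_diff mult_ac)
      qed
      also have "\<dots> \<le> A * \<bar>u\<bar> powr (- 5 / 4)"
      proof (rule mult_left_mono)
        have "K * 2 powr (- 5 / 4 * y - (x - real n / real m) / 2) =
            2 powr (log 2 K + (- 5 / 4 * y - (x - real n / real m) / 2))"
          using K by (simp add: powr_add)
        also have "\<dots> \<le> 2 powr (x * (- 5 / 4))"
        proof (rule powr_mono)
          have "- 5 / 4 * y - (x - real n / real m) / 2 =
              - 5 / 4 * x - x / 2 + (3 * real n + 15 / 4) / real m"
            using m by (simp add: y_def field_simps)
          moreover have "(3 * real n + 15 / 4) / real m \<le> (3 * real n + 15 / 4) / 7"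
            by (rule m7) simp
          ultimately show "log 2 K + (- 5 / 4 * y - (x - real n / real m) / 2) \<le> x * (- 5 / 4)"
            using n x2 by argo
        qed simp
        finally show "K * 2 powr (- 5 / 4 * y - (x - real n / real m) / 2) \<le> \<bar>u\<bar> powr (- 5 / 4)"
          by (simp add: x powr_powr)
      qed (use A in simp)
      finally show ?thesis .
    qed
  qed
  with A show ?thesis by (rule that)
qed

section \<open>The Rademacher chaos\<close>

lemma integrable_powr_tail:
  "integrable lborel (\<lambda>x::real. indicator {1..} \<bar>x\<bar> * \<bar>x\<bar> powr (- 5 / 4))"
proof -
  define k where "k x = indicator {1..} x * x powr (- 5 / 4)" for x :: real
  have "(\<integral>\<^sup>+x. ennreal (\<bar>x\<bar> powr (- 5 / 4)) * indicator {1..} x \<partial>lborel) =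
      ennreal (0 - (- 4 * 1 powr (- 1 / 4)))"
  proof (rule nn_integral_FTC_atLeast[where F = "\<lambda>x. - 4 * x powr (- 1 / 4)" and T = 0 and a = 1])
    show "((\<lambda>x. - 4 * x powr (- 1 / 4)) has_real_derivative \<bar>x\<bar> powr (- 5 / 4)) (at x)"
      if "1 \<le> x" for x :: real
      using that by (auto intro!: derivative_eq_intros)
    have "((\<lambda>x::real. x powr (- 1 / 4)) \<longlongrightarrow> 0) at_top"
      by (rule tendsto_neg_powr) (auto simp: filterlim_ident)
    from tendsto_mult_left[OF this, of "- 4"]
    show "((\<lambda>x::real. - 4 * x powr (- 1 / 4)) \<longlongrightarrow> 0) at_top"
      by simp
  qed auto
  also have "(\<integral>\<^sup>+x. ennreal (\<bar>x\<bar> powr (- 5 / 4)) * indicator {1..} x \<partial>lborel) =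
      (\<integral>\<^sup>+x. ennreal (norm (k x)) \<partial>lborel)"
    by (intro nn_integral_cong) (auto simp: k_def split: split_indicator)
  finally have k: "integrable lborel k"
    by (intro integrableI_bounded) (auto simp: k_def[abs_def])
  have "integrable lborel (\<lambda>x. k x + k (0 + - 1 * x))"
    by (intro Bochner_Integration.integrable_add k lborel_integrable_real_affine) auto
  also have "(\<lambda>x. k x + k (0 + - 1 * x)) = (\<lambda>x. indicator {1..} \<bar>x\<bar> * \<bar>x\<bar> powr (- 5 / 4))"
    by (auto simp: k_def fun_eq_iff split: split_indicator)
  finally show ?thesis .
qed

text \<open>Common to the chaos and the Takagi function: \<open>c\<close> is the factor of the
  quadratic form, and the weight may depend on \<open>u\<close>, as the linear part of the chaos
  does. For fixed \<open>u\<close> with \<open>\<bar>c * u\<bar> \<ge> 1\<close> the digit condition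
  of \<open>char_decay\<close> holds for all large \<open>N\<close>, so its bound survives the
  limit. Only norms are compared, since the Takagi means carry an extra phase.\<close>

lemma square_integrable_if_decay:
  fixes \<phi> :: "real \<Rightarrow> complex"
  assumes m: "m \<ge> 7" and \<gamma>: "\<gamma> = 2 powr (- 1 / real m)" and c: "c \<noteq> 0"
    and meas: "\<phi> \<in> borel_measurable borel"
    and b: "\<And>u. bounded_weight (b u)"
    and lim: "\<And>u. (\<lambda>N. norm (ave N (\<lambda>x. wt (b u) x * cis (c * u * quad \<gamma> x)))) \<longlonglongrightarrow> norm (\<phi> u)"
  shows "square_integrable \<phi>"
proof -
  obtain A where A: "A > 0" "\<And>N u b. \<lbrakk>bounded_weight b; 1 \<le> \<bar>u\<bar>; \<gamma> ^ N * \<bar>u\<bar> \<le> 1\<rbrakk> \<Longrightarrow>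
    (norm (ave N (\<lambda>x. wt b x * cis (u * quad \<gamma> x))))\<^sup>2 \<le> A * \<bar>u\<bar> powr (- 5 / 4)"
    using char_decay[OF m \<gamma>] by blast
  note \<gamma>b = gamma_bounds[OF m \<gamma>]
  define H where "H v = indicator {- 1..1} v + A * (indicator {1..} \<bar>v\<bar> * \<bar>v\<bar> powr (- 5 / 4))"
    for v :: real
  have "integrable lborel H"
    unfolding H_def
    by (intro Bochner_Integration.integrable_add integrable_mult_right integrable_powr_tail) auto
  then have H: "integrable lborel (\<lambda>u. H (0 + c * u))"
    using c by (rule lborel_integrable_real_affine)
  have bound: "(norm (\<phi> u))\<^sup>2 \<le> H (c * u)" for u
  proof (cases "\<bar>c * u\<bar> < 1")
    case True
    have "norm (\<phi> u) \<le> 1"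
    proof (rule LIMSEQ_le_const2[OF lim], intro exI allI impI)
      fix N
      show "norm (ave N (\<lambda>x. wt (b u) x * cis (c * u * quad \<gamma> x))) \<le> 1"
        using b by (intro norm_ave_bound) (simp add: norm_mult norm_wt_le)
    qed
    then have "(norm (\<phi> u))\<^sup>2 \<le> 1" by (simp add: power_le_one)
    moreover have "A * (indicator {1..} \<bar>c * u\<bar> * \<bar>c * u\<bar> powr (- 5 / 4)) \<ge> 0"
      using A by simp
    ultimately show ?thesis using True by (auto simp: H_def indicator_def)
  next
    case False
    have "(\<lambda>N. \<gamma> ^ N * \<bar>c * u\<bar>) \<longlonglongrightarrow> 0 * \<bar>c * u\<bar>"
      using \<gamma>b by (intro tendsto_mult LIMSEQ_power_zero tendsto_const) auto
    then have "\<forall>\<^sub>F N in sequentially. \<gamma> ^ N * \<bar>c * u\<bar> < 1"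
      by (rule order_tendstoD) simp
    then have ev: "\<forall>\<^sub>F N in sequentially.
        (norm (ave N (\<lambda>x. wt (b u) x * cis (c * u * quad \<gamma> x))))\<^sup>2 \<le> A * \<bar>c * u\<bar> powr (- 5 / 4)"
      by eventually_elim (intro A(2) b, use False in simp_all)
    have "(norm (\<phi> u))\<^sup>2 \<le> A * \<bar>c * u\<bar> powr (- 5 / 4)"
      by (rule tendsto_upperbound[OF tendsto_power[OF lim] ev]) simp
    also have "\<dots> \<le> H (c * u)"
      using False by (auto simp: H_def)
    finally show ?thesis .
  qed
  have "integrable lborel (\<lambda>u. (norm (\<phi> u))\<^sup>2)"
  proof (rule Bochner_Integration.integrable_bound[OF H])
    show "AE u in lborel. norm ((norm (\<phi> u))\<^sup>2) \<le> norm (H (0 + c * u))"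
      using bound by (intro AE_I2) (simp add: order_trans[OF _ abs_ge_self])
  qed (use meas in measurable)
  then show ?thesis
    using meas by (simp add: square_integrable_def)
qed

section \<open>Coefficients of the chaos and the quadratic form\<close>

text \<open>With \<open>\<kappa> / 2 = 1 / (4 * \<gamma>)\<close> the half-integral powers combine
  into integral ones.\<close>

lemma g_coeff_less:
  assumes "\<gamma> > 0" "i < k"
  shows "g_coeff \<gamma> i k = \<gamma> ^ i / 2 ^ Suc (k - i)"
proof -
  define d where "d = (real k - real i) / 2"
  have "(kappa \<gamma> / 2) powr d = (1 / 4) powr d * \<gamma> powr - d"
  proof -
    have "kappa \<gamma> / 2 = (1 / 4) * (1 / \<gamma>)" by (simp add: kappa_def)
    then have "(kappa \<gamma> / 2) powr d = (1 / 4) powr d * (1 / \<gamma>) powr d"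
      using assms by (simp only:) (rule powr_mult; simp)
    then show ?thesis using assms by (simp add: powr_divide powr_minus divide_simps)
  qed
  moreover have "(1 / 4 :: real) powr d = 1 / 2 ^ (k - i)"
  proof -
    have "(1 / 4 :: real) = (1 / 2) powr 2" by (simp add: power2_eq_square)
    then have "(1 / 4 :: real) powr d = (1 / 2) powr (real (k - i))"
    proof -
      have "2 * d = real (k - i)" using assms by (simp add: d_def of_nat_diff)
      then show ?thesis using \<open>(1 / 4 :: real) = _\<close> by (simp only: powr_powr)
    qed
    then show ?thesis by (simp add: powr_realpow power_one_over)
  qed
  moreover have "\<gamma> powr ((real i + real k) / 2) * \<gamma> powr - d = \<gamma> ^ i"
  proof -
    have "(real i + real k) / 2 + - d = real i" by (simp add: d_def field_simps)
    then show ?thesis using assms by (simp add: powr_realpow flip: powr_add)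
  qed
  ultimately show ?thesis
    using assms by (simp add: g_coeff_def d_def mult_ac)
qed

lemma g_coeff_commute: "g_coeff \<gamma> i k = g_coeff \<gamma> k i"
  by (simp add: g_coeff_def add.commute abs_minus_commute eq_commute[of i])

lemma g_coeff_nonneg: "\<gamma> > 0 \<Longrightarrow> 0 \<le> g_coeff \<gamma> i k"
  by (simp add: g_coeff_def)

text \<open>A majorant in product form, ready for absolute summability over pairs.\<close>

lemma g_coeff_le:
  assumes "0 < \<gamma>" "kappa \<gamma> \<le> 2"
  shows "g_coeff \<gamma> i k \<le> sqrt \<gamma> ^ i * sqrt \<gamma> ^ k"
proof -
  have "\<gamma> powr ((real i + real k) / 2) = sqrt \<gamma> ^ i * sqrt \<gamma> ^ k"
  proof -
    have "\<gamma> powr ((real i + real k) / 2) = sqrt \<gamma> powr (real (i + k))"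
      using assms by (simp add: powr_half_sqrt[symmetric] powr_powr)
    also have "\<dots> = sqrt \<gamma> ^ (i + k)"
      using assms by (subst powr_realpow) auto
    finally show ?thesis by (simp add: power_add)
  qed
  moreover have "(kappa \<gamma> / 2) powr (\<bar>real i - real k\<bar> / 2) \<le> 1"
  proof (rule powr_le1)
    have "0 < kappa \<gamma>" using assms by (simp add: kappa_def)
    then show "\<bar>kappa \<gamma> / 2\<bar> \<le> 1" using assms by auto
  qed simp
  moreover have "0 \<le> sqrt \<gamma> ^ i * sqrt \<gamma> ^ k"
    using assms by simp
  ultimately show ?thesis
    using mult_left_le[of "(kappa \<gamma> / 2) powr (\<bar>real i - real k\<bar> / 2)" "sqrt \<gamma> ^ i * sqrt \<gamma> ^ k"]
    by (auto simp: g_coeff_def)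
qed

lemma upt_Suc_Suc: "[1..<Suc (Suc N)] = [1..<Suc N] @ [Suc N]"
  by simp

lemma slope_map_upt:
  "slope \<gamma> (map Y [1..<Suc N]) = (\<Sum>i=1..N. Y i * kappa \<gamma> ^ (N - i))"
proof (induction N)
  case (Suc N)
  have "(\<Sum>i=1..N. Y i * kappa \<gamma> ^ (Suc N - i)) = kappa \<gamma> * (\<Sum>i=1..N. Y i * kappa \<gamma> ^ (N - i))"
    unfolding sum_distrib_left by (intro sum.cong) (auto simp: Suc_diff_le)
  then show ?case
    using Suc unfolding upt_Suc_Suc by (simp add: slope_append del: upt_Suc)
qed simp

text \<open>Each pair occurs in both orders, which cancels the factor 1/2 of \<open>g_coeff\<close>.
  Adding the last index produces cross terms proportional to the slope of the earlier digits, as in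
  \<open>quad_append\<close>.\<close>

lemma double_sum_g_tilde:
  assumes \<gamma>: "\<gamma> > 0"
  shows "(\<Sum>i=1..N. \<Sum>k=1..N. g_tilde \<gamma> i k * Y i * Y k) =
    - ((kappa \<gamma>)\<^sup>2 / 2) * quad \<gamma> (map Y [1..<Suc N])"
proof (induction N)
  case (Suc N)
  have *: "g_tilde \<gamma> (Suc N) (Suc N) = 0"
    by (simp add: g_tilde_def g_coeff_def)
  have cross: "(\<Sum>i=1..N. g_tilde \<gamma> i (Suc N) * Y i * Y (Suc N)) =
      - ((kappa \<gamma>)\<^sup>2 / 2) * (\<gamma> ^ N * slope \<gamma> (map Y [1..<Suc N]) * Y (Suc N) / 4)"
  proof -
    have "g_tilde \<gamma> i (Suc N) = - ((kappa \<gamma>)\<^sup>2 / 2) * (\<gamma> ^ N * kappa \<gamma> ^ (N - i) / 4)"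
      if "i \<in> {1..N}" for i
    proof -
      have "\<gamma> ^ N * kappa \<gamma> ^ (N - i) = \<gamma> ^ i * (\<gamma> * kappa \<gamma>) ^ (N - i)"
        using that by (simp add: power_mult_distrib flip: power_add)
      also have "\<gamma> * kappa \<gamma> = 1 / 2"
        using \<gamma> by (simp add: kappa_def)
      finally show ?thesis
        using that \<gamma> by (simp add: g_tilde_def g_coeff_less Suc_diff_le power_one_over)
    qed
    then have "(\<Sum>i=1..N. g_tilde \<gamma> i (Suc N) * Y i * Y (Suc N)) =
      (\<Sum>i=1..N. - ((kappa \<gamma>)\<^sup>2 / 2) * (\<gamma> ^ N * kappa \<gamma> ^ (N - i) / 4) * Y i * Y (Suc N))"
      by (intro sum.cong) auto
    also have "\<dots> = - ((kappa \<gamma>)\<^sup>2 / 2) * (\<gamma> ^ N * (\<Sum>i=1..N. Y i * kappa \<gamma> ^ (N - i)) * Y (Suc N) / 4)"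
      by (simp add: sum_distrib_left sum_distrib_right sum_divide_distrib sum_negf mult_ac)
    finally show ?thesis unfolding slope_map_upt .
  qed
  have cross': "(\<Sum>k=1..N. g_tilde \<gamma> (Suc N) k * Y (Suc N) * Y k) =
      (\<Sum>i=1..N. g_tilde \<gamma> i (Suc N) * Y i * Y (Suc N))"
    by (intro sum.cong) (auto simp: g_tilde_def g_coeff_commute)
  have "(\<Sum>i=1..Suc N. \<Sum>k=1..Suc N. g_tilde \<gamma> i k * Y i * Y k) =
      (\<Sum>i=1..N. \<Sum>k=1..N. g_tilde \<gamma> i k * Y i * Y k)
      + 2 * (\<Sum>i=1..N. g_tilde \<gamma> i (Suc N) * Y i * Y (Suc N))"
    using cross' by (simp add: sum.distrib *)
  also have "\<dots> = - ((kappa \<gamma>)\<^sup>2 / 2) * (quad \<gamma> (map Y [1..<Suc N])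
      + \<gamma> ^ N * slope \<gamma> (map Y [1..<Suc N]) * Y (Suc N) / 2)"
    unfolding Suc cross by (simp add: algebra_simps)
  also have "quad \<gamma> (map Y [1..<Suc N]) + \<gamma> ^ N * slope \<gamma> (map Y [1..<Suc N]) * Y (Suc N) / 2
      = quad \<gamma> (map Y [1..<Suc (Suc N)])"
    using \<gamma> unfolding upt_Suc_Suc by (simp add: quad_append del: upt_Suc)
  finally show ?case .
qed simp

lemma wt_cis_map_upt:
  "wt (\<lambda>k x. cis (u * (f (Suc k) * x))) (map Y [1..<Suc N]) = cis (u * (\<Sum>i=1..N. f i * Y i))"
proof (induction N)
  case (Suc N)
  then show ?case
    unfolding upt_Suc_Suc
    by (simp add: wt_append cis_mult distrib_left del: upt_Suc)
qed simp

text \<open>For \<open>xs\<close> in the cube the weight is \<open>2^N\<close> if \<open>xs\<close> is the list of the \<open>Y i\<close> and \<open>0\<close> otherwise.\<close>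

lemma ave_kernel:
  assumes "\<And>n. n \<ge> 1 \<Longrightarrow> Y n \<in> {- 1, 1}"
  shows "h (map Y [1..<Suc N]) = ave N (\<lambda>xs. h xs * wt (\<lambda>k x. of_real (1 + x * Y (Suc k))) xs)"
  using assms
proof (induction N arbitrary: h Y)
  case (Suc N)
  have "map Y [1..<Suc (Suc N)] = Y 1 # map (\<lambda>i. Y (Suc i)) [1..<Suc N]"
    by (subst upt_conv_Cons) (simp_all add: map_Suc_upt[symmetric] del: upt_Suc)
  then have "h (map Y [1..<Suc (Suc N)]) = (\<lambda>xs. h (Y 1 # xs)) (map (\<lambda>i. Y (Suc i)) [1..<Suc N])"
    by simp
  also have "\<dots> = ave N (\<lambda>xs. h (Y 1 # xs) * wt (\<lambda>k x. of_real (1 + x * Y (Suc (Suc k)))) xs)"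
    by (rule Suc.IH) (use Suc.prems in auto)
  also have "\<dots> = ave (Suc N) (\<lambda>xs. h xs * wt (\<lambda>k x. of_real (1 + x * Y (Suc k))) xs)"
    using Suc.prems[of 1] by (auto simp: ave_mult_left[symmetric] scaleR_conv_of_real mult_ac)
  finally show ?case .
qed simp

lemma wt_eq_prod: "wt b xs = (\<Prod>k<length xs. b k (xs ! k))"
  by (induction xs arbitrary: b) (simp_all add: prod.lessThan_Suc_shift del: prod.lessThan_Suc)

section \<open>Measurability and exhaustion of unordered sums\<close>

text \<open>Unordered summability of reals is absolute. Along an enumeration the sum is thus an
  ordinary series where the absolute series is finite, and the default value 0 elsewhere; both
  pieces are measurable.\<close>

lemma borel_measurable_infsum_real:
  fixes h :: "'i \<Rightarrow> 'a \<Rightarrow> real"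
  assumes A: "countable A" "infinite A" and h: "\<And>i. i \<in> A \<Longrightarrow> h i \<in> borel_measurable M"
  shows "(\<lambda>\<omega>. \<Sum>\<^sub>\<infinity>i\<in>A. h i \<omega>) \<in> borel_measurable M"
proof -
  define e where "e = from_nat_into A"
  have e: "bij_betw e UNIV A"
    unfolding e_def using A by (rule bij_betw_from_nat_into)
  have [measurable]: "h (e n) \<in> borel_measurable M" for n
    using e h[of "e n"] by (auto simp: bij_betw_def)
  have eq: "(\<Sum>\<^sub>\<infinity>i\<in>A. h i \<omega>) =
      (if (\<Sum>n. ennreal \<bar>h (e n) \<omega>\<bar>) \<noteq> \<top> then \<Sum>n. h (e n) \<omega> else 0)" for \<omega>
  proof -
    have "(\<Sum>\<^sub>\<infinity>i\<in>A. h i \<omega>) = (\<Sum>\<^sub>\<infinity>n. h (e n) \<omega>)"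
      using infsum_reindex_bij_betw[OF e, of "\<lambda>i. h i \<omega>"] by simp
    also have "\<dots> = (if (\<Sum>n. ennreal \<bar>h (e n) \<omega>\<bar>) \<noteq> \<top> then \<Sum>n. h (e n) \<omega> else 0)"
    proof (cases "(\<Sum>n. ennreal \<bar>h (e n) \<omega>\<bar>) \<noteq> \<top>")
      case True
      then have "summable (\<lambda>n. \<bar>h (e n) \<omega>\<bar>)"
        by (intro summable_suminf_not_top) auto
      then have "((\<lambda>n. h (e n) \<omega>) has_sum (\<Sum>n. h (e n) \<omega>)) UNIV"
        by (intro norm_summable_imp_has_sum summable_sums) (auto intro: summable_rabs_cancel)
      then show ?thesis using True by (simp add: infsumI)
    next
      case False
      have "\<not> (\<lambda>n. h (e n) \<omega>) summable_on UNIV"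
      proof
        assume "(\<lambda>n. h (e n) \<omega>) summable_on UNIV"
        then have "summable (\<lambda>n. \<bar>h (e n) \<omega>\<bar>)"
          using summable_on_imp_summable[of "\<lambda>n. \<bar>h (e n) \<omega>\<bar>"]
            summable_on_iff_abs_summable_on_real[of "\<lambda>n. h (e n) \<omega>" UNIV] by simp
        with False show False
          using ennreal_suminf_neq_top by auto
      qed
      with False show ?thesis by (simp add: infsum_not_exists)
    qed
    finally show ?thesis .
  qed
  show ?thesis unfolding eq by measurable
qed

text \<open>An increasing exhaustion swallows every finite subset at some stage, so it is cofinal in
  the net of all finite subsets.\<close>

lemma has_sum_exhaustion:
  assumes "(f has_sum s) A"
    and "\<And>N. finite (G N)" "\<And>N. G N \<subseteq> A" "incseq G" "A \<subseteq> (\<Union>N. G N)"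
  shows "(\<lambda>N. sum f (G N)) \<longlonglongrightarrow> s"
proof -
  have "filterlim G (finite_subsets_at_top A) sequentially"
    unfolding filterlim_iff eventually_finite_subsets_at_top
  proof safe
    fix P F assume F: "finite F" "F \<subseteq> A" "\<forall>Y. finite Y \<and> F \<subseteq> Y \<and> Y \<subseteq> A \<longrightarrow> P Y"
    have "\<exists>N. F \<subseteq> G N"
      using F(1,2)
    proof (induction F rule: finite_induct)
      case (insert x F)
      then obtain N K where "F \<subseteq> G N" "x \<in> G K" using assms(5) by auto
      then have "insert x F \<subseteq> G (max N K)"
        using incseqD[OF assms(4), of N "max N K"] incseqD[OF assms(4), of K "max N K"] by auto
      then show ?case by blast
    qed simp
    then obtain N where N: "F \<subseteq> G N" ..
    show "\<forall>\<^sub>F N in sequentially. P (G N)"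
      using eventually_ge_at_top[of N]
    proof eventually_elim
      case (elim K)
      then show ?case
        using N F(3)[rule_format, of "G K"] incseqD[OF assms(4) elim] assms(2,3) by auto
    qed
  qed
  then show ?thesis
    using assms(1) unfolding has_sum_def by (rule filterlim_compose[rotated])
qed

lemma summable_on_geometric_product:
  fixes s :: real
  assumes "0 \<le> s" "s < 1"
  shows "(\<lambda>(i, k). s ^ i * s ^ k) summable_on {1::nat..} \<times> {1::nat..}"
proof -
  have s: "(\<lambda>k. norm (s ^ k)) summable_on {1::nat..}"
    by (rule summable_on_subset_banach[of _ UNIV])
      (use assms in \<open>auto intro!: norm_summable_imp_summable_on summable_geometric\<close>)
  have "(\<lambda>x. norm ((\<lambda>(i, k). s ^ i * s ^ k) x)) summable_on {1::nat..} \<times> {1::nat..}"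
    unfolding Infinite_Sum.abs_summable_on_Sigma_iff
    using assms s by (auto simp: abs_mult infsum_cmult_right' intro!: summable_on_cmult_right summable_on_cmult_left)
  then show ?thesis by (rule abs_summable_summable)
qed

section \<open>Rademacher expectations as means over the cube\<close>

lemma rademacher_measurable:
  assumes "rademacher_sequence M X" "n \<ge> 1"
  shows "X n \<in> borel_measurable M"
  using assms by (auto simp: rademacher_sequence_def prob_space.indep_vars_def)

lemma rademacher_AE:
  assumes "rademacher_sequence M X"
  shows "AE \<omega> in M. \<forall>n\<ge>1. X n \<omega> \<in> {- 1, 1}"
proof -
  interpret prob_space M using assms by (simp add: rademacher_sequence_def)
  have "AE \<omega> in M. n \<ge> 1 \<longrightarrow> X n \<omega> \<in> {- 1, 1}" for n
  proof (cases "n \<ge> 1")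
    case True
    have [measurable]: "X n \<in> borel_measurable M"
      using assms True by (rule rademacher_measurable)
    have "prob ({\<omega> \<in> space M. X n \<omega> = 1} \<union> {\<omega> \<in> space M. X n \<omega> = - 1}) = 1 / 2 + 1 / 2"
      using assms True by (subst finite_measure_Union) (auto simp: rademacher_sequence_def)
    then have "AE \<omega> in M. \<omega> \<in> {\<omega> \<in> space M. X n \<omega> = 1} \<union> {\<omega> \<in> space M. X n \<omega> = - 1}"
      by (subst AE_in_set_eq_1) auto
    then show ?thesis by eventually_elim auto
  qed simp
  then show ?thesis by (simp add: AE_all_countable)
qed

lemma rademacher_mean:
  assumes "rademacher_sequence M X" "n \<ge> 1"
  shows "integrable M (X n)" "(LINT \<omega>|M. X n \<omega>) = 0"
proof -
  interpret prob_space M using assms by (simp add: rademacher_sequence_def)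
  have [measurable]: "X n \<in> borel_measurable M"
    using assms by (rule rademacher_measurable)
  have AE: "AE \<omega> in M. X n \<omega> \<in> {- 1, 1}"
    using rademacher_AE[OF assms(1)] by eventually_elim (use assms(2) in blast)
  then have "AE \<omega> in M. norm (X n \<omega>) \<le> 1"
    by eventually_elim auto
  then show "integrable M (X n)"
    by (rule integrable_const_bound) measurable
  have "(LINT \<omega>|M. X n \<omega>) =
      (LINT \<omega>|M. indicator {\<omega> \<in> space M. X n \<omega> = 1} \<omega> - indicator {\<omega> \<in> space M. X n \<omega> = - 1} \<omega>)"
  proof (rule integral_cong_AE)
    show "AE \<omega> in M. X n \<omega> =
        indicator {\<omega> \<in> space M. X n \<omega> = 1} \<omega> - indicator {\<omega> \<in> space M. X n \<omega> = - 1} \<omega>"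
      using AE AE_space by eventually_elim (auto simp: indicator_def)
  qed measurable
  also have "\<dots> = prob {\<omega> \<in> space M. X n \<omega> = 1} - prob {\<omega> \<in> space M. X n \<omega> = - 1}"
    by (subst Bochner_Integration.integral_diff) (auto simp: emeasure_eq_measure)
  also have "\<dots> = 1 / 2 - 1 / 2"
  proof -
    have "prob {\<omega> \<in> space M. X n \<omega> = 1} = 1 / 2 \<and> prob {\<omega> \<in> space M. X n \<omega> = - 1} = 1 / 2"
      using assms unfolding rademacher_sequence_def by blast
    then show ?thesis by (simp only:)
  qed
  finally show "(LINT \<omega>|M. X n \<omega>) = 0" by simp
qed

text \<open>Every factor \<open>1 + x * X n\<close> has mean 1 because \<open>X n\<close> is
  centred, and independence multiplies these means; integrating the kernel of
  \<open>ave_kernel\<close> thus leaves the uniform mean.\<close>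

lemma rademacher_kernel_mean:
  assumes "rademacher_sequence M X"
  shows "integrable M (\<lambda>\<omega>. wt (\<lambda>k x. complex_of_real (1 + x * X (Suc k) \<omega>)) xs)"
    and "(LINT \<omega>|M. wt (\<lambda>k x. complex_of_real (1 + x * X (Suc k) \<omega>)) xs) = 1"
proof -
  interpret prob_space M using assms by (simp add: rademacher_sequence_def)
  define Y where "Y i \<omega> = complex_of_real (1 + xs ! (i - 1) * X i \<omega>)" for i \<omega>
  have eq: "wt (\<lambda>k x. complex_of_real (1 + x * X (Suc k) \<omega>)) xs = (\<Prod>i\<in>{1..length xs}. Y i \<omega>)" for \<omega>
    by (simp only: wt_eq_prod Y_def prod.atLeast1_atMost_eq diff_Suc_Suc diff_zero One_nat_def)
  have "indep_vars (\<lambda>_. borel) X {1..length xs}"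
    using assms unfolding rademacher_sequence_def
    by (intro indep_vars_subset[of "\<lambda>_. borel" X "{1..}" "{1..length xs}"]) auto
  then have indep: "indep_vars (\<lambda>_. borel) Y {1..length xs}"
    unfolding Y_def[abs_def]
    by (rule indep_vars_compose2[where Y = "\<lambda>i x. complex_of_real (1 + xs ! (i - 1) * x)"])
      measurable
  have Y: "integrable M (Y i)" "(LINT \<omega>|M. Y i \<omega>) = 1" if "i \<in> {1..length xs}" for i
  proof -
    have X: "integrable M (X i)" "(LINT \<omega>|M. X i \<omega>) = 0"
      using rademacher_mean[OF assms, of i] that by auto
    then show "integrable M (Y i)" "(LINT \<omega>|M. Y i \<omega>) = 1"
      unfolding Y_def by (auto simp: prob_space)
  qed
  show "integrable M (\<lambda>\<omega>. wt (\<lambda>k x. complex_of_real (1 + x * X (Suc k) \<omega>)) xs)"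
    unfolding eq by (rule indep_vars_integrable[OF _ indep Y(1)]) auto
  have "(LINT \<omega>|M. (\<Prod>i\<in>{1..length xs}. Y i \<omega>)) = (\<Prod>i\<in>{1..length xs}. LINT \<omega>|M. Y i \<omega>)"
    by (rule indep_vars_lebesgue_integral[OF _ indep Y(1)]) auto
  also have "\<dots> = 1"
    using Y(2) by simp
  finally show "(LINT \<omega>|M. wt (\<lambda>k x. complex_of_real (1 + x * X (Suc k) \<omega>)) xs) = 1"
    unfolding eq .
qed

lemma integral_ave:
  fixes h :: "'a \<Rightarrow> real list \<Rightarrow> 'b::{banach, second_countable_topology}"
  assumes "\<And>xs. integrable M (\<lambda>\<omega>. h \<omega> xs)"
  shows "integrable M (\<lambda>\<omega>. ave N (h \<omega>))"
    and "(LINT \<omega>|M. ave N (h \<omega>)) = ave N (\<lambda>xs. LINT \<omega>|M. h \<omega> xs)"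
proof -
  have "integrable M (\<lambda>\<omega>. ave N (h \<omega>)) \<and>
      (LINT \<omega>|M. ave N (h \<omega>)) = ave N (\<lambda>xs. LINT \<omega>|M. h \<omega> xs)"
    using assms
  proof (induction N arbitrary: h)
    case (Suc N)
    from Suc.IH[of "\<lambda>\<omega> xs. h \<omega> (1 # xs)"] Suc.IH[of "\<lambda>\<omega> xs. h \<omega> (- 1 # xs)"] Suc.prems
    show ?case by simp
  qed simp
  then show "integrable M (\<lambda>\<omega>. ave N (h \<omega>))"
    "(LINT \<omega>|M. ave N (h \<omega>)) = ave N (\<lambda>xs. LINT \<omega>|M. h \<omega> xs)"
    by blast+
qed

text \<open>By \<open>ave_kernel\<close> the integrand is almost surely a cube mean of constants
  times kernels, so linearity takes the place of a description of the joint law.\<close>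

lemma rademacher_integral:
  fixes h :: "real list \<Rightarrow> complex"
  assumes X: "rademacher_sequence M X"
    and meas: "(\<lambda>\<omega>. h (map (\<lambda>i. X i \<omega>) [1..<Suc N])) \<in> borel_measurable M"
  shows "(LINT \<omega>|M. h (map (\<lambda>i. X i \<omega>) [1..<Suc N])) = ave N h"
proof -
  have int: "integrable M (\<lambda>\<omega>. h xs * wt (\<lambda>k x. complex_of_real (1 + x * X (Suc k) \<omega>)) xs)" for xs
    by (intro integrable_mult_right rademacher_kernel_mean X)
  have "(LINT \<omega>|M. h (map (\<lambda>i. X i \<omega>) [1..<Suc N])) =
      (LINT \<omega>|M. ave N (\<lambda>xs. h xs * wt (\<lambda>k x. complex_of_real (1 + x * X (Suc k) \<omega>)) xs))"
  proof (rule integral_cong_AE[OF meas borel_measurable_integrable[OF integral_ave(1)[OF int]]])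
    show "AE \<omega> in M. h (map (\<lambda>i. X i \<omega>) [1..<Suc N]) =
        ave N (\<lambda>xs. h xs * wt (\<lambda>k x. complex_of_real (1 + x * X (Suc k) \<omega>)) xs)"
      using rademacher_AE[OF X] by eventually_elim (rule ave_kernel; blast)
  qed
  also have "\<dots> = ave N (\<lambda>xs. h xs * 1)"
    unfolding integral_ave(2)[OF int]
    by (simp only: integral_mult_right_zero rademacher_kernel_mean(2)[OF X])
  finally show ?thesis by simp
qed

section \<open>Convergence of the partial sums of the chaos\<close>

lemma f_coeff_le:
  assumes "0 < \<gamma>" "kappa \<gamma> \<le> 1"
  shows "\<bar>f_coeff \<gamma> \<xi> n\<bar> \<le> ((kappa \<gamma>)\<^sup>2 + (1 + kappa \<gamma>) / 2 * \<bar>S0 \<gamma> \<xi>\<bar>) * \<gamma> ^ n"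
proof -
  have \<kappa>: "0 < kappa \<gamma>" using assms by (simp add: kappa_def)
  have "\<bar>(1 + kappa \<gamma>) * kappa \<gamma> ^ n / 2 * S0 \<gamma> \<xi>\<bar> = (1 + kappa \<gamma>) / 2 * \<bar>S0 \<gamma> \<xi>\<bar> * kappa \<gamma> ^ n"
    using \<kappa> by (simp add: abs_mult)
  also have "\<dots> \<le> (1 + kappa \<gamma>) / 2 * \<bar>S0 \<gamma> \<xi>\<bar> * 1"
    using \<kappa> assms by (intro mult_left_mono power_le_one) auto
  finally have "\<bar>(kappa \<gamma>)\<^sup>2 + (1 + kappa \<gamma>) * kappa \<gamma> ^ n / 2 * S0 \<gamma> \<xi>\<bar>
      \<le> (kappa \<gamma>)\<^sup>2 + (1 + kappa \<gamma>) / 2 * \<bar>S0 \<gamma> \<xi>\<bar>"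
    by (intro order_trans[OF abs_triangle_ineq]) auto
  then show ?thesis
    using assms by (simp add: f_coeff_def abs_mult mult.commute mult_left_mono)
qed

lemma I1_tendsto:
  assumes "0 < \<gamma>" "\<gamma> < 1" "kappa \<gamma> \<le> 1" and Y: "\<And>n. n \<ge> 1 \<Longrightarrow> X n \<omega> \<in> {- 1, 1}"
  shows "(\<lambda>N. \<Sum>i=1..N. f_coeff \<gamma> \<xi> i * X i \<omega>) \<longlonglongrightarrow> I1 X (f_coeff \<gamma> \<xi>) \<omega>"
proof -
  define C where "C = (kappa \<gamma>)\<^sup>2 + (1 + kappa \<gamma>) / 2 * \<bar>S0 \<gamma> \<xi>\<bar>"
  have "(\<lambda>i. f_coeff \<gamma> \<xi> i * X i \<omega>) summable_on {1..}"
  proof (rule Infinite_Sum.abs_summable_summable, rule Infinite_Sum.abs_summable_on_comparison_test')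
    show "(\<lambda>n. C * \<gamma> ^ n) summable_on {1..}"
      using assms
      by (intro summable_on_cmult_right summable_on_subset_banach[of _ UNIV "{1..}"])
        (auto intro!: norm_summable_imp_summable_on summable_geometric)
    show "norm (f_coeff \<gamma> \<xi> n * X n \<omega>) \<le> C * \<gamma> ^ n" if "n \<in> {1..}" for n
      using f_coeff_le[OF assms(1,3), of \<xi> n] Y[of n] that by (auto simp: C_def abs_mult)
  qed
  then have "((\<lambda>i. f_coeff \<gamma> \<xi> i * X i \<omega>) has_sum I1 X (f_coeff \<gamma> \<xi>) \<omega>) {1..}"
    unfolding I1_def by (rule has_sum_infsum)
  then show ?thesis
    by (rule has_sum_exhaustion) (auto simp: incseq_def)
qed

lemma I2_tendsto:
  assumes "0 < \<gamma>" "\<gamma> < 1" "kappa \<gamma> \<le> 1" and Y: "\<And>n. n \<ge> 1 \<Longrightarrow> X n \<omega> \<in> {- 1, 1}"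
  shows "(\<lambda>N. \<Sum>i=1..N. \<Sum>k=1..N. g_tilde \<gamma> i k * X i \<omega> * X k \<omega>) \<longlonglongrightarrow> I2 X (g_tilde \<gamma>) \<omega>"
proof -
  have "(\<lambda>(i, k). g_tilde \<gamma> i k * X i \<omega> * X k \<omega>) summable_on {1..} \<times> {1..}"
  proof (rule Infinite_Sum.abs_summable_summable, rule Infinite_Sum.abs_summable_on_comparison_test')
    show "(\<lambda>p. (kappa \<gamma>)\<^sup>2 / 2 * (case p of (i, k) \<Rightarrow> sqrt \<gamma> ^ i * sqrt \<gamma> ^ k)) summable_on {1..} \<times> {1..}"
      using assms by (intro summable_on_cmult_right summable_on_geometric_product) auto
    fix p :: "nat \<times> nat" assume "p \<in> {1..} \<times> {1..}"
    then obtain i k where p: "p = (i, k)" "i \<ge> 1" "k \<ge> 1" by auto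
    have "\<bar>X i \<omega>\<bar> = 1" "\<bar>X k \<omega>\<bar> = 1"
      using Y[of i] Y[of k] p by auto
    moreover have "\<bar>g_tilde \<gamma> i k\<bar> \<le> (kappa \<gamma>)\<^sup>2 / 2 * (sqrt \<gamma> ^ i * sqrt \<gamma> ^ k)"
      using g_coeff_le[of \<gamma> i k] g_coeff_nonneg[of \<gamma> i k] assms
      by (auto simp: g_tilde_def abs_mult intro!: mult_left_mono)
    ultimately show "norm (case p of (i, k) \<Rightarrow> g_tilde \<gamma> i k * X i \<omega> * X k \<omega>)
        \<le> (kappa \<gamma>)\<^sup>2 / 2 * (case p of (i, k) \<Rightarrow> sqrt \<gamma> ^ i * sqrt \<gamma> ^ k)"
      by (simp add: p abs_mult)
  qed
  then have "((\<lambda>(i, k). g_tilde \<gamma> i k * X i \<omega> * X k \<omega>) has_sum I2 X (g_tilde \<gamma>) \<omega>) ({1..} \<times> {1..})"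
    unfolding I2_def by (rule has_sum_infsum)
  then have "(\<lambda>N. \<Sum>(i, k)\<in>{1..N} \<times> {1..N}. g_tilde \<gamma> i k * X i \<omega> * X k \<omega>) \<longlonglongrightarrow> I2 X (g_tilde \<gamma>) \<omega>"
  proof (rule has_sum_exhaustion)
    show "{1..} \<times> {1..} \<subseteq> (\<Union>N. {1..N} \<times> {1..N::nat})"
    proof
      fix p :: "nat \<times> nat" assume "p \<in> {1..} \<times> {1..}"
      then show "p \<in> (\<Union>N. {1..N} \<times> {1..N})"
        by (intro UN_I[of "max (fst p) (snd p)"]) auto
    qed
  qed (auto simp: incseq_def)
  then show ?thesis by (simp add: sum.cartesian_product)
qed

lemma chaos_char_square_integrable:
  assumes m: "m \<ge> 7" and \<gamma>: "\<gamma> = 2 powr (- 1 / real m)" and X: "rademacher_sequence M X"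
  shows "square_integrable (chaos_char M X \<gamma> \<xi>)"
proof -
  interpret prob_space M using X by (simp add: rademacher_sequence_def)
  note \<gamma>b = gamma_bounds[OF m \<gamma>]
  define c where "c = - ((kappa \<gamma>)\<^sup>2 / 2)"
  have c: "c \<noteq> 0" using \<gamma>b by (simp add: c_def kappa_def)
  have X_meas: "X n \<in> borel_measurable M" if "n \<in> {1..}" for n
    using X that by (intro rademacher_measurable) auto
  define ZN where "ZN N \<omega> = (\<Sum>i=1..N. f_coeff \<gamma> \<xi> i * X i \<omega>)
    + (\<Sum>i=1..N. \<Sum>k=1..N. g_tilde \<gamma> i k * X i \<omega> * X k \<omega>)" for N \<omega>
  define Z where "Z \<omega> = I1 X (f_coeff \<gamma> \<xi>) \<omega> + I2 X (g_tilde \<gamma>) \<omega>" for \<omega>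
  have ZN_meas [measurable]: "ZN N \<in> borel_measurable M" for N
    unfolding ZN_def[abs_def]
    by (intro borel_measurable_add borel_measurable_sum borel_measurable_times X_meas
        borel_measurable_const) auto
  have Z_meas [measurable]: "Z \<in> borel_measurable M"
  proof -
    have "I1 X (f_coeff \<gamma> \<xi>) \<in> borel_measurable M"
      unfolding I1_def[abs_def]
      by (intro borel_measurable_infsum_real borel_measurable_times X_meas borel_measurable_const)
        (auto simp: infinite_Ici)
    moreover have "I2 X (g_tilde \<gamma>) \<in> borel_measurable M"
      unfolding I2_def[abs_def]
      by (intro borel_measurable_infsum_real)
        (auto simp: infinite_Ici finite_cartesian_product_iff
          intro!: borel_measurable_times X_meas borel_measurable_const)
    ultimately show ?thesis unfolding Z_def[abs_def] by (rule borel_measurable_add)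
  qed
  have Z_lim: "AE \<omega> in M. (\<lambda>N. ZN N \<omega>) \<longlonglongrightarrow> Z \<omega>"
    using rademacher_AE[OF X]
  proof eventually_elim
    case (elim \<omega>)
    with \<gamma>b show ?case
      unfolding ZN_def Z_def by (intro tendsto_add I1_tendsto I2_tendsto) auto
  qed
  \<comment> \<open>The linear part becomes a weight of modulus 1; \<open>Suc k\<close> appears
    because \<open>wt\<close> counts digits from 0 and the chaos from 1.\<close>
  define b where "b u k x = cis (u * (f_coeff \<gamma> \<xi> (Suc k) * x))" for u k x
  have b: "bounded_weight (b u)" for u
    by (simp add: bounded_weight_def b_def)
  define A where "A N u = ave N (\<lambda>x. wt (b u) x * cis (c * u * quad \<gamma> x))" for N u
  have A: "(LINT \<omega>|M. cis (u * ZN N \<omega>)) = A N u" for N u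
  proof -
    have eq: "cis (u * ZN N \<omega>) = (\<lambda>x. wt (b u) x * cis (c * u * quad \<gamma> x)) (map (\<lambda>i. X i \<omega>) [1..<Suc N])" for \<omega>
    proof -
      have "wt (b u) (map (\<lambda>i. X i \<omega>) [1..<Suc N]) = cis (u * (\<Sum>i=1..N. f_coeff \<gamma> \<xi> i * X i \<omega>))"
        unfolding b_def[abs_def] by (rule wt_cis_map_upt)
      moreover have "c * u * quad \<gamma> (map (\<lambda>i. X i \<omega>) [1..<Suc N]) =
          u * (\<Sum>i=1..N. \<Sum>k=1..N. g_tilde \<gamma> i k * X i \<omega> * X k \<omega>)"
        unfolding double_sum_g_tilde[OF \<gamma>b(1)] c_def by simp
      ultimately show ?thesis
        by (simp only: ZN_def cis_mult distrib_left)
    qed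
    have "(\<lambda>\<omega>. cis (u * ZN N \<omega>)) \<in> borel_measurable M"
      by (simp add: cis_conv_exp)
    then show ?thesis
      unfolding eq A_def by (intro rademacher_integral X)
  qed
  have chaos: "chaos_char M X \<gamma> \<xi> u = (LINT \<omega>|M. cis (u * Z \<omega>))" for u
    by (simp add: chaos_char_def Z_def cis_conv_exp mult.assoc)
  have lim: "(\<lambda>N. A N u) \<longlonglongrightarrow> chaos_char M X \<gamma> \<xi> u" for u
    unfolding chaos A[symmetric]
  proof (rule integral_dominated_convergence[where w = "\<lambda>_. 1"])
    show "AE \<omega> in M. (\<lambda>N. cis (u * ZN N \<omega>)) \<longlonglongrightarrow> cis (u * Z \<omega>)"
      using Z_lim by eventually_elim (auto intro!: tendsto_intros simp: cis_conv_exp)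
  qed (auto simp: cis_conv_exp)
  show ?thesis
  proof (rule square_integrable_if_decay[OF m \<gamma> c _ b])
    \<comment> \<open>\<open>A N\<close> is a parameter integral of a jointly measurable function;
      its measurability in \<open>u\<close> passes to the limit.\<close>
    have "A N \<in> borel_measurable borel" for N
      unfolding A[abs_def, symmetric]
      by (intro borel_measurable_lebesgue_integral) (simp add: cis_conv_exp)
    then show "chaos_char M X \<gamma> \<xi> \<in> borel_measurable borel"
      using lim by (rule borel_measurable_LIMSEQ_metric)
    show "(\<lambda>N. norm (ave N (\<lambda>x. wt (b u) x * cis (c * u * quad \<gamma> x)))) \<longlonglongrightarrow> norm (chaos_char M X \<gamma> \<xi> u)" for u
      using tendsto_norm[OF lim[of u]] by (simp add: A_def)
  qed
qed

section \<open>The Takagi function\<close>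

lemma infdist_Ints_le_1: "infdist x \<int> \<le> 1" for x :: real
proof -
  have "infdist x \<int> \<le> dist x (of_int \<lfloor>x\<rfloor>)"
    by (rule infdist_le) simp
  also have "\<dots> \<le> 1"
    unfolding dist_real_def by linarith
  finally show ?thesis .
qed

lemma Ints_nonempty: "(\<int> :: real set) \<noteq> {}"
  using Ints_0 by blast

lemma infdist_Ints_shift:
  fixes x k :: real
  assumes "k \<in> \<int>"
  shows "infdist (x + k) \<int> = infdist x \<int>"
proof -
  have le: "infdist (x + k) \<int> \<le> infdist x \<int>" if "k \<in> \<int>" for x k :: real
    unfolding infdist_notempty[OF Ints_nonempty, of x]
  proof (rule cINF_greatest)
    fix a :: real assume "a \<in> \<int>"
    with that have "infdist (x + k) \<int> \<le> dist (x + k) (a + k)"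
      by (intro infdist_le) auto
    then show "infdist (x + k) \<int> \<le> dist x a" by simp
  qed (rule Ints_nonempty)
  show ?thesis
    using le[OF assms, of x] le[of "- k" "x + k"] assms by simp
qed

lemma infdist_Ints_midpoint:
  fixes t :: real
  assumes "\<bar>t\<bar> \<le> 1"
  shows "infdist ((1 + t) / 2) \<int> = (1 - \<bar>t\<bar>) / 2"
proof (rule antisym)
  have "infdist ((1 + t) / 2) \<int> \<le> dist ((1 + t) / 2) 0" "infdist ((1 + t) / 2) \<int> \<le> dist ((1 + t) / 2) 1"
    by (intro infdist_le; simp)+
  with assms show "infdist ((1 + t) / 2) \<int> \<le> (1 - \<bar>t\<bar>) / 2"
    unfolding dist_real_def by argo
  show "(1 - \<bar>t\<bar>) / 2 \<le> infdist ((1 + t) / 2) \<int>"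
    unfolding infdist_notempty[OF Ints_nonempty]
  proof (rule cINF_greatest)
    fix a :: real assume "a \<in> \<int>"
    then obtain k :: int where a: "a = of_int k" by (rule Ints_cases)
    have "k \<le> 0 \<or> k \<ge> 1" by linarith
    then have "a \<le> 0 \<or> a \<ge> 1" unfolding a by linarith
    with assms show "(1 - \<bar>t\<bar>) / 2 \<le> dist ((1 + t) / 2) a"
      unfolding dist_real_def by argo
  qed (rule Ints_nonempty)
qed

section \<open>Self-similarity of the Takagi function and its values at dyadic midpoints\<close>

context
  fixes \<gamma> :: real
  assumes \<gamma>: "0 < \<gamma>" "\<gamma> < 1"
begin

lemma takagi_term_le: "norm (\<gamma> ^ n * infdist (2 ^ n * y) \<int>) \<le> \<gamma> ^ n" for y :: real
  using \<gamma> infdist_Ints_le_1[of "2 ^ n * y"] infdist_nonneg[of "2 ^ n * y" "\<int>"]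
  by (simp add: abs_mult mult_left_le)

lemma summable_takagi: "summable (\<lambda>n. \<gamma> ^ n * infdist (2 ^ n * y) \<int>)" for y :: real
  by (rule summable_comparison_test'[OF summable_geometric takagi_term_le]) (use \<gamma> in simp)

lemma takagi_rec: "takagi \<gamma> y = infdist y \<int> + \<gamma> * takagi \<gamma> (2 * y)"
proof -
  have "takagi \<gamma> y = (\<Sum>n. \<gamma> ^ Suc n * infdist (2 ^ Suc n * y) \<int>) + infdist y \<int>"
    unfolding takagi_def using suminf_split_head[OF summable_takagi, of y] by simp
  also have "(\<Sum>n. \<gamma> ^ Suc n * infdist (2 ^ Suc n * y) \<int>) = \<gamma> * takagi \<gamma> (2 * y)"
    unfolding takagi_def using suminf_mult[OF summable_takagi, of \<gamma> "2 * y"] by (simp add: mult_ac)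
  finally show ?thesis by simp
qed

lemma takagi_add_1: "takagi \<gamma> (y + 1) = takagi \<gamma> y"
  by (simp add: takagi_def distrib_left infdist_Ints_shift)

lemma takagi_0: "takagi \<gamma> 0 = 0"
  by (simp add: takagi_def)

lemma continuous_on_takagi: "continuous_on UNIV (takagi \<gamma>)"
proof -
  have "uniform_limit UNIV (\<lambda>N y. \<Sum>n<N. \<gamma> ^ n * infdist (2 ^ n * y) \<int>) (takagi \<gamma>) sequentially"
    unfolding takagi_def[abs_def]
    by (rule Weierstrass_m_test[OF takagi_term_le]) (use \<gamma> in \<open>simp add: summable_geometric\<close>)
  then show ?thesis
    by (rule uniform_limit_theorem[rotated])
      (auto intro!: always_eventually continuous_intros continuous_on_infdist)
qed

text \<open>Induction by \<open>takagi_rec\<close>. For a first digit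
  \<open>x = \<plusminus>1\<close> and \<open>d = dya xs\<close> in \<open>[-1, 1]\<close> one has
  \<open>\<bar>x + d\<bar> = 1 + x * d\<close>, so the distance term is affine in the cross term
  \<open>x * dya xs\<close> of \<open>quad\<close>; doubling the midpoint gives, modulo 1, the
  midpoint of the remaining digits.\<close>

lemma takagi_midpoints:
  "\<exists>K. \<forall>xs\<in>cube n. takagi \<gamma> ((1 + dya xs) / 2) = K - quad \<gamma> xs / (4 * \<gamma>)"
proof (induction n)
  case 0
  have "takagi \<gamma> (1 / 2) = infdist (1 / 2 :: real) \<int> + \<gamma> * takagi \<gamma> (0 + 1)"
    by (subst takagi_rec) simp
  also have "infdist (1 / 2 :: real) \<int> = 1 / 2"
    using infdist_Ints_midpoint[of 0] by simp
  finally have "takagi \<gamma> (1 / 2) = 1 / 2"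
    unfolding takagi_add_1 takagi_0 by simp
  then show ?case by (auto simp: cube_def)
next
  case (Suc n)
  then obtain K where K: "\<And>xs. xs \<in> cube n \<Longrightarrow> takagi \<gamma> ((1 + dya xs) / 2) = K - quad \<gamma> xs / (4 * \<gamma>)"
    by blast
  have "takagi \<gamma> ((1 + dya (x # xs)) / 2) = 1 / 4 + \<gamma> * K - quad \<gamma> (x # xs) / (4 * \<gamma>)"
    if x: "x \<in> {- 1, 1}" and xs: "xs \<in> cube n" for x xs
  proof -
    define d where "d = dya xs"
    have d: "\<bar>d\<bar> \<le> 1" using abs_dya_le[OF xs] by (simp add: d_def)
    have "takagi \<gamma> ((1 + (x + d) / 2) / 2) =
        infdist ((1 + (x + d) / 2) / 2) \<int> + \<gamma> * takagi \<gamma> (1 + (x + d) / 2)"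
      using takagi_rec[of "(1 + (x + d) / 2) / 2"] by (simp only: times_divide_eq_right
        nonzero_mult_div_cancel_left[OF zero_neq_numeral[symmetric]])
    also have "infdist ((1 + (x + d) / 2) / 2) \<int> = (1 - \<bar>(x + d) / 2\<bar>) / 2"
      using x d by (intro infdist_Ints_midpoint) auto
    also have "\<bar>(x + d) / 2\<bar> = (1 + x * d) / 2"
      using x d by auto
    also have "takagi \<gamma> (1 + (x + d) / 2) = takagi \<gamma> ((1 + d) / 2)"
    proof (cases "x = 1")
      case True
      then have "1 + (x + d) / 2 = (1 + d) / 2 + 1" by simp
      then show ?thesis by (simp only: takagi_add_1)
    next
      case False
      with x have "1 + (x + d) / 2 = (1 + d) / 2" by (simp add: field_simps)
      then show ?thesis by (simp only:)
    qed
    also have "takagi \<gamma> ((1 + d) / 2) = K - quad \<gamma> xs / (4 * \<gamma>)"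
      unfolding d_def by (rule K[OF xs])
    also have "(1 - (1 + x * d) / 2) / 2 + \<gamma> * (K - quad \<gamma> xs / (4 * \<gamma>)) =
        1 / 4 + \<gamma> * K - quad \<gamma> (x # xs) / (4 * \<gamma>)"
      using \<gamma> by (simp add: d_def field_simps)
    finally show ?thesis by (simp add: d_def)
  qed
  then have "\<forall>xs\<in>cube (Suc n). takagi \<gamma> ((1 + dya xs) / 2) = 1 / 4 + \<gamma> * K - quad \<gamma> xs / (4 * \<gamma>)"
    by (auto simp: cube_def length_Suc_conv)
  then show ?case ..
qed

end

section \<open>Integrals as limits of midpoint means\<close>

lemma integral_unit_split:
  fixes h :: "real \<Rightarrow> complex"
  assumes h: "continuous_on {0..1} h"
  shows "integral {0..1} h =
    (1 / 2) *\<^sub>R (integral {0..1} (\<lambda>t. h ((1 + t) / 2)) + integral {0..1} (\<lambda>t. h (t / 2)))"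
proof -
  have int: "h integrable_on {0..1 / 2}" "h integrable_on {1 / 2..1}"
    using h by (auto intro!: integrable_continuous_real intro: continuous_on_subset)
  have "((\<lambda>t. h ((1 / 2) *\<^sub>R t + 0)) has_integral (integral {0..1 / 2} h /\<^sub>R (1 / 2) ^ DIM(real)))
      (cbox ((0 - 0) /\<^sub>R (1 / 2)) ((1 / 2 - 0) /\<^sub>R (1 / 2)))"
    using int(1) by (intro has_integral_affinity') (auto simp: has_integral_integral)
  then have 1: "integral {0..1} (\<lambda>t. h (t / 2)) = 2 *\<^sub>R integral {0..1 / 2} h"
    by (simp add: integral_unique)
  have "((\<lambda>t. h ((1 / 2) *\<^sub>R t + 1 / 2)) has_integral (integral {1 / 2..1} h /\<^sub>R (1 / 2) ^ DIM(real)))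
      (cbox ((1 / 2 - 1 / 2) /\<^sub>R (1 / 2)) ((1 - 1 / 2) /\<^sub>R (1 / 2)))"
    using int(2) by (intro has_integral_affinity') (auto simp: has_integral_integral)
  then have 2: "integral {0..1} (\<lambda>t. h ((1 + t) / 2)) = 2 *\<^sub>R integral {1 / 2..1} h"
    by (simp add: integral_unique add_divide_distrib add.commute)
  have "integral {0..1 / 2} h + integral {1 / 2..1} h = integral {0..1} h"
    using h by (intro Henstock_Kurzweil_Integration.integral_combine integrable_continuous_real) auto
  then show ?thesis
    unfolding 1 2 by (simp add: algebra_simps flip: scaleR_add_right)
qed

text \<open>The first digit selects a half of the interval, and rescaling that half turns the
  oscillation of \<open>h\<close> at scale \<open>2^-(N+1)\<close> into oscillation at scale
  \<open>2^-N\<close>.\<close>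

lemma ave_midpoints_error:
  fixes h :: "real \<Rightarrow> complex"
  assumes "continuous_on {0..1} h"
    and "\<And>x y. x \<in> {0..1} \<Longrightarrow> y \<in> {0..1} \<Longrightarrow> \<bar>x - y\<bar> \<le> 1 / 2 ^ N \<Longrightarrow> norm (h x - h y) \<le> e"
  shows "norm (integral {0..1} h - ave N (\<lambda>xs. h ((1 + dya xs) / 2))) \<le> e"
  using assms
proof (induction N arbitrary: h)
  case 0
  have "norm (integral {0..1} (\<lambda>x. h x - h (1 / 2))) \<le> e * (1 - 0)"
  proof (rule integral_bound)
    show "continuous_on {0..1} (\<lambda>x. h x - h (1 / 2))"
      using "0.prems"(1) by (intro continuous_intros)
    show "norm (h t - h (1 / 2)) \<le> e" if "t \<in> {0..1}" for t
      using that by (intro "0.prems"(2)) auto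
  qed simp
  moreover have "integral {0..1} (\<lambda>x. h x - h (1 / 2)) = integral {0..1} h - h (1 / 2)"
    using "0.prems"(1) by (subst Henstock_Kurzweil_Integration.integral_diff)
      (auto intro!: integrable_continuous_real)
  ultimately show ?case by simp
next
  case (Suc N)
  define h0 h1 where "h0 t = h (t / 2)" and "h1 t = h ((1 + t) / 2)" for t
  have "norm (integral {0..1} h0 - ave N (\<lambda>xs. h0 ((1 + dya xs) / 2))) \<le> e"
    unfolding h0_def
  proof (rule Suc.IH)
    show "continuous_on {0..1} (\<lambda>t. h (t / 2))"
      by (rule continuous_on_compose2[OF Suc.prems(1)]) (auto intro!: continuous_intros)
    show "norm (h (x / 2) - h (y / 2)) \<le> e"
      if "x \<in> {0..1}" "y \<in> {0..1}" "\<bar>x - y\<bar> \<le> 1 / 2 ^ N" for x y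
      using that diff_divide_distrib[of x y 2, symmetric]
      by (intro Suc.prems(2)) (auto simp: field_simps)
  qed
  moreover have "norm (integral {0..1} h1 - ave N (\<lambda>xs. h1 ((1 + dya xs) / 2))) \<le> e"
    unfolding h1_def
  proof (rule Suc.IH)
    show "continuous_on {0..1} (\<lambda>t. h ((1 + t) / 2))"
      by (rule continuous_on_compose2[OF Suc.prems(1)]) (auto intro!: continuous_intros)
    show "norm (h ((1 + x) / 2) - h ((1 + y) / 2)) \<le> e"
      if "x \<in> {0..1}" "y \<in> {0..1}" "\<bar>x - y\<bar> \<le> 1 / 2 ^ N" for x y
    proof (rule Suc.prems(2))
      have "(1 + x) / 2 - (1 + y) / 2 = (x - y) / 2" by (simp add: field_simps)
      with that(3) show "\<bar>(1 + x) / 2 - (1 + y) / 2\<bar> \<le> 1 / 2 ^ Suc N"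
        by (simp only: abs_divide) (simp add: field_simps)
    qed (use that in auto)
  qed
  ultimately have "norm ((integral {0..1} h1 - ave N (\<lambda>xs. h1 ((1 + dya xs) / 2)))
      + (integral {0..1} h0 - ave N (\<lambda>xs. h0 ((1 + dya xs) / 2)))) \<le> e + e"
    by (intro order_trans[OF norm_triangle_ineq] add_mono)
  moreover have "integral {0..1} h - ave (Suc N) (\<lambda>xs. h ((1 + dya xs) / 2)) =
      (1 / 2) *\<^sub>R ((integral {0..1} h1 - ave N (\<lambda>xs. h1 ((1 + dya xs) / 2)))
      + (integral {0..1} h0 - ave N (\<lambda>xs. h0 ((1 + dya xs) / 2))))"
  proof -
    have eq: "(1 + (- 1 + d) / 2) / 2 = (1 + d) / 2 / 2" for d :: real
      by (simp add: field_simps)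
    show ?thesis
      unfolding integral_unit_split[OF Suc.prems(1)] h0_def h1_def ave.simps dya.simps eq
      by (simp add: algebra_simps)
  qed
  ultimately show ?case by simp
qed

lemma ave_midpoints_tendsto:
  fixes h :: "real \<Rightarrow> complex"
  assumes h: "continuous_on {0..1} h"
  shows "(\<lambda>N. ave N (\<lambda>xs. h ((1 + dya xs) / 2))) \<longlonglongrightarrow> integral {0..1} h"
proof (rule LIMSEQ_I)
  fix e :: real assume "e > 0"
  then obtain d where d: "d > 0"
    "\<And>x y. x \<in> {0..1} \<Longrightarrow> y \<in> {0..1} \<Longrightarrow> dist y x < d \<Longrightarrow> dist (h y) (h x) < e / 2"
    using compact_uniformly_continuous[OF h] unfolding uniformly_continuous_on_def
    by (meson compact_Icc half_gt_zero)
  have "(\<lambda>N. (1 / 2) ^ N) \<longlonglongrightarrow> (0 :: real)"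
    by (rule LIMSEQ_power_zero) simp
  then have "\<forall>\<^sub>F N in sequentially. (1 / 2) ^ N < d"
    using d(1) by (rule order_tendstoD)
  then obtain N0 where N0: "\<And>N. N \<ge> N0 \<Longrightarrow> (1 / 2) ^ N < d"
    by (auto simp: eventually_sequentially)
  have "norm (ave N (\<lambda>xs. h ((1 + dya xs) / 2)) - integral {0..1} h) < e" if "N \<ge> N0" for N
  proof -
    have "norm (integral {0..1} h - ave N (\<lambda>xs. h ((1 + dya xs) / 2))) \<le> e / 2"
    proof (rule ave_midpoints_error[OF h])
      fix x y :: real assume "x \<in> {0..1}" "y \<in> {0..1}" "\<bar>x - y\<bar> \<le> 1 / 2 ^ N"
      then show "norm (h x - h y) \<le> e / 2"
        using d(2)[of y x] N0[OF that] by (simp add: dist_norm power_one_over)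
    qed
    then show ?thesis using \<open>e > 0\<close> by (simp add: norm_minus_commute)
  qed
  then show "\<exists>N0. \<forall>N\<ge>N0. norm (ave N (\<lambda>xs. h ((1 + dya xs) / 2)) - integral {0..1} h) < e"
    by blast
qed

section \<open>The occupation law of the Takagi function and its characteristic function\<close>

lemma takagi_occupation_distribution:
  assumes \<gamma>: "0 < \<gamma>" "\<gamma> < 1"
  shows "takagi \<gamma> \<in> borel_measurable (lebesgue_on {0..1})"
    and "real_distribution (occupation_measure (takagi \<gamma>))"
proof -
  show meas: "takagi \<gamma> \<in> borel_measurable (lebesgue_on {0..1})"
    by (intro continuous_imp_measurable_on_sets_lebesgue
        continuous_on_subset[OF continuous_on_takagi[OF \<gamma>]]) auto
  have "prob_space (lebesgue_on {0..1::real})"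
    by (rule prob_spaceI) (simp add: emeasure_restrict_space)
  then interpret prob_space "lebesgue_on {0..1::real}" .
  show "real_distribution (occupation_measure (takagi \<gamma>))"
    unfolding occupation_measure_def
    by (rule real_distribution_distr) (rule meas)
qed

lemma char_takagi_square_integrable:
  assumes m: "m \<ge> 7" and \<gamma>: "\<gamma> = 2 powr (- 1 / real m)"
  shows "square_integrable (char (occupation_measure (takagi \<gamma>)))"
proof -
  note \<gamma>b = gamma_bounds[OF m \<gamma>]
  note meas = takagi_occupation_distribution(1)[OF \<gamma>b(1,2)]
  interpret real_distribution "occupation_measure (takagi \<gamma>)"
    by (rule takagi_occupation_distribution[OF \<gamma>b(1,2)])
  define c where "c = - (1 / (4 * \<gamma>))"
  have c: "c \<noteq> 0" using \<gamma>b by (simp add: c_def)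
  have cont: "continuous_on {0..1} (\<lambda>y. cis (u * takagi \<gamma> y))" for u
    unfolding cis_conv_exp
    by (intro continuous_intros continuous_on_subset[OF continuous_on_takagi[OF \<gamma>b(1,2)]]) auto
  have char: "char (occupation_measure (takagi \<gamma>)) u = integral {0..1} (\<lambda>y. cis (u * takagi \<gamma> y))" for u
  proof -
    have "char (occupation_measure (takagi \<gamma>)) u = (LINT y|lebesgue_on {0..1}. cis (u * takagi \<gamma> y))"
      unfolding char_def occupation_measure_def
      by (subst integral_distr) (use meas in \<open>auto simp: cis_conv_exp\<close>)
    also have "\<dots> = integral {0..1} (\<lambda>y. cis (u * takagi \<gamma> y))"
    proof (rule lebesgue_integral_eq_integral)
      interpret finite_measure "lebesgue_on {0..1::real}"
        by (rule finite_measure_lebesgue_on) simp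
      show "integrable (lebesgue_on {0..1}) (\<lambda>y. cis (u * takagi \<gamma> y))"
        by (rule integrable_const_bound[of _ 1])
          (auto intro!: continuous_imp_measurable_on_sets_lebesgue cont)
    qed simp
    finally show ?thesis .
  qed
  have lim: "(\<lambda>N. ave N (\<lambda>xs. cis (u * takagi \<gamma> ((1 + dya xs) / 2))))
      \<longlonglongrightarrow> char (occupation_measure (takagi \<gamma>)) u" for u
    unfolding char by (rule ave_midpoints_tendsto[OF cont])
  \<comment> \<open>The constant \<open>K\<close> of \<open>takagi_midpoints\<close> may depend on
    \<open>N\<close>, but it enters only as a phase and disappears in the norm.\<close>
  have eq: "norm (ave N (\<lambda>xs. cis (u * takagi \<gamma> ((1 + dya xs) / 2)))) =
      norm (ave N (\<lambda>x. wt (\<lambda>_ _. 1) x * cis (c * u * quad \<gamma> x)))" for N u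
  proof -
    obtain K where K: "\<And>xs. xs \<in> cube N \<Longrightarrow> takagi \<gamma> ((1 + dya xs) / 2) = K - quad \<gamma> xs / (4 * \<gamma>)"
      using takagi_midpoints[OF \<gamma>b(1,2), of N] by blast
    have "ave N (\<lambda>xs. cis (u * takagi \<gamma> ((1 + dya xs) / 2))) =
        ave N (\<lambda>x. cis (u * K) * (wt (\<lambda>_ _. 1) x * cis (c * u * quad \<gamma> x)))"
    proof (rule ave_cong)
      fix xs assume "xs \<in> cube N"
      moreover have "u * (K - quad \<gamma> xs / (4 * \<gamma>)) = u * K + c * u * quad \<gamma> xs"
        by (simp add: c_def algebra_simps)
      moreover have "wt (\<lambda>_ _. 1) xs = 1"
        by (simp add: wt_eq_prod)
      ultimately show "cis (u * takagi \<gamma> ((1 + dya xs) / 2)) =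
          cis (u * K) * (wt (\<lambda>_ _. 1) xs * cis (c * u * quad \<gamma> xs))"
        by (simp add: K cis_mult)
    qed
    then show ?thesis by (simp add: ave_mult_left norm_mult)
  qed
  show ?thesis
  proof (rule square_integrable_if_decay[OF m \<gamma> c])
    show "char (occupation_measure (takagi \<gamma>)) \<in> borel_measurable borel"
      by (rule char_measurable)
    show "bounded_weight (\<lambda>_ _. 1)" for u :: real
      by (simp add: bounded_weight_def)
    show "(\<lambda>N. norm (ave N (\<lambda>x. wt (\<lambda>_ _. 1) x * cis (c * u * quad \<gamma> x))))
        \<longlonglongrightarrow> norm (char (occupation_measure (takagi \<gamma>)) u)" for u
      using tendsto_norm[OF lim[of u]] unfolding eq .
  qed
qed

section \<open>Square integrable characteristic functions\<close>

context real_distribution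
begin

lemma char_uminus: "char M (- t) = cnj (char M t)"
proof -
  have "cnj (char M t) = (CLINT x|M. cnj (iexp (t * x)))"
    unfolding char_def by (rule Bochner_Integration.integral_cnj[symmetric])
  also have "\<dots> = char M (- t)"
    unfolding char_def by (intro Bochner_Integration.integral_cong) (auto simp: exp_cnj)
  finally show ?thesis by simp
qed

text \<open>The Gaussian of \<open>(x - y) / r\<close> is the characteristic function of the
  standard normal law at that point; exchanging integrals separates \<open>x\<close> from
  \<open>y\<close> and leaves \<open>char M (g / r)\<close> times its conjugate.\<close>

lemma gaussian_energy:
  assumes "r > 0"
  shows "(LINT x|M. LINT y|M. exp (- (((x - y) / r)\<^sup>2) / 2)) =
    (LINT g|std_normal_distribution. (cmod (char M (g / r)))\<^sup>2)"
proof -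
  interpret N: real_distribution std_normal_distribution
    by (rule real_dist_normal_dist)
  interpret P: pair_prob_space M std_normal_distribution ..
  have inner: "complex_of_real (LINT y|M. exp (- (((x - y) / r)\<^sup>2) / 2)) =
      (CLINT g|std_normal_distribution. iexp ((g / r) * x) * char M (- (g / r)))" for x
  proof -
    have "complex_of_real (LINT y|M. exp (- (((x - y) / r)\<^sup>2) / 2)) =
        (CLINT y|M. complex_of_real (exp (- (((x - y) / r)\<^sup>2) / 2)))"
      by (rule integral_complex_of_real[symmetric])
    also have "\<dots> = (CLINT y|M. char std_normal_distribution ((x - y) / r))"
      by (simp add: char_std_normal_distribution)
    also have "\<dots> = (CLINT y|M. CLINT g|std_normal_distribution. iexp ((x - y) / r * g))"
      unfolding char_def ..
    also have "\<dots> = (CLINT g|std_normal_distribution. CLINT y|M. iexp ((x - y) / r * g))"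
      by (intro P.Fubini_integral[symmetric] P.P.integrable_const_bound[of _ 1]) (auto simp: split_beta)
    also have "\<dots> = (CLINT g|std_normal_distribution. iexp ((g / r) * x) * char M (- (g / r)))"
    proof (intro Bochner_Integration.integral_cong refl)
      fix g
      have "iexp ((x - y) / r * g) = iexp ((g / r) * x) * iexp (- (g / r) * y)" for y
        by (simp add: diff_divide_distrib algebra_simps flip: exp_add)
      then show "(CLINT y|M. iexp ((x - y) / r * g)) = iexp ((g / r) * x) * char M (- (g / r))"
        unfolding char_def by simp
    qed
    finally show ?thesis .
  qed
  have "complex_of_real (LINT x|M. LINT y|M. exp (- (((x - y) / r)\<^sup>2) / 2)) =
      (CLINT x|M. complex_of_real (LINT y|M. exp (- (((x - y) / r)\<^sup>2) / 2)))"
    by (rule integral_complex_of_real[symmetric])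
  also have "\<dots> = (CLINT x|M. CLINT g|std_normal_distribution. iexp ((g / r) * x) * char M (- (g / r)))"
    unfolding inner ..
  also have "\<dots> = (CLINT g|std_normal_distribution. CLINT x|M. iexp ((g / r) * x) * char M (- (g / r)))"
    by (intro P.Fubini_integral[symmetric] P.P.integrable_const_bound[of _ 1])
      (auto simp: split_beta norm_mult cmod_char_le_1)
  also have "\<dots> = (CLINT g|std_normal_distribution. complex_of_real ((cmod (char M (g / r)))\<^sup>2))"
  proof (intro Bochner_Integration.integral_cong refl)
    fix g
    have "(CLINT x|M. iexp ((g / r) * x) * char M (- (g / r))) = char M (g / r) * char M (- (g / r))"
      unfolding char_def by simp
    then show "(CLINT x|M. iexp ((g / r) * x) * char M (- (g / r))) = complex_of_real ((cmod (char M (g / r)))\<^sup>2)"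
      by (simp only: char_uminus complex_norm_square)
  qed
  also have "\<dots> = complex_of_real (LINT g|std_normal_distribution. (cmod (char M (g / r)))\<^sup>2)"
    by (rule integral_complex_of_real)
  finally show ?thesis by (simp only: of_real_eq_iff)
qed

text \<open>The indicator is at most twice the Gaussian, as \<open>exp (-1/2) \<ge> 1/2\<close>. In
  the energy identity the normal density is at most 1, and the substitution \<open>g = r * u\<close>
  produces the factor \<open>r\<close>.\<close>

lemma pair_correlation_le:
  assumes char: "square_integrable (char M)" and r: "r > 0"
  shows "(\<integral>\<^sup>+x. \<integral>\<^sup>+y. (if \<bar>x - y\<bar> < r then 1 else 0) \<partial>M \<partial>M)
    \<le> ennreal (2 * (LINT u|lborel. (cmod (char M u))\<^sup>2) * r)"
proof -
  interpret P: pair_prob_space M M ..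
  define I where "I = (LINT u|lborel. (cmod (char M u))\<^sup>2)"
  have int: "integrable lborel (\<lambda>u. (cmod (char M u))\<^sup>2)"
    using char by (simp add: square_integrable_def)
  define f where "f x y = exp (- (((x - y) / r)\<^sup>2) / 2)" for x y
  have f_le: "f x y \<le> 1" for x y by (simp add: f_def)
  have f_int: "integrable M (f x)" for x
    unfolding f_def by (intro integrable_const_bound[of _ 1]) auto
  have "(LINT g|std_normal_distribution. (cmod (char M (g / r)))\<^sup>2) =
      (LINT g|lborel. std_normal_density g *\<^sub>R (cmod (char M (g / r)))\<^sup>2)"
    by (subst integral_density) auto
  also have "\<dots> \<le> (LINT g|lborel. (cmod (char M (g / r)))\<^sup>2)"
  proof (rule integral_mono)
    have scaled: "integrable lborel (\<lambda>g. (cmod (char M (g / r)))\<^sup>2)"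
      using lborel_integrable_real_affine[OF int, of "1 / r" 0] r by simp
    then show "integrable lborel (\<lambda>g. (cmod (char M (g / r)))\<^sup>2)" .
    have le: "std_normal_density g \<le> 1" for g
    proof -
      have "1 \<le> sqrt (2 * pi)" using pi_gt3 by simp
      then have "1 / sqrt (2 * pi) \<le> 1" by (simp add: divide_le_eq_1)
      moreover have "exp (- g\<^sup>2 / 2) \<le> 1" by simp
      ultimately show ?thesis
        unfolding normal_density_def using mult_le_one[of "1 / sqrt (2 * pi)" "exp (- g\<^sup>2 / 2)"]
        by simp
    qed
    then show "std_normal_density g *\<^sub>R (cmod (char M (g / r)))\<^sup>2 \<le> (cmod (char M (g / r)))\<^sup>2" for g
      by (simp add: mult_left_le_one_le)
    show "integrable lborel (\<lambda>g. std_normal_density g *\<^sub>R (cmod (char M (g / r)))\<^sup>2)"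
      by (rule Bochner_Integration.integrable_bound[OF scaled])
        (use le in \<open>auto intro!: AE_I2 simp: abs_mult mult_left_le_one_le\<close>)
  qed
  also have "\<dots> = r * I"
    using lborel_integral_real_affine[of r "\<lambda>g. (cmod (char M (g / r)))\<^sup>2" 0] r
    by (simp add: I_def)
  finally have E: "(LINT x|M. LINT y|M. f x y) \<le> r * I"
    unfolding f_def gaussian_energy[OF r] .
  have "(\<integral>\<^sup>+x. \<integral>\<^sup>+y. (if \<bar>x - y\<bar> < r then 1 else 0) \<partial>M \<partial>M) \<le>
      (\<integral>\<^sup>+x. \<integral>\<^sup>+y. ennreal 2 * ennreal (f x y) \<partial>M \<partial>M)"
  proof (intro nn_integral_mono)
    fix x y
    have "1 / 2 \<le> f x y" if "\<bar>x - y\<bar> < r"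
    proof -
      have "((x - y) / r)\<^sup>2 \<le> 1"
        using that r by (simp add: abs_square_le_1)
      then have "1 + (- (1 / 2)) \<le> f x y"
        unfolding f_def by (intro order_trans[OF exp_ge_add_one_self] iffD2[OF exp_le_cancel_iff]) simp
      then show ?thesis by simp
    qed
    then have "ennreal 1 \<le> ennreal (2 * f x y)" if "\<bar>x - y\<bar> < r"
      using that by (intro ennreal_leI) force
    moreover have "ennreal (2 * f x y) = ennreal 2 * ennreal (f x y)"
      by (rule ennreal_mult) (simp_all add: f_def)
    ultimately show "(if \<bar>x - y\<bar> < r then 1 else 0) \<le> ennreal 2 * ennreal (f x y)"
      by simp
  qed
  also have "\<dots> = ennreal 2 * (\<integral>\<^sup>+x. \<integral>\<^sup>+y. ennreal (f x y) \<partial>M \<partial>M)"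
    unfolding f_def by (simp add: nn_integral_cmult)
  also have "(\<integral>\<^sup>+x. \<integral>\<^sup>+y. ennreal (f x y) \<partial>M \<partial>M) = (\<integral>\<^sup>+x. ennreal (LINT y|M. f x y) \<partial>M)"
    by (intro nn_integral_cong nn_integral_eq_integral f_int AE_I2) (simp add: f_def)
  also have "\<dots> = ennreal (LINT x|M. LINT y|M. f x y)"
  proof (rule nn_integral_eq_integral)
    have "norm (LINT y|M. f x y) \<le> 1" for x
    proof -
      have "(LINT y|M. f x y) \<le> (LINT y|M. 1)"
        using f_int f_le by (intro integral_mono) auto
      moreover have "0 \<le> (LINT y|M. f x y)"
        by (intro integral_nonneg_AE AE_I2) (simp add: f_def)
      moreover have "(LINT y|M. 1) = (1 :: real)"
        using prob_space by simp
      ultimately show ?thesis by simp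
    qed
    then show "integrable M (\<lambda>x. LINT y|M. f x y)"
      by (intro integrable_const_bound[of _ 1]) (auto simp: f_def)
    show "AE x in M. 0 \<le> (LINT y|M. f x y)"
      by (intro AE_I2 integral_nonneg_AE) (simp add: f_def)
  qed
  also have "ennreal 2 * ennreal (LINT x|M. LINT y|M. f x y) \<le> ennreal 2 * ennreal (r * I)"
    by (intro mult_left_mono ennreal_leI E) auto
  also have "\<dots> = ennreal (2 * I * r)"
    using r by (subst ennreal_mult[symmetric]) (auto simp: I_def mult_ac)
  finally show ?thesis by (simp add: I_def)
qed

section \<open>Duality with square integrable test functions\<close>

text \<open>The inner integral is the density of the law smoothed by a window of length
  \<open>r\<close>. Its square expands over pairs \<open>x\<close>, \<open>y\<close>, whose windows
  overlap only for \<open>\<bar>x - y\<bar> < r\<close>, with overlap integral at most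
  \<open>1 / r\<close>; this cancels the \<open>r\<close> in the correlation bound.\<close>

lemma window_energy_le:
  assumes r: "r > 0" and C: "C \<ge> 0"
    and corr: "(\<integral>\<^sup>+x. \<integral>\<^sup>+y. (if \<bar>x - y\<bar> < r then 1 else 0) \<partial>M \<partial>M) \<le> ennreal (C * r)"
  shows "(\<integral>\<^sup>+t. (\<integral>\<^sup>+x. (if x \<le> t \<and> t < x + r then ennreal (1 / r) else 0) \<partial>M)\<^sup>2 \<partial>lborel) \<le> ennreal C"
proof -
  interpret L: pair_sigma_finite lborel M ..
  define k where "k x t = (if x \<le> t \<and> t < x + r then ennreal (1 / r) else 0)" for x t
  have k_meas [measurable]: "(\<lambda>p. k (fst p) (snd p)) \<in> borel_measurable (borel \<Otimes>\<^sub>M borel)"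
    unfolding k_def by measurable
  have k_meas2 [measurable]: "(\<lambda>x. k (f x) (h x)) \<in> borel_measurable N"
    if "f \<in> borel_measurable N" "h \<in> borel_measurable N" for f h and N :: "'b measure"
    using that unfolding k_def by measurable
  have "(\<integral>\<^sup>+t. (\<integral>\<^sup>+x. k x t \<partial>M)\<^sup>2 \<partial>lborel) =
      (\<integral>\<^sup>+t. (\<integral>\<^sup>+x. (\<integral>\<^sup>+y. k x t * k y t \<partial>M) \<partial>M) \<partial>lborel)"
    by (intro nn_integral_cong) (simp add: power2_eq_square nn_integral_cmult nn_integral_multc)
  also have "\<dots> = (\<integral>\<^sup>+x. (\<integral>\<^sup>+t. (\<integral>\<^sup>+y. k x t * k y t \<partial>M) \<partial>lborel) \<partial>M)"
    by (rule L.Fubini'[symmetric]) measurable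
  also have "\<dots> = (\<integral>\<^sup>+x. (\<integral>\<^sup>+y. (\<integral>\<^sup>+t. k x t * k y t \<partial>lborel) \<partial>M) \<partial>M)"
    by (intro nn_integral_cong L.Fubini'[symmetric]) measurable
  also have "\<dots> \<le> (\<integral>\<^sup>+x. (\<integral>\<^sup>+y. ennreal (1 / r) * (if \<bar>x - y\<bar> < r then 1 else 0) \<partial>M) \<partial>M)"
  proof (intro nn_integral_mono)
    fix x y
    have "(\<integral>\<^sup>+t. k x t * k y t \<partial>lborel) \<le>
        (\<integral>\<^sup>+t. (ennreal (1 / r) * ennreal (1 / r) * (if \<bar>x - y\<bar> < r then 1 else 0)) * indicator {x..<x + r} t \<partial>lborel)"
      by (intro nn_integral_mono) (auto simp: k_def indicator_def)
    also have "\<dots> = ennreal (1 / r) * ennreal (1 / r) * (if \<bar>x - y\<bar> < r then 1 else 0) * ennreal r"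
      using r by (subst nn_integral_cmult_indicator) auto
    also have "\<dots> = ennreal (1 / r) * (if \<bar>x - y\<bar> < r then 1 else 0)"
      using r by (auto simp: ennreal_mult[symmetric] mult.assoc)
    finally show "(\<integral>\<^sup>+t. k x t * k y t \<partial>lborel) \<le> ennreal (1 / r) * (if \<bar>x - y\<bar> < r then 1 else 0)" .
  qed
  also have "\<dots> = ennreal (1 / r) * (\<integral>\<^sup>+x. \<integral>\<^sup>+y. (if \<bar>x - y\<bar> < r then 1 else 0) \<partial>M \<partial>M)"
    by (simp add: nn_integral_cmult)
  also have "\<dots> \<le> ennreal (1 / r) * ennreal (C * r)"
    by (intro mult_left_mono corr) simp
  also have "\<dots> = ennreal C"
    using r C by (simp add: ennreal_mult[symmetric])
  finally show ?thesis by (simp add: k_def)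
qed

text \<open>Averages of \<open>g\<close> over \<open>[x, x + r)\<close> have lower limit at least
  \<open>g x\<close>, by lower semicontinuity from the right. Fatou and Fubini move the averaging
  onto the law, and Cauchy-Schwarz with \<open>window_energy_le\<close> bounds the result. The
  condition \<open>lsc\<close> admits both continuous functions and indicators of open sets.\<close>

lemma nn_integral_le_L2:
  assumes C: "C \<ge> 0"
    and corr: "\<And>r. r > 0 \<Longrightarrow> (\<integral>\<^sup>+x. \<integral>\<^sup>+y. (if \<bar>x - y\<bar> < r then 1 else 0) \<partial>M \<partial>M) \<le> ennreal (C * r)"
    and g [measurable]: "g \<in> borel_measurable borel" and nonneg: "\<And>x. 0 \<le> g x"
    and lsc: "\<And>x a. a < g x \<Longrightarrow> \<exists>\<delta>>0. \<forall>t. x \<le> t \<and> t < x + \<delta> \<longrightarrow> a \<le> g t"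
    and K: "K \<ge> 0" "(\<integral>\<^sup>+t. ennreal ((g t)\<^sup>2) \<partial>lborel) \<le> ennreal (K\<^sup>2)"
  shows "(\<integral>\<^sup>+x. ennreal (g x) \<partial>M) \<le> ennreal (sqrt C * K)"
proof -
  interpret L: pair_sigma_finite lborel M ..
  define r where "r n = 1 / real (Suc n)" for n
  have r: "r n > 0" for n by (simp add: r_def)
  define k where "k n x t = (if x \<le> t \<and> t < x + r n then ennreal (1 / r n) else 0)" for n x t
  have k_meas [measurable]: "(\<lambda>x. k n (f x) (h x)) \<in> borel_measurable N"
    if "f \<in> borel_measurable N" "h \<in> borel_measurable N" for f h n and N :: "'b measure"
    using that unfolding k_def by measurable
  define A where "A n x = (\<integral>\<^sup>+t. ennreal (g t) * k n x t \<partial>lborel)" for n x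
  have A_meas [measurable]: "A n \<in> borel_measurable M" for n
    unfolding A_def by measurable
  have lower: "ennreal (g x) \<le> liminf (\<lambda>n. A n x)" for x
    unfolding le_Liminf_iff
  proof (intro allI impI)
    fix y assume y: "y < ennreal (g x)"
    then obtain a' where a': "y = ennreal a'" "0 \<le> a'"
      by (cases y) auto
    with y have "a' < g x" by (simp add: ennreal_less_iff)
    then obtain a where a: "a' < a" "a < g x" using dense by blast
    obtain \<delta> where \<delta>: "\<delta> > 0" "\<And>t. x \<le> t \<Longrightarrow> t < x + \<delta> \<Longrightarrow> a \<le> g t"
      using lsc[OF a(2)] by blast
    have "r \<longlonglongrightarrow> 0"
      unfolding r_def by (rule LIMSEQ_Suc[OF lim_1_over_n])
    then have "\<forall>\<^sub>F n in sequentially. r n < \<delta>"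
      using \<delta>(1) by (rule order_tendstoD)
    then show "\<forall>\<^sub>F n in sequentially. y < A n x"
    proof eventually_elim
      case (elim n)
      have "ennreal a = ennreal a * ennreal (1 / r n) * ennreal (r n)"
        using r[of n] a a' by (simp add: ennreal_mult[symmetric] mult.assoc)
      also have "\<dots> = (\<integral>\<^sup>+t. (ennreal a * ennreal (1 / r n)) * indicator {x..<x + r n} t \<partial>lborel)"
        using r[of n] by (subst nn_integral_cmult_indicator) auto
      also have "\<dots> \<le> A n x"
        unfolding A_def using elim \<delta>(2)
        by (intro nn_integral_mono) (auto simp: k_def indicator_def intro!: mult_right_mono ennreal_leI)
      finally show ?case
        using a a' by (auto simp: ennreal_less_iff intro: less_le_trans[rotated])
    qed
  qed
  have upper: "(\<integral>\<^sup>+x. A n x \<partial>M) \<le> ennreal (sqrt C * K)" for n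
  proof -
    define p where "p t = (\<integral>\<^sup>+x. k n x t \<partial>M)" for t
    have [measurable]: "p \<in> borel_measurable lborel"
      unfolding p_def by measurable
    have "(\<integral>\<^sup>+x. A n x \<partial>M) = (\<integral>\<^sup>+t. (\<integral>\<^sup>+x. ennreal (g t) * k n x t \<partial>M) \<partial>lborel)"
      unfolding A_def by (rule L.Fubini') measurable
    also have "\<dots> = (\<integral>\<^sup>+t. ennreal (g t) * p t \<partial>lborel)"
      by (simp add: p_def nn_integral_cmult)
    finally have "(\<integral>\<^sup>+x. A n x \<partial>M)\<^sup>2 = (\<integral>\<^sup>+t. ennreal (g t) * p t \<partial>lborel)\<^sup>2"
      by simp
    also have "\<dots> \<le> (\<integral>\<^sup>+t. (ennreal (g t))\<^sup>2 \<partial>lborel) * (\<integral>\<^sup>+t. (p t)\<^sup>2 \<partial>lborel)"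
      by (rule Cauchy_Schwarz_nn_integral) measurable
    also have "\<dots> \<le> ennreal (K\<^sup>2) * ennreal C"
    proof (rule mult_mono)
      show "(\<integral>\<^sup>+t. (ennreal (g t))\<^sup>2 \<partial>lborel) \<le> ennreal (K\<^sup>2)"
        using K(2) nonneg by (simp add: ennreal_power)
      show "(\<integral>\<^sup>+t. (p t)\<^sup>2 \<partial>lborel) \<le> ennreal C"
        unfolding p_def k_def by (rule window_energy_le[OF r C corr[OF r]])
    qed auto
    also have "\<dots> = ennreal ((sqrt C * K)\<^sup>2)"
      using C by (simp add: ennreal_mult[symmetric] power_mult_distrib mult.commute)
    finally have sq: "(\<integral>\<^sup>+x. A n x \<partial>M)\<^sup>2 \<le> ennreal ((sqrt C * K)\<^sup>2)" .
    show ?thesis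
    proof (cases "\<integral>\<^sup>+x. A n x \<partial>M")
      case (real s)
      have "ennreal (s\<^sup>2) \<le> ennreal ((sqrt C * K)\<^sup>2)"
        using sq unfolding real(2) ennreal_power[OF real(1)] .
      then have "s\<^sup>2 \<le> (sqrt C * K)\<^sup>2" by (simp only: ennreal_le_iff zero_le_power2)
      then have "s \<le> sqrt C * K" by (rule power2_le_imp_le) (use C K(1) in simp)
      then show ?thesis using real by (simp add: ennreal_leI)
    next
      case top
      with sq show ?thesis by (simp add: power2_eq_square ennreal_top_mult top_unique)
    qed
  qed
  have "(\<integral>\<^sup>+x. ennreal (g x) \<partial>M) \<le> (\<integral>\<^sup>+x. liminf (\<lambda>n. A n x) \<partial>M)"
    by (intro nn_integral_mono lower)
  also have "\<dots> \<le> liminf (\<lambda>n. \<integral>\<^sup>+x. A n x \<partial>M)"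
    by (rule nn_integral_liminf) measurable
  also have "\<dots> \<le> limsup (\<lambda>n. \<integral>\<^sup>+x. A n x \<partial>M)"
    by (rule Liminf_le_Limsup) simp
  also have "\<dots> \<le> ennreal (sqrt C * K)"
    by (rule Limsup_bounded) (simp add: upper)
  finally show ?thesis .
qed

section \<open>From pair correlations to a square integrable density\<close>

text \<open>By outer regularity a null set lies in an open set of measure at most
  \<open>d^2\<close>, whose indicator is an admissible test function of norm at most
  \<open>d\<close> in \<open>nn_integral_le_L2\<close>.\<close>

lemma absolutely_continuous_if_correlation:
  assumes C: "C \<ge> 0"
    and corr: "\<And>r. r > 0 \<Longrightarrow> (\<integral>\<^sup>+x. \<integral>\<^sup>+y. (if \<bar>x - y\<bar> < r then 1 else 0) \<partial>M \<partial>M) \<le> ennreal (C * r)"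
  shows "absolutely_continuous lborel M"
  unfolding absolutely_continuous_def
proof
  fix N :: "real set" assume N: "N \<in> null_sets lborel"
  have le: "measure M N \<le> sqrt C * d" if d: "d > 0" for d
  proof -
    have "N \<in> sets borel" using N by (auto simp: null_sets_def)
    then obtain U where U: "open U" "N \<subseteq> U" "emeasure lborel (U - N) < ennreal (d\<^sup>2)"
      using outer_regular_lborel[of N "d\<^sup>2"] d by (metis zero_less_power)
    have "emeasure lborel U = emeasure lborel (U - N)"
      using N U by (intro emeasure_Diff_null_set[symmetric]) auto
    then have dU: "emeasure lborel U \<le> ennreal (d\<^sup>2)" using U by simp
    have "emeasure M N \<le> emeasure M U"
      using U by (intro emeasure_mono) auto
    also have "\<dots> = (\<integral>\<^sup>+x. ennreal (indicator U x) \<partial>M)"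
      unfolding ennreal_indicator using U(1) by (intro nn_integral_indicator[symmetric]) auto
    also have "\<dots> \<le> ennreal (sqrt C * d)"
    proof (rule nn_integral_le_L2[OF C corr])
      show "indicat_real U \<in> borel_measurable borel"
        using U by simp
      show "\<exists>\<delta>>0. \<forall>t. x \<le> t \<and> t < x + \<delta> \<longrightarrow> a \<le> indicat_real U t" if "a < indicat_real U x" for x a
      proof (cases "x \<in> U")
        case True
        then obtain \<delta> where "\<delta> > 0" "ball x \<delta> \<subseteq> U"
          using U(1) by (meson openE)
        then have "\<forall>t. x \<le> t \<and> t < x + \<delta> \<longrightarrow> t \<in> U"
          by (auto simp: ball_eq_greaterThanLessThan subset_eq)
        with \<open>\<delta> > 0\<close> that True show ?thesis by (intro exI[of _ \<delta>]) auto
      next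
        case False
        with that show ?thesis by (intro exI[of _ 1]) (auto simp: indicator_def)
      qed
      have "(\<integral>\<^sup>+t. ennreal ((indicat_real U t)\<^sup>2) \<partial>lborel) = (\<integral>\<^sup>+t. indicator U t \<partial>lborel)"
        by (intro nn_integral_cong) (auto simp: indicator_def)
      also have "\<dots> = emeasure lborel U"
        using U by simp
      finally show "(\<integral>\<^sup>+t. ennreal ((indicat_real U t)\<^sup>2) \<partial>lborel) \<le> ennreal (d\<^sup>2)"
        using dU by simp
    qed (use d in auto)
    finally show ?thesis
      using C d by (simp add: emeasure_eq_measure)
  qed
  have "measure M N \<le> 0"
  proof (rule field_le_epsilon)
    fix e :: real assume e: "e > 0"
    \<comment> \<open>The summand 1 keeps the denominator positive when
      \<open>C = 0\<close>.\<close>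
    have "measure M N \<le> sqrt C * (e / (sqrt C + 1))"
      using e C by (intro le) (auto simp: add_nonneg_pos)
    also have "\<dots> \<le> 0 + e"
      using e C by (simp add: divide_simps add_nonneg_pos)
    finally show "measure M N \<le> 0 + e" .
  qed
  then show "N \<in> null_sets M"
    using N by (auto simp: null_sets_def emeasure_eq_measure measure_nonneg intro: antisym)
qed

text \<open>The law is tested on its own truncated density: \<open>\<integral>f^2 \<le>
  \<integral>\<rho> f = \<integral>f dM \<le> sqrt C * (\<integral>f^2)^(1/2)\<close>. Truncating
  height and support makes the norm finite, so that it can be divided out. As \<open>f\<close> is
  merely measurable, the last inequality is first obtained for continuous approximations.\<close>

lemma integral_square_truncated_density:
  fixes f \<rho> :: "real \<Rightarrow> real"
  assumes C: "C \<ge> 0"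
    and corr: "\<And>r. r > 0 \<Longrightarrow> (\<integral>\<^sup>+x. \<integral>\<^sup>+y. (if \<bar>x - y\<bar> < r then 1 else 0) \<partial>M \<partial>M) \<le> ennreal (C * r)"
    and \<rho> [measurable]: "\<rho> \<in> borel_measurable borel" and \<rho>0: "\<And>x. 0 \<le> \<rho> x"
    and M: "M = density lborel (\<lambda>x. ennreal (\<rho> x))"
    and f: "\<And>x. f x = min (\<rho> x) b * indicator {- b..b} x" and b: "b \<ge> 0"
  shows "(\<integral>\<^sup>+x. ennreal ((f x)\<^sup>2) \<partial>lborel) \<le> ennreal C"
proof -
  have ac: "absolutely_continuous lborel M"
    by (rule absolutely_continuous_if_correlation[OF C corr])
  have f_meas [measurable]: "f \<in> borel_measurable borel"
    unfolding f by measurable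
  have f0: "0 \<le> f x" and fb: "f x \<le> b" and f\<rho>: "f x \<le> \<rho> x" for x
    using \<rho>0[of x] b by (auto simp: f indicator_def)
  obtain N g where N: "negligible N" and g: "\<And>n. continuous_on UNIV (g n)"
    "\<And>x. x \<notin> N \<Longrightarrow> (\<lambda>n::nat. g n x) \<longlonglongrightarrow> f x"
  proof -
    have "f measurable_on UNIV"
      by (rule lebesgue_measurable_imp_measurable_on) (auto intro: measurable_completion)
    then show ?thesis using that unfolding measurable_on_def by auto
  qed
  \<comment> \<open>\<open>\<eta>\<close> is 1 on \<open>[-b, b]\<close> and 0 off
    \<open>[-(b + 1), b + 1]\<close>. Clipping and cutting off keep the approximants continuous,
    bounded by \<open>b\<close>, and dominated by one \<open>lborel\<close>-integrable
    function.\<close>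
  define \<eta> where "\<eta> x = max 0 (min 1 (b + 1 - \<bar>x\<bar>))" for x :: real
  define G where "G n x = max 0 (min b (g n x)) * \<eta> x" for n x
  define w where "w x = indicat_real {- (b + 1)..b + 1} x" for x
  have G_cont: "continuous_on UNIV (G n)" for n
    unfolding G_def \<eta>_def by (intro continuous_intros g)
  have G_meas [measurable]: "G n \<in> borel_measurable borel" for n
    by (rule borel_measurable_continuous_onI[OF G_cont])
  have G0: "0 \<le> G n x" for n x by (simp add: G_def \<eta>_def)
  have G_le: "G n x \<le> b * w x" for n x
  proof (cases "x \<in> {- (b + 1)..b + 1}")
    case True
    then show ?thesis
      using b mult_mono[of "max 0 (min b (g n x))" b "\<eta> x" 1] by (simp add: G_def w_def \<eta>_def)
  next
    case False
    then have "\<eta> x = 0" by (auto simp: \<eta>_def)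
    then show ?thesis using b by (simp add: G_def w_def)
  qed
  have G_lim: "(\<lambda>n. G n x) \<longlonglongrightarrow> f x" if "x \<notin> N" for x
  proof -
    have "(\<lambda>n. G n x) \<longlonglongrightarrow> max 0 (min b (f x)) * \<eta> x"
      unfolding G_def by (intro tendsto_intros g that)
    also have "max 0 (min b (f x)) * \<eta> x = f x"
    proof (cases "x \<in> {- b..b}")
      case True
      then have "\<eta> x = 1" by (auto simp: \<eta>_def)
      then show ?thesis using f0[of x] fb[of x] by simp
    next
      case False
      then show ?thesis using b by (simp add: f)
    qed
    finally show ?thesis .
  qed
  have AE_N: "AE x in lborel. x \<notin> N"
  proof -
    have "AE x in lebesgue. x \<notin> N"
      using N unfolding negligible_iff_null_sets by (rule AE_not_in)
    then show ?thesis by (simp only: AE_completion_iff)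
  qed
  then have AE_lborel: "AE x in lborel. (\<lambda>n. G n x) \<longlonglongrightarrow> f x"
    by eventually_elim (rule G_lim)
  \<comment> \<open>Convergence holds off a Lebesgue null set; absolute continuity carries it over
    to \<open>M\<close>.\<close>
  have AE_M: "AE x in M. (\<lambda>n. G n x) \<longlonglongrightarrow> f x"
    by (rule absolutely_continuous_AE[OF _ ac AE_lborel]) simp
  have w_int: "integrable lborel w"
    unfolding w_def by (intro integrable_real_indicator) (auto simp: emeasure_lborel_Icc_eq)
  have w2_int: "integrable lborel (\<lambda>x. b\<^sup>2 * w x)"
    by (intro integrable_mult_right w_int)
  have G2_le: "(G n x)\<^sup>2 \<le> b\<^sup>2 * w x" for n x
  proof -
    have "(w x)\<^sup>2 = w x" by (simp add: w_def indicator_def)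
    then show ?thesis
      using power_mono[OF G_le G0, of n x 2] by (simp only: power_mult_distrib)
  qed
  have G2_int: "integrable lborel (\<lambda>x. (G n x)\<^sup>2)" for n
  proof (rule Bochner_Integration.integrable_bound[OF w2_int])
    show "AE x in lborel. norm ((G n x)\<^sup>2) \<le> norm (b\<^sup>2 * w x)"
      using order_trans[OF G2_le abs_ge_self] by simp
  qed measurable
  have lim2: "(\<lambda>n. LINT x|lborel. (G n x)\<^sup>2) \<longlonglongrightarrow> (LINT x|lborel. (f x)\<^sup>2)"
  proof (rule integral_dominated_convergence[OF _ _ w2_int])
    show "AE x in lborel. (\<lambda>n. (G n x)\<^sup>2) \<longlonglongrightarrow> (f x)\<^sup>2"
      using AE_lborel by eventually_elim (rule tendsto_power)
  qed (use G2_le in auto)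
  have Gb: "G n x \<le> b" for n x
    by (rule order_trans[OF G_le]) (use b in \<open>simp add: w_def indicator_def\<close>)
  have G_int: "integrable M (G n)" for n
    by (rule integrable_const_bound[of _ b]) (use G0 Gb in auto)
  have lim1: "(\<lambda>n. LINT x|M. G n x) \<longlonglongrightarrow> (LINT x|M. f x)"
    by (rule integral_dominated_convergence[where w = "\<lambda>_. b"])
      (use AE_M G0 Gb in auto)
  have G_bound: "(LINT x|M. G n x) \<le> sqrt C * sqrt (LINT x|lborel. (G n x)\<^sup>2)" for n
  proof -
    have "(\<integral>\<^sup>+x. ennreal (G n x) \<partial>M) \<le> ennreal (sqrt C * sqrt (LINT x|lborel. (G n x)\<^sup>2))"
    proof (rule nn_integral_le_L2[OF C corr])
      show "\<exists>\<delta>>0. \<forall>t. x \<le> t \<and> t < x + \<delta> \<longrightarrow> a \<le> G n t" if "a < G n x" for x a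
      proof -
        have "isCont (G n) x"
          using G_cont by (simp add: continuous_on_eq_continuous_at)
        moreover have "0 < G n x - a"
          using that by simp
        ultimately obtain \<delta> where \<delta>: "\<delta> > 0" "\<And>t. dist t x < \<delta> \<Longrightarrow> dist (G n t) (G n x) < G n x - a"
          unfolding continuous_at_eps_delta by blast
        have "a \<le> G n t" if "x \<le> t" "t < x + \<delta>" for t
          using \<delta>(2)[of t] that by (auto simp: dist_real_def abs_less_iff)
        with \<delta>(1) show ?thesis by blast
      qed
      show "(\<integral>\<^sup>+t. ennreal ((G n t)\<^sup>2) \<partial>lborel) \<le> ennreal ((sqrt (LINT x|lborel. (G n x)\<^sup>2))\<^sup>2)"
        using G2_int by (subst nn_integral_eq_integral) auto
    qed (auto simp: G0)
    then show ?thesis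
      using C by (subst (asm) nn_integral_eq_integral) (auto simp: G_int G0)
  qed
  have fM: "(LINT x|M. f x) \<le> sqrt C * sqrt (LINT x|lborel. (f x)\<^sup>2)"
    by (rule LIMSEQ_le[OF lim1 tendsto_mult[OF tendsto_const tendsto_real_sqrt[OF lim2]]])
      (use G_bound in blast)
  have f_int: "integrable M f"
    by (rule integrable_const_bound[of _ b]) (use f0 fb in auto)
  have f2_int: "integrable lborel (\<lambda>x. (f x)\<^sup>2)"
  proof (rule Bochner_Integration.integrable_bound[OF w2_int])
    have "(f x)\<^sup>2 \<le> b\<^sup>2 * w x" for x
      using power_mono[OF fb f0, of x 2] b by (auto simp: w_def f indicator_def)
    from order_trans[OF this abs_ge_self]
    show "AE x in lborel. norm ((f x)\<^sup>2) \<le> norm (b\<^sup>2 * w x)"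
      by simp
  qed measurable
  have "(LINT x|lborel. (f x)\<^sup>2) \<le> (LINT x|lborel. \<rho> x *\<^sub>R f x)"
  proof (rule integral_mono[OF f2_int])
    show "integrable lborel (\<lambda>x. \<rho> x *\<^sub>R f x)"
      using f_int \<rho>0 unfolding M by (subst (asm) integrable_density) auto
    show "(f x)\<^sup>2 \<le> \<rho> x *\<^sub>R f x" for x
      using f\<rho>[of x] f0[of x] by (simp add: power2_eq_square mult_right_mono)
  qed
  also have "\<dots> = (LINT x|M. f x)"
    using \<rho>0 unfolding M by (subst integral_density) auto
  also note fM
  finally have J: "(LINT x|lborel. (f x)\<^sup>2) \<le> sqrt C * sqrt (LINT x|lborel. (f x)\<^sup>2)" .
  define s where "s = sqrt (LINT x|lborel. (f x)\<^sup>2)"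
  have s: "s \<ge> 0" "s\<^sup>2 = (LINT x|lborel. (f x)\<^sup>2)"
    by (auto simp: s_def)
  have "s * s \<le> sqrt C * s" using J s by (simp add: s_def power2_eq_square)
  then have "s \<le> sqrt C"
    using s(1) C by (cases "s = 0") auto
  then have "s\<^sup>2 \<le> (sqrt C)\<^sup>2" using s by (intro power_mono)
  then have "(LINT x|lborel. (f x)\<^sup>2) \<le> C" using s C by simp
  then show ?thesis
    using f2_int by (subst nn_integral_eq_integral) (auto intro: ennreal_leI)
qed

text \<open>At each point the truncations of the Radon-Nikodym density eventually agree with it, so
  Fatou's lemma transfers their uniform bound \<open>C\<close>.\<close>

lemma square_integrable_density_if_char:
  assumes "square_integrable (char M)"
  shows "absolutely_continuous lborel M"
    and "\<exists>\<rho>. (\<forall>x. 0 \<le> \<rho> x) \<and> square_integrable \<rho> \<and> M = density lborel (\<lambda>x. ennreal (\<rho> x))"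
proof -
  define C where "C = 2 * (LINT u|lborel. (cmod (char M u))\<^sup>2)"
  have C: "C \<ge> 0" by (simp add: C_def)
  have corr: "(\<integral>\<^sup>+x. \<integral>\<^sup>+y. (if \<bar>x - y\<bar> < r then 1 else 0) \<partial>M \<partial>M) \<le> ennreal (C * r)" if "r > 0" for r
    unfolding C_def by (rule pair_correlation_le[OF assms that])
  show ac: "absolutely_continuous lborel M"
    by (rule absolutely_continuous_if_correlation[OF C corr])
  obtain h where h [measurable]: "h \<in> borel_measurable lborel" and h_eq: "density lborel h = M"
    using sigma_finite_measure.Radon_Nikodym[OF sigma_finite_lborel ac] by auto
  have "(\<integral>\<^sup>+x. h x \<partial>lborel) = emeasure (density lborel h) UNIV"
    by (subst emeasure_density) auto
  also have "\<dots> = 1" unfolding h_eq using emeasure_space_1 by simp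
  finally have "AE x in lborel. h x \<noteq> \<infinity>"
    by (intro nn_integral_PInf_AE) auto
  \<comment> \<open>\<open>enn2real\<close> alters \<open>h\<close> only where it is infinite, a
    null set because \<open>M\<close> has mass 1.\<close>
  define \<rho> where "\<rho> x = enn2real (h x)" for x
  have \<rho> [measurable]: "\<rho> \<in> borel_measurable borel"
    unfolding \<rho>_def using h by (simp add: measurable_lborel1)
  have \<rho>0: "0 \<le> \<rho> x" for x by (simp add: \<rho>_def)
  have M: "M = density lborel (\<lambda>x. ennreal (\<rho> x))"
    unfolding h_eq[symmetric]
  proof (rule density_cong)
    show "AE x in lborel. h x = ennreal (\<rho> x)"
      using \<open>AE x in lborel. h x \<noteq> \<infinity>\<close> by eventually_elim (simp add: \<rho>_def less_top)
  qed auto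
  define f where "f n x = min (\<rho> x) (real n) * indicator {- real n..real n} x" for n x
  have f2: "(\<integral>\<^sup>+x. ennreal ((f n x)\<^sup>2) \<partial>lborel) \<le> ennreal C" for n
    by (rule integral_square_truncated_density[OF C corr \<rho> \<rho>0 M f_def]) auto
  have "(\<integral>\<^sup>+x. ennreal ((\<rho> x)\<^sup>2) \<partial>lborel) = (\<integral>\<^sup>+x. liminf (\<lambda>n. ennreal ((f n x)\<^sup>2)) \<partial>lborel)"
  proof (intro nn_integral_cong)
    fix x
    obtain n0 :: nat where n0: "max (\<rho> x) \<bar>x\<bar> \<le> real n0"
      using real_arch_simple by blast
    have "\<forall>\<^sub>F n in sequentially. ennreal ((f n x)\<^sup>2) = ennreal ((\<rho> x)\<^sup>2)"
      using eventually_ge_at_top[of n0]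
    proof eventually_elim
      case (elim n)
      then have "max (\<rho> x) \<bar>x\<bar> \<le> real n" using n0 by simp
      then show ?case by (auto simp: f_def indicator_def)
    qed
    then have "(\<lambda>n. ennreal ((f n x)\<^sup>2)) \<longlonglongrightarrow> ennreal ((\<rho> x)\<^sup>2)"
      by (rule tendsto_eventually)
    then show "ennreal ((\<rho> x)\<^sup>2) = liminf (\<lambda>n. ennreal ((f n x)\<^sup>2))"
      by (rule lim_imp_Liminf[OF sequentially_bot, symmetric])
  qed
  also have "\<dots> \<le> liminf (\<lambda>n. \<integral>\<^sup>+x. ennreal ((f n x)\<^sup>2) \<partial>lborel)"
    by (rule nn_integral_liminf) (simp add: f_def)
  also have "\<dots> \<le> limsup (\<lambda>n. \<integral>\<^sup>+x. ennreal ((f n x)\<^sup>2) \<partial>lborel)"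
    by (rule Liminf_le_Limsup) simp
  also have "\<dots> \<le> ennreal C"
    by (rule Limsup_bounded) (simp add: f2)
  finally have "(\<integral>\<^sup>+x. ennreal ((\<rho> x)\<^sup>2) \<partial>lborel) \<le> ennreal C" .
  then have "(\<integral>\<^sup>+x. ennreal ((\<rho> x)\<^sup>2) \<partial>lborel) < \<infinity>"
    using ennreal_less_top le_less_trans by (metis infinity_ennreal_def)
  then have "square_integrable \<rho>"
    unfolding square_integrable_def by (auto intro!: integrableI_bounded)
  with \<rho>0 M show "\<exists>\<rho>. (\<forall>x. 0 \<le> \<rho> x) \<and> square_integrable \<rho> \<and> M = density lborel (\<lambda>x. ennreal (\<rho> x))"
    by blast
qed

end

theorem theorem4p23:
  fixes m :: nat and \<gamma> \<xi> :: real
  assumes "m \<ge> 7"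
    and "\<gamma> = 2 powr (- 1 / real m)"
    and "\<xi> \<in> {0..1}"
  shows "(\<forall>(M :: 'a measure) X. rademacher_sequence M X \<longrightarrow> square_integrable (chaos_char M X \<gamma> \<xi>))
     \<and> has_square_integrable_occupation_density (takagi \<gamma>)"
proof (intro conjI allI impI)
  note \<gamma> = gamma_bounds[OF assms(1,2)]
  show "square_integrable (chaos_char M X \<gamma> \<xi>)" if "rademacher_sequence M X"
    for M :: "'a measure" and X
    using assms(1,2) that by (rule chaos_char_square_integrable)
  show "has_square_integrable_occupation_density (takagi \<gamma>)"
    unfolding has_square_integrable_occupation_density_def
    using takagi_occupation_distribution[OF \<gamma>(1,2)]
      real_distribution.square_integrable_density_if_char[OF takagi_occupation_distribution(2)[OF \<gamma>(1,2)]
        char_takagi_square_integrable[OF assms(1,2)]]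
    by blast
qed

end
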